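(* Fix $k\ge2$ and $0<D<1$. For any $\alpha>D$, there is $c>0$ such that for $L$ sufficiently large (fixed, depending on $k$, $D$, $\alpha$) the following holds with probability $1-O(e^{-n^c})$ as $n\to\infty$. Let $G$ be a random $k$-generator group at density $D$ and length $n$, let $r$ be one of its relators (chosen in advance, say the first), and let $S$ be a beaded surface constructed from $r$ with trivalent spine $Y$ all of whose edges have length at least $L$. Then $S$ is $\alpha$-convex with respect to the random presentation of $G$.
   Context: Density model: a random $k$-generator group at density $D$ and length $n$ is $G=\langle x_1,\dots,x_k\mid r_1,\dots,r_\ell\rangle$ with $\ell=(2k-1)^{Dn}$ and the $r_i$ chosen independently and uniformly from the cyclically reduced cyclic words of length $n$ in the $x_i^{\pm1}$. Fatgraphs. A fatgraph is a graph $Y$ with a cyclic order on the edges incident to each vertex; it fattens canonically to an oriented surface $S(Y)$ deformation retracting to $Y$. All fatgraphs come with a simplicial map to the rose $X$ of $F_k=\langle x_1,\dots,x_k\rangle$, so that $\partial S(Y)$ is a collection of cyclic words; $Y$ is folded if the map $Y\to X$ is locally injective. A tag on a cyclic word is a vertex of it together with the germ of an additional edge attached there; tags are counted as edges in computing valences and as vertices in computing edge lengths of fatgraphs bounding tagged cyclic words. Beaded surfaces. Fix sufficiently small constants $C,\delta>0$ (with $C<(1-2\delta)/\log(2k-1)$), a (large) constant $L$, and a positive integer $N$ depending only on $L$ (the multiplicity provided by the theorem that homologically trivial collections of sufficiently pseudorandom tagged loops with few well-spaced tags have $N$ copies bounding a trivalent fatgraph with all edges of length at least $L$). A bead decomposition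 of $r$ is a decomposition of $r$ into segments labelled, in cyclic order, $r_0,r_1^+,\dots,r_{M-1}^+,r_M,r_{M-1}^-,\dots,r_1^-$, where each $r_i^\pm$ has length $n^{1-\delta}(1/2+o(1))$ and $r_0,r_M$ have length $n^{1-\delta}(1+o(1))$ (so $M=n^\delta(1+o(1))$), such that the prefix of $r_i^+$ of length $C\log n$ is inverse to the suffix of $r_i^-$ of length $C\log n$, and the prefix of $r_M$ of length $C\log n$ is inverse to the suffix of $r_M$ of that length. It is constructed as follows: start at an arbitrary location of $r$, the approximate midpoint of $r_0$; extend by $n^{1-\delta}(1/2-n^{-\delta})$ in both directions, then read the next pair of segments of length $n^{1-2\delta}$ synchronously in the two directions until the first time a pair of mutually inverse segments of length $C\log n$ is found; then continue in the same way to build the successive $r_i^\pm$. Gluing the mutually inverse segments (the resulting edges of length $C\log n$ are called lips) decomposes $r$ into tagged cyclic words (beads) $B_0,\dots,B_M$. Do the same for $r^{-1}$, with inverse beads $B_i^{-1}$. For each $i$ choose, in a way depending only on the subwords $r_i^\pm$ (respectively $r_0$, $r_M$), a trivalent fatgraph $Y_i$ with all edges of length at least $L$ whose boundary is $N$ copies of $B_i$ and $N$ copies of $B_i^{-1}$. (For random $r$ of length $n$, the bead decomposition and all the $Y_i$ exist with probability $1-O(e^{-n^c})$ for some $c>0$.) Let $Y$ be the union of the $Y_i$ joined along the lips; it is a trivalent folded fatgraph with all edges of length at least $L$ and $\partial S(Y)$ is $N$ copies of $r$ and $N$ copies of $r^{-1}$. The beaded surface $S$ is the closed oriented surface obtained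 by gluing $2N$ disks to $S(Y)$, each mapping to the $2$-cell of the presentation complex corresponding to $r$; $Y$ is its spine. $\alpha$-convexity. $S$ is $\alpha$-convex with respect to the presentation if for every immersed path $\gamma$ in $Y$ whose label is a subword of some $r_i^{\pm1}$ (as cyclic word), $r_i$ a relator, with $|\gamma|/|r_i|\ge\alpha$, the path $\gamma$ is contained in $\partial S(Y)$, i.e. is contained in the boundary of a disk of $S$. *)

theory Defs
  imports
    "HOL-Probability.Probability"
    "HOL-Library.Sublist"
    "HOL-Library.Landau_Symbols"
    "HOL-Combinatorics.Orbits"
begin

section \<open>Words, cyclic words and random presentations\<close>

text \<open>
  \<open>Gen i True\<close> and \<open>Gen i False\<close> are the \<open>i\<close>-th free generator and its inverse (generators are
  numbered from 0). \<open>Tag\<close> marks the position of a tag on a word; on the words of the presentation it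
  never occurs. A bead carries at most one tag leading back to the previous bead (\<open>Tag False\<close>) and
  at most one leading on to the next bead (\<open>Tag True\<close>).
\<close>

datatype symbol = Gen nat bool | Tag bool

type_synonym word = "symbol list"

fun inv_symbol :: "symbol \<Rightarrow> symbol" where
  "inv_symbol (Gen i b) = Gen i (\<not> b)"
| "inv_symbol (Tag b) = Tag b"

definition inv_word :: "word \<Rightarrow> word" where
  "inv_word w = rev (map inv_symbol w)"

definition slice :: "'a list \<Rightarrow> nat \<Rightarrow> nat \<Rightarrow> 'a list" where
  "slice w a b = take (b - a) (drop a w)"

text \<open>A cyclic word is the set of all its linear representatives.\<close>

definition cyc :: "word \<Rightarrow> word set" where
  "cyc w = {rotate i w | i. True}"

definition cyc_reduced_words :: "nat \<Rightarrow> nat \<Rightarrow> word set" where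
  "cyc_reduced_words k n =
     {w. length w = n \<and> set w \<subseteq> {Gen i b | i b. i < k} \<and>
         successively (\<lambda>a b. b \<noteq> inv_symbol a) w \<and>
         (w \<noteq> [] \<longrightarrow> hd w \<noteq> inv_symbol (last w))}"

definition cyclic_words :: "nat \<Rightarrow> nat \<Rightarrow> word set set" where
  "cyclic_words k n = cyc ` cyc_reduced_words k n"

definition num_relators :: "nat \<Rightarrow> real \<Rightarrow> nat \<Rightarrow> nat" where
  "num_relators k D n = nat \<lfloor>(2 * real k - 1) powr (D * real n)\<rfloor>"

definition random_relators :: "nat \<Rightarrow> real \<Rightarrow> nat \<Rightarrow> (nat \<Rightarrow> word set) pmf" where
  "random_relators k D n =
     Pi_pmf {..<num_relators k D n} {} (\<lambda>_. pmf_of_set (cyclic_words k n))"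


section \<open>Fatgraphs\<close>

text \<open>
  A fatgraph over the rose is given by its half-edges, after subdivision so that every edge maps to
  a single edge of the rose: \<open>opp\<close> exchanges the two halves of an edge, \<open>nxt\<close> is the cyclic order
  around the vertices (so the vertices are the orbits of \<open>nxt\<close>), and \<open>lab h\<close> is the label of the edge
  of \<open>h\<close> read away from the vertex at which \<open>h\<close> is attached. Half-edges fixed by \<open>opp\<close> are tags.
  A half-edge that is not a tag also stands for its edge, oriented away from that vertex.
\<close>

record 'h fatgraph =
  hedges :: "'h set"
  opp :: "'h \<Rightarrow> 'h"
  nxt :: "'h \<Rightarrow> 'h"
  lab :: "'h \<Rightarrow> symbol"

definition fatgraph :: "'h fatgraph \<Rightarrow> bool" where
  "fatgraph Y \<longleftrightarrow>
     finite (hedges Y) \<and>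
     bij_betw (nxt Y) (hedges Y) (hedges Y) \<and>
     (\<forall>h\<in>hedges Y. opp Y h \<in> hedges Y \<and> opp Y (opp Y h) = h \<and>
        lab Y (opp Y h) = inv_symbol (lab Y h) \<and>
        (opp Y h = h \<longleftrightarrow> (\<exists>b. lab Y h = Tag b)))"

definition tags :: "'h fatgraph \<Rightarrow> 'h set" where
  "tags Y = {h \<in> hedges Y. opp Y h = h}"

definition vertex :: "'h fatgraph \<Rightarrow> 'h \<Rightarrow> 'h set" where
  "vertex Y h = orbit (nxt Y) h"

definition valence :: "'h fatgraph \<Rightarrow> 'h \<Rightarrow> nat" where
  "valence Y h = card (vertex Y h)"

text \<open>
  \<open>bd_next\<close> runs along the boundary of the fattened surface, so the boundary components are its
  orbits. At a tag it stays at the same vertex, so that the tag shows up, as a symbol of its own, in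
  the boundary word at the place where it is attached.
\<close>

definition bd_next :: "'h fatgraph \<Rightarrow> 'h \<Rightarrow> 'h" where
  "bd_next Y h = nxt Y (opp Y h)"

definition face :: "'h fatgraph \<Rightarrow> 'h \<Rightarrow> 'h set" where
  "face Y h = orbit (bd_next Y) h"

definition face_word :: "'h fatgraph \<Rightarrow> 'h set \<Rightarrow> word set" where
  "face_word Y f = {map (\<lambda>j. lab Y ((bd_next Y ^^ j) h)) [0..<card f] | h. h \<in> f}"

definition boundary :: "'h fatgraph \<Rightarrow> word set multiset" where
  "boundary Y = image_mset (face_word Y) (mset_set (face Y ` hedges Y))"

text \<open>The vertices of valence 2 without tags are interior points of subdivided edges.\<close>

definition trivalent :: "'h fatgraph \<Rightarrow> bool" where
  "trivalent Y \<longleftrightarrow>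
     (\<forall>h\<in>hedges Y. valence Y h = 3 \<or> (valence Y h = 2 \<and> vertex Y h \<inter> tags Y = {}))"

text \<open>
  All edges of a trivalent fatgraph have length at least \<open>L\<close>. As long as only vertices of valence 2
  are met, \<open>bd_next\<close> moves along the edge on which it started.
\<close>

definition long_edges :: "nat \<Rightarrow> 'h fatgraph \<Rightarrow> bool" where
  "long_edges L Y \<longleftrightarrow>
     (\<forall>h \<in> hedges Y - tags Y. valence Y h = 3 \<longrightarrow>
        (\<forall>j\<in>{1..<L}. valence Y ((bd_next Y ^^ j) h) = 2))"

definition folded :: "'h fatgraph \<Rightarrow> bool" where
  "folded Y \<longleftrightarrow> (\<forall>h\<in>hedges Y. inj_on (lab Y) (vertex Y h))"

definition immersed_path :: "'h fatgraph \<Rightarrow> 'h list \<Rightarrow> bool" where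
  "immersed_path Y \<gamma> \<longleftrightarrow>
     set \<gamma> \<subseteq> hedges Y - tags Y \<and>
     successively (\<lambda>d e. e \<in> vertex Y (opp Y d) \<and> e \<noteq> opp Y d) \<gamma>"

definition boundary_path :: "'h fatgraph \<Rightarrow> 'h list \<Rightarrow> bool" where
  "boundary_path Y \<gamma> \<longleftrightarrow>
     set \<gamma> \<subseteq> hedges Y \<and> successively (\<lambda>d e. e = bd_next Y d) \<gamma>"

definition reverse_path :: "'h fatgraph \<Rightarrow> 'h list \<Rightarrow> 'h list" where
  "reverse_path Y \<gamma> = rev (map (opp Y) \<gamma>)"

text \<open>Containment in the boundary is as an unoriented path.\<close>

definition in_boundary :: "'h fatgraph \<Rightarrow> 'h list \<Rightarrow> bool" where
  "in_boundary Y \<gamma> \<longleftrightarrow> boundary_path Y \<gamma> \<or> boundary_path Y (reverse_path Y \<gamma>)"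

definition disjoint_union :: "'i set \<Rightarrow> ('i \<Rightarrow> 'h fatgraph) \<Rightarrow> ('i \<times> 'h) fatgraph" where
  "disjoint_union I Ys =
     \<lparr> hedges = (SIGMA i:I. hedges (Ys i)),
       opp = (\<lambda>(i, h). (i, opp (Ys i) h)),
       nxt = (\<lambda>(i, h). (i, nxt (Ys i) h)),
       lab = (\<lambda>(i, h). lab (Ys i) h) \<rparr>"

text \<open>
  Join each tag \<open>h\<close> to the tag \<open>\<mu> h\<close> by a segment that reads \<open>lip h\<close> from \<open>h\<close> to \<open>\<mu> h\<close>; so \<open>\<mu>\<close>
  should be a fixed-point free involution of the tags, and \<open>lip (\<mu> h)\<close> the inverse of \<open>lip h\<close>. The
  pair \<open>(h, j)\<close> is the half-edge at distance \<open>j\<close> from the vertex of \<open>h\<close> on this segment, directed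
  towards \<open>\<mu> h\<close>. A half-edge \<open>h\<close> which is not a tag becomes \<open>(h, 0)\<close>.
\<close>

definition join_tags :: "'h fatgraph \<Rightarrow> ('h \<Rightarrow> 'h) \<Rightarrow> ('h \<Rightarrow> word) \<Rightarrow> ('h \<times> nat) fatgraph" where
  "join_tags Y \<mu> lip =
     \<lparr> hedges = {(h, j). h \<in> hedges Y \<and> (if h \<in> tags Y then j < length (lip h) else j = 0)},
       opp = (\<lambda>(h, j). if h \<in> tags Y then (\<mu> h, length (lip h) - 1 - j) else (opp Y h, 0)),
       nxt = (\<lambda>(h, j). if j = 0 then (nxt Y h, 0) else (\<mu> h, length (lip h) - j)),
       lab = (\<lambda>(h, j). if h \<in> tags Y then lip h ! j else lab Y h) \<rparr>"


section \<open>Bead decompositions\<close>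

text \<open>
  A word \<open>w\<close> of length \<open>n\<close> is a relator read from the arbitrarily chosen midpoint of its first
  segment \<open>r\<^sub>0\<close>. Reading \<open>w\<close> synchronously in the two directions, one meets at distance \<open>p\<close> from the
  midpoint the letters \<open>w ! p\<close> and \<open>w ! (n - 1 - p)\<close>.
\<close>

definition lip_length :: "real \<Rightarrow> nat \<Rightarrow> nat" where
  "lip_length C n = nat \<lfloor>C * ln (real n)\<rfloor>"

definition stem_length :: "real \<Rightarrow> nat \<Rightarrow> nat" where
  "stem_length \<delta> n =
     nat \<lfloor>real n powr (1 - \<delta>) * (1 / 2 - real n powr (- \<delta>))\<rfloor>"

definition scan_length :: "real \<Rightarrow> nat \<Rightarrow> nat" where
  "scan_length \<delta> n = nat \<lfloor>real n powr (1 - 2 * \<delta>)\<rfloor>"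

text \<open>
  At distance \<open>t\<close> starts a pair of mutually inverse segments of length exactly \<open>m\<close>, that is, which
  cannot be extended at either end. If it could be, then one of the two loops obtained by gluing the
  two segments would backtrack at its tag, and so would not bound a folded fatgraph.
\<close>

definition lip_at :: "nat \<Rightarrow> word \<Rightarrow> nat \<Rightarrow> bool" where
  "lip_at m w t \<longleftrightarrow> (let n = length w in
     slice w t (t + m) = inv_word (slice w (n - (t + m)) (n - t)) \<and>
     w ! (t - 1) \<noteq> inv_symbol (w ! (n - t)) \<and>
     w ! (t + m) \<noteq> inv_symbol (w ! (n - 1 - (t + m))))"

text \<open>The next cut after the one at distance \<open>a\<close> is at distance \<open>b\<close>.\<close>

definition next_cut :: "real \<Rightarrow> real \<Rightarrow> word \<Rightarrow> nat \<Rightarrow> nat \<Rightarrow> bool" where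
  "next_cut C \<delta> w a b \<longleftrightarrow>
     (let n = length w; m = lip_length C n; s = a + stem_length \<delta> n in
        s \<le> b \<and> b + m \<le> s + scan_length \<delta> n \<and>
        lip_at m w b \<and> (\<forall>t\<in>{s..<b}. \<not> lip_at m w t))"

text \<open>
  \<open>cuts\<close> lists the distances from the midpoint of \<open>r\<^sub>0\<close> at which \<open>r\<^sub>1\<^sup>+, \<dots>, r\<^sub>M\<close> start; the
  construction is symmetric, so \<open>r\<^sub>i\<^sup>-\<close> lies opposite to \<open>r\<^sub>i\<^sup>+\<close>. The construction determines the
  lengths of all segments except for \<open>r\<^sub>M\<close>, which is what is left over. The bounds imposed on it allow
  at least every length \<open>n powr (1 - \<delta>) * (1 + o(1))\<close> as soon as \<open>n\<close> is large; as a step of the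
  construction uses up at most \<open>n powr (1 - \<delta>)\<close> letters, they can always be met.
\<close>

definition bead_decomposition :: "real \<Rightarrow> real \<Rightarrow> word \<Rightarrow> nat list \<Rightarrow> bool" where
  "bead_decomposition C \<delta> w cuts \<longleftrightarrow>
     cuts \<noteq> [] \<and> successively (next_cut C \<delta> w) (0 # cuts) \<and>
     (let n = real (length w); rest = n - 2 * real (last cuts) in
        n powr (1 - \<delta>) / 2 \<le> rest \<and> rest \<le> 3 / 2 * n powr (1 - \<delta>))"

datatype segment =
    First word        \<comment> \<open>\<open>r\<^sub>0\<close>\<close>
  | Middle word word  \<comment> \<open>\<open>r\<^sub>i\<^sup>+\<close> and \<open>r\<^sub>i\<^sup>-\<close> for \<open>0 < i < M\<close>\<close>
  | Last word         \<comment> \<open>\<open>r\<^sub>M\<close>\<close>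

definition segment_of :: "word \<Rightarrow> nat list \<Rightarrow> nat \<Rightarrow> segment" where
  "segment_of w cuts i = (let n = length w; M = length cuts in
     if i = 0 then First (drop (n - cuts ! 0) w @ take (cuts ! 0) w)
     else if i < M then
       Middle (slice w (cuts ! (i - 1)) (cuts ! i)) (slice w (n - cuts ! i) (n - cuts ! (i - 1)))
     else Last (slice w (cuts ! (M - 1)) (n - cuts ! (M - 1))))"

text \<open>
  The tagged loop obtained from a segment (or pair of segments) by gluing up the lips, where \<open>m\<close> is
  the length of the lips. Of the two occurrences of a lip, the prefix of \<open>r\<^sub>i\<^sup>+\<close> and the suffix of
  \<open>r\<^sub>i\<^sup>-\<close>, neither belongs to the bead.
\<close>

fun bead :: "nat \<Rightarrow> segment \<Rightarrow> word" where
  "bead m (First u) = u @ [Tag True]"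
| "bead m (Middle u v) =
     [Tag False] @ drop m u @ [Tag True] @ take (length v - m) v"
| "bead m (Last u) = [Tag False] @ drop m (take (length u - m) u)"

definition copies :: "nat \<Rightarrow> word \<Rightarrow> word set multiset" where
  "copies N w = replicate_mset N (cyc w) + replicate_mset N (cyc (inv_word w))"


section \<open>Beaded surfaces\<close>

text \<open>
  The lip between the beads \<open>i\<close> and \<open>i + 1\<close> is the prefix of the segment starting at \<open>cuts ! i\<close>. This
  is the word read along it when leaving the bead \<open>i\<close> through a tag \<open>Tag b\<close>.
\<close>

definition lip_word :: "nat \<Rightarrow> word \<Rightarrow> nat list \<Rightarrow> nat \<Rightarrow> symbol \<Rightarrow> word" where
  "lip_word m w cuts i b =
     (if b = Tag True then slice w (cuts ! i) (cuts ! i + m)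
      else inv_word (slice w (cuts ! (i - 1)) (cuts ! (i - 1) + m)))"

text \<open>
  \<open>\<mu>\<close> pairs each tag of a bead leading on with one of the next bead leading back, copies of \<open>B\<^sub>i\<close>
  being joined to copies of \<open>B\<^bsub>i+1\<^esub>\<close>, and copies of the inverse of \<open>B\<^sub>i\<close> to copies of the inverse of
  \<open>B\<^bsub>i+1\<^esub>\<close>. In \<open>U\<close>, the first component of a half-edge is the number of its bead.
\<close>

definition tag_pairing :: "(nat \<Rightarrow> word) \<Rightarrow> (nat \<times> 'h) fatgraph \<Rightarrow> (nat \<times> 'h \<Rightarrow> nat \<times> 'h) \<Rightarrow> bool" where
  "tag_pairing B U \<mu> \<longleftrightarrow>
     (\<forall>x\<in>tags U. \<mu> x \<in> tags U \<and> \<mu> (\<mu> x) = x \<and>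
        (lab U x = Tag True \<longrightarrow> fst (\<mu> x) = Suc (fst x) \<and> lab U (\<mu> x) = Tag False) \<and>
        (lab U x = Tag False \<longrightarrow> fst x = Suc (fst (\<mu> x)) \<and> lab U (\<mu> x) = Tag True) \<and>
        (face_word U (face U x) = cyc (B (fst x)) \<longleftrightarrow>
           face_word U (face U (\<mu> x)) = cyc (B (fst (\<mu> x)))))"

text \<open>
  \<open>Y\<close> is the spine of a beaded surface built from the relator \<open>w\<close>, read from the midpoint of \<open>r\<^sub>0\<close>.
  The pieces \<open>Y\<^sub>i\<close> are prescribed by the function \<open>\<Phi>\<close> of the subwords \<open>r\<^sub>i\<^sup>+\<close>, \<open>r\<^sub>i\<^sup>-\<close> (or \<open>r\<^sub>0\<close>,
  \<open>r\<^sub>M\<close>). The closed surface is obtained by gluing a disk to every boundary component of the fattened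
  \<open>Y\<close>; so it is determined by \<open>Y\<close>, and its disks are the orbits of \<open>bd_next Y\<close>. The last line
  records what the construction yields for large \<open>n\<close>: each of the \<open>2 * N\<close> disks can be mapped to the
  2-cell of the relator, and \<open>Y\<close> is a folded trivalent fatgraph with edges of length at least \<open>L\<close>.
\<close>

definition beaded_surface ::
  "real \<Rightarrow> real \<Rightarrow> nat \<Rightarrow> nat \<Rightarrow> (segment \<Rightarrow> 'h fatgraph) \<Rightarrow> word \<Rightarrow> ((nat \<times> 'h) \<times> nat) fatgraph \<Rightarrow> bool"
  where
  "beaded_surface C \<delta> L N \<Phi> w Y \<longleftrightarrow>
     (\<exists>cuts \<mu>.
        let m = lip_length C (length w);
            M = length cuts;
            B = (\<lambda>i. bead m (segment_of w cuts i));
            Ys = (\<lambda>i. \<Phi> (segment_of w cuts i));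
            U = disjoint_union {..M} Ys
        in bead_decomposition C \<delta> w cuts \<and>
           (\<forall>i\<le>M. fatgraph (Ys i) \<and> trivalent (Ys i) \<and> long_edges L (Ys i) \<and>
                  boundary (Ys i) = copies N (B i)) \<and>
           tag_pairing B U \<mu> \<and>
           Y = join_tags U \<mu> (\<lambda>x. lip_word m w cuts (fst x) (lab U x))) \<and>
     fatgraph Y \<and> trivalent Y \<and> folded Y \<and> long_edges L Y \<and> boundary Y = copies N w"


section \<open>Convexity\<close>

text \<open>
  Since a cyclic word consists of all its linear representatives, its subwords are the prefixes of
  its elements.
\<close>

definition alpha_convex :: "real \<Rightarrow> word set set \<Rightarrow> 'h fatgraph \<Rightarrow> bool" where
  "alpha_convex \<alpha> Rels Y \<longleftrightarrow>
     (\<forall>\<gamma> r v. immersed_path Y \<gamma> \<and> r \<in> Rels \<and> v \<in> r \<and>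
        (prefix (map (lab Y) \<gamma>) v \<or> prefix (map (lab Y) \<gamma>) (inv_word v)) \<and>
        real (length \<gamma>) / real (length v) \<ge> \<alpha> \<longrightarrow>
        in_boundary Y \<gamma>)"

end

theory Submission
  imports Defs "HOL-Real_Asymp.Real_Asymp"
begin

text \<open>
  A path in the spine is encoded by the pieces it visits and the choices it makes at branch points.
  Since edges and lips are long, there are only polynomially many times \<open>2 powr (l / L)\<close> labels of
  paths of length \<open>l\<close>, whatever the pairing of the tags is. A relator independent of \<open>r\<close> contains one
  of the labels of length \<open>\<alpha> * n\<close> only with exponentially small probability, even when summed over
  all \<open>(2 * k - 1) powr (D * n)\<close> relators, because \<open>D < \<alpha>\<close>.

  For \<open>r\<close> itself, the piece of a bead depends only on the letters of that bead. So a path of length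
  \<open>n powr c\<close> that avoids a bead is independent of the letters of that bead and does not read them. A
  path reading a subword of \<open>r\<close> must therefore cross each lip at nearly the right time. If it crosses
  one of them at exactly the right time, it agrees there with the boundary, and by foldedness
  everywhere. Otherwise each of about \<open>n powr \<delta>\<close> consecutive lips is repeated nearby. A lip has length
  \<open>C * ln n\<close> and can be resampled independently of all other letters, so each repetition has
  small probability, and all of them together have probability at most \<open>2 powr (- \<epsilon> * n powr \<delta>)\<close>.
\<close>

section \<open>Words and cyclic words\<close>

text \<open>The relator decides both the spine and the word to be read in it, and changing a letter
  may move the cuts. Two kinds of changes stay under control: letters well inside one bead whose
  cuts are prescribed (\<open>core\<close>), and a whole lip together with its mirror image
  (\<open>resample\<close>), where the maximality of lips keeps the cuts in place. Windows have
  length \<open>l\<close>, about n powr e with e = C * ln (2 * k - 1) / 2. A lip has about n powr (2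
  * e) possible labels, while a path that is early or late by at most \<open>l\<close> can repeat it
  in about 4 * \<open>l\<close> ways, so a repetition costs a factor of order n powr (- e). As
  \<open>l\<close> is a power of n, events of probability exponential in - \<open>l\<close> are
  negligible, and the bound on C gives 2 * e < 1 - 2 * \<delta>, so that windows fit into beads.
  Cuts are measured from the midpoint of r_0, so only a stretch of the path within one half of the
  relator is used; the other half is treated by reversing the path. The number \<rho> with \<rho> ^
  L = 2 is the growth rate of paths; L is so large that the paths use up at most half of the
  exponent gained from D < \<alpha>.\<close>

lemma inv_symbol_inv_symbol [simp]: "inv_symbol (inv_symbol s) = s"
  by (cases s) auto

lemma inv_symbol_inj [simp]: "inv_symbol s = inv_symbol t \<longleftrightarrow> s = t"
  by (metis inv_symbol_inv_symbol)

lemma length_inv_word [simp]: "length (inv_word w) = length w"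
  by (simp add: inv_word_def)

lemma inv_word_inv_word [simp]: "inv_word (inv_word w) = w"
  by (simp add: inv_word_def rev_map[symmetric] comp_def)

lemma inv_word_eq_Nil [simp]: "inv_word w = [] \<longleftrightarrow> w = []"
  by (simp add: inv_word_def)

lemma inv_word_Nil [simp]: "inv_word [] = []"
  by (simp add: inv_word_def)

lemma set_inv_word [simp]: "set (inv_word w) = inv_symbol ` set w"
  by (simp add: inv_word_def)

lemma nth_inv_word: "j < length w \<Longrightarrow> inv_word w ! j = inv_symbol (w ! (length w - Suc j))"
  by (simp add: inv_word_def rev_nth)

text \<open>Letters of a cyclic word are addressed by natural numbers read modulo the length. A
  negative offset - x is written as the natural number \<open>length w * x - x\<close>.\<close>

definition cnth :: "'a list \<Rightarrow> nat \<Rightarrow> 'a" where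
  "cnth w j = w ! (j mod length w)"

lemma cnth_nth: "j < length w \<Longrightarrow> cnth w j = w ! j"
  by (simp add: cnth_def)

lemma cnth_cong: "i mod length w = j mod length w \<Longrightarrow> cnth w i = cnth w j"
  by (simp add: cnth_def)

lemma cnth_rotate: "w \<noteq> [] \<Longrightarrow> cnth (rotate x w) j = cnth w (x + j)"
  by (simp add: cnth_def nth_rotate mod_simps)

lemma list_eq_cnth: "length u = length v \<Longrightarrow> (\<And>j. j < length v \<Longrightarrow> cnth u j = cnth v j) \<Longrightarrow> u = v"
  by (intro nth_equalityI) (auto simp: cnth_def)

text \<open>Inversion sends the position j to - 1 - j modulo the length; the divisibility condition
  says this without subtraction.\<close>

lemma cnth_inv_word:
  assumes "w \<noteq> []" "length w dvd Suc (j + c)"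
  shows "cnth (inv_word w) j = inv_symbol (cnth w c)"
proof -
  let ?n = "length w"
  have n: "?n > 0" using assms by simp
  have "?n dvd Suc (j mod ?n + c mod ?n)"
    using assms(2) by (metis Suc_eq_plus1 mod_add_eq mod_add_left_eq mod_eq_0_iff_dvd)
  \<comment> \<open>The sum of two residues plus one lies strictly between 0 and twice the length,
    which leaves only q = 1.\<close>
  then obtain q where q: "Suc (j mod ?n + c mod ?n) = ?n * q" by blast
  have "j mod ?n < ?n" "c mod ?n < ?n" using n by auto
  hence "?n * q < ?n * 2" using q by linarith
  hence "q < 2" using n by (meson mult_less_cancel1)
  moreover have "q \<noteq> 0" using q by (intro notI) simp
  ultimately have "Suc (j mod ?n + c mod ?n) = ?n" using q by (cases q) auto
  hence "c mod ?n = ?n - Suc (j mod ?n)" by linarith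
  thus ?thesis using n by (simp add: cnth_def nth_inv_word)
qed

lemma cyc_iff: "v \<in> cyc w \<longleftrightarrow> (\<exists>x. v = rotate x w)"
  by (auto simp: cyc_def)

lemma cyc_iff_less: "w \<noteq> [] \<Longrightarrow> v \<in> cyc w \<longleftrightarrow> (\<exists>x<length w. v = rotate x w)"
  unfolding cyc_iff by (metis length_greater_0_conv mod_less_divisor rotate_conv_mod)

lemma self_in_cyc: "w \<in> cyc w"
  unfolding cyc_iff by (metis rotate0 id_apply)

lemma cyc_length: "v \<in> cyc w \<Longrightarrow> length v = length w"
  by (auto simp: cyc_def)

lemma cyc_sym: assumes "v \<in> cyc w" shows "w \<in> cyc v"
proof (cases "w = []")
  case False
  obtain x where x: "x < length w" "v = rotate x w" using assms False by (auto simp: cyc_iff_less)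
  have "rotate (length w - x) v = rotate (length w) w"
    unfolding x(2) rotate_rotate using x(1) by simp
  thus ?thesis by (metis cyc_iff rotate_id mod_self)
qed (use assms in \<open>auto simp: cyc_def\<close>)

lemma cyc_trans: "u \<in> cyc v \<Longrightarrow> v \<in> cyc w \<Longrightarrow> u \<in> cyc w"
  by (auto simp: cyc_iff rotate_rotate)

lemma cyc_eq: assumes "v \<in> cyc w" shows "cyc v = cyc w"
  using assms cyc_sym cyc_trans by blast

lemma finite_cyc: "finite (cyc w)" and card_cyc_le: "w \<noteq> [] \<Longrightarrow> card (cyc w) \<le> length w"
proof -
  have *: "cyc w = (\<lambda>x. rotate x w) ` {..<length w}" if "w \<noteq> []"
    using cyc_iff_less[OF that] by auto
  show "finite (cyc w)"
  proof (cases "w = []")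
    case True thus ?thesis by (simp add: cyc_def)
  next
    case False show ?thesis unfolding *[OF False] by simp
  qed
  show "w \<noteq> [] \<Longrightarrow> card (cyc w) \<le> length w"
    unfolding * by (metis card_image_le card_lessThan finite_lessThan)
qed

lemma inv_word_rotate: "\<exists>y. inv_word (rotate x w) = rotate y (inv_word w)"
proof (cases "w = []")
  case False
  let ?n = "length w"
  \<comment> \<open>A natural number congruent to - x, because inversion turns the direction of a
    rotation around.\<close>
  let ?y = "?n * x - x"
  have x: "x \<le> ?n * x" using False by (cases w) auto
  have "inv_word (rotate x w) = rotate ?y (inv_word w)"
  proof (rule list_eq_cnth)
    fix j assume j: "j < length (rotate ?y (inv_word w))"
    have "cnth (inv_word (rotate x w)) j = inv_symbol (cnth (rotate x w) (?n - Suc j))"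
      using j False by (intro cnth_inv_word) auto
    also have "\<dots> = inv_symbol (cnth w (x + (?n - Suc j)))" by (simp add: cnth_rotate False)
    also have "\<dots> = cnth (inv_word w) (?y + j)"
    proof (rule cnth_inv_word[symmetric])
      have "j < ?n" using j by simp
      hence "Suc (?y + j + (x + (?n - Suc j))) = ?n * x + ?n" using x by linarith
      thus "?n dvd Suc (?y + j + (x + (?n - Suc j)))" by (metis dvd_triv_left dvd_add_triv_right_iff)
    qed (use False in auto)
    finally show "cnth (inv_word (rotate x w)) j = cnth (rotate ?y (inv_word w)) j"
      by (simp add: cnth_rotate False)
  qed simp
  thus ?thesis by blast
qed simp

lemma inv_word_in_cyc: "v \<in> cyc w \<Longrightarrow> inv_word v \<in> cyc (inv_word w)"
  unfolding cyc_iff using inv_word_rotate by metis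

section \<open>Reduced and cyclically reduced words, and their number\<close>

definition letters :: "nat \<Rightarrow> symbol set" where
  "letters k = {Gen i b | i b. i < k}"

lemma letters_alt: "letters k = (\<lambda>(i, b). Gen i b) ` ({..<k} \<times> UNIV)"
  by (auto simp: letters_def)

lemma finite_letters [simp]: "finite (letters k)"
  by (simp add: letters_alt)

lemma card_letters: "card (letters k) = 2 * k"
  unfolding letters_alt by (subst card_image) (auto simp: inj_on_def card_cartesian_product)

lemma inv_symbol_letters [simp]: "inv_symbol s \<in> letters k \<longleftrightarrow> s \<in> letters k"
  by (cases s) (auto simp: letters_def)

lemma letters_not_Tag: "s \<in> letters k \<Longrightarrow> s \<noteq> Tag b"
  by (auto simp: letters_def)

definition reduced_words :: "nat \<Rightarrow> nat \<Rightarrow> word set" where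
  "reduced_words k n = {w. length w = n \<and> set w \<subseteq> letters k \<and>
     (\<forall>j. Suc j < n \<longrightarrow> w ! Suc j \<noteq> inv_symbol (w ! j))}"

lemma finite_reduced_words [simp]: "finite (reduced_words k n)"
proof (rule finite_subset)
  show "reduced_words k n \<subseteq> {w. set w \<subseteq> letters k \<and> length w = n}"
    by (auto simp: reduced_words_def)
qed (simp add: finite_lists_length_eq)

text \<open>With cyclic indices the junction of the last and the first letter is one more pair of
  neighbours, so that invariance under rotation and inversion can be read off.\<close>

lemma crw_iff:
  "w \<in> cyc_reduced_words k n \<longleftrightarrow> length w = n \<and> set w \<subseteq> letters k \<and>
     (\<forall>j. w \<noteq> [] \<longrightarrow> cnth w (Suc j) \<noteq> inv_symbol (cnth w j))"
proof (cases "length w = n \<and> w \<noteq> []")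
  case True
  hence n: "n > 0" "length w = n" by auto
  have "(\<forall>j. cnth w (Suc j) \<noteq> inv_symbol (cnth w j)) \<longleftrightarrow>
    (\<forall>j. Suc j < n \<longrightarrow> w ! Suc j \<noteq> inv_symbol (w ! j)) \<and> w ! 0 \<noteq> inv_symbol (w ! (n - 1))"
    (is "?A \<longleftrightarrow> ?B")
  proof
    assume A: ?A
    have "w ! Suc j \<noteq> inv_symbol (w ! j)" if "Suc j < n" for j
      using A that n by (metis Suc_lessD cnth_nth)
    moreover have "w ! 0 \<noteq> inv_symbol (w ! (n - 1))"
      using A[rule_format, of "n - 1"] n by (simp add: cnth_def)
    ultimately show ?B by blast
  next
    assume B: ?B
    show ?A
    proof
      fix j
      show "cnth w (Suc j) \<noteq> inv_symbol (cnth w j)"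
      proof (cases "Suc (j mod n) < n")
        case True
        hence "Suc j mod n = Suc (j mod n)" by (simp add: mod_Suc)
        thus ?thesis using B True n by (simp add: cnth_def)
      next
        case False
        hence *: "Suc (j mod n) = n" using n by (metis Suc_lessI mod_less_divisor)
        hence "Suc j mod n = 0" "j mod n = n - 1" by (auto simp: mod_Suc)
        thus ?thesis using B n by (simp add: cnth_def)
      qed
    qed
  qed
  thus ?thesis using True
    by (simp add: cyc_reduced_words_def letters_def successively_conv_nth hd_conv_nth last_conv_nth)
qed (auto simp: cyc_reduced_words_def letters_def)

lemma crw_length: "w \<in> cyc_reduced_words k n \<Longrightarrow> length w = n"
  by (simp add: crw_iff)

lemma crw_letters: "w \<in> cyc_reduced_words k n \<Longrightarrow> set w \<subseteq> letters k"
  by (simp add: crw_iff)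

lemma crw_cnth: "w \<in> cyc_reduced_words k n \<Longrightarrow> w \<noteq> [] \<Longrightarrow> cnth w (Suc j) \<noteq> inv_symbol (cnth w j)"
  by (simp add: crw_iff)

lemma crw_rotate: "w \<in> cyc_reduced_words k n \<Longrightarrow> rotate x w \<in> cyc_reduced_words k n"
  by (auto simp: crw_iff cnth_rotate)

lemma crw_inv_word:
  assumes w: "w \<in> cyc_reduced_words k n" shows "inv_word w \<in> cyc_reduced_words k n"
proof (cases "w = []")
  case False
  have n: "length w = n" "n > 0" using w False crw_length by auto
  show ?thesis unfolding crw_iff
  proof (intro conjI allI impI)
    fix j
        define c' where "c' = n * (j+2) - (j + 2)"
    have c': "n * (j+2) \<ge> j + 2" using n mult_le_mono1[of 1 n "j + 2"] by simp
    have 1: "cnth (inv_word w) (Suc j) = inv_symbol (cnth w c')"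

  proof (intro cnth_inv_word False)
    have "Suc (Suc j + c') = n * (j+2)" using c' by (simp add: c'_def)
    thus "length w dvd Suc (Suc j + c')" using n by simp
  qed
    have 2: "cnth (inv_word w) j = inv_symbol (cnth w (Suc c'))"
    proof (intro cnth_inv_word False)
      have "Suc (j + Suc c') = n * (j+2)" using c' by (simp add: c'_def)
      thus "length w dvd Suc (j + Suc c')" using n by simp
    qed
    show "cnth (inv_word w) (Suc j) \<noteq> inv_symbol (cnth (inv_word w) j)"
      unfolding 1 2 using crw_cnth[OF w False, of c'] by auto
  next
    show "set (inv_word w) \<subseteq> letters k" using crw_letters[OF w] by auto
  qed (use n in auto)
qed (use w in auto)

lemma crw_cyc: "w \<in> cyc_reduced_words k n \<Longrightarrow> v \<in> cyc w \<Longrightarrow> v \<in> cyc_reduced_words k n"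
  unfolding cyc_iff using crw_rotate by blast

lemma crw_subset_reduced: "cyc_reduced_words k n \<subseteq> reduced_words k n"
proof
  fix w assume w: "w \<in> cyc_reduced_words k n"
  have "w ! Suc j \<noteq> inv_symbol (w ! j)" if "Suc j < n" for j
    using crw_cnth[OF w, of j] that crw_length[OF w] by (cases "w = []") (auto simp: cnth_def)
  thus "w \<in> reduced_words k n" using w by (simp add: reduced_words_def crw_iff)
qed

lemma finite_crw [simp]: "finite (cyc_reduced_words k n)"
  using crw_subset_reduced finite_reduced_words finite_subset by blast

lemma reduced_take: "w \<in> reduced_words k n \<Longrightarrow> i \<le> n \<Longrightarrow> take i w \<in> reduced_words k i"
  using set_take_subset[of i w] by (auto simp: reduced_words_def)

lemma reduced_drop: "w \<in> reduced_words k n \<Longrightarrow> i \<le> n \<Longrightarrow> drop i w \<in> reduced_words k (n - i)"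
  using set_drop_subset[of i w] by (auto simp: reduced_words_def)

text \<open>The induction step of the counts of reduced words: \<open>E u\<close> holds the letters
  that may follow \<open>u\<close>.\<close>

lemma card_snoc_le:
  assumes "finite A" "\<And>u. u \<in> A \<Longrightarrow> finite (E u) \<and> card (E u) \<le> c"
    and "B \<subseteq> (\<lambda>(u, x). u @ [x]) ` (SIGMA u:A. E u)"
  shows "card B \<le> c * card A"
proof -
  have f: "finite (SIGMA u:A. E u)" using assms by auto
  have "card B \<le> card (SIGMA u:A. E u)"
    using surj_card_le[OF f assms(3)] .
  also have "\<dots> = (\<Sum>u\<in>A. card (E u))" using assms by (simp add: card_SigmaI)
  also have "\<dots> \<le> c * card A" using sum_bounded_above[of A "\<lambda>u. card (E u)" c] assms by (simp add: mult.commute)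
  finally show ?thesis .
qed

lemma card_snoc_ge:
  assumes "finite A" "\<And>u. u \<in> A \<Longrightarrow> finite (E u) \<and> card (E u) \<ge> c"
    and "(\<lambda>(u, x). u @ [x]) ` (SIGMA u:A. E u) \<subseteq> B" "finite B"
  shows "c * card A \<le> card B"
proof -
  have "c * card A \<le> (\<Sum>u\<in>A. card (E u))"
    using sum_bounded_below[of A c "\<lambda>u. card (E u)"] assms by (simp add: mult.commute)
  also have "\<dots> = card (SIGMA u:A. E u)" using assms by (simp add: card_SigmaI)
  also have "\<dots> = card ((\<lambda>(u, x). u @ [x]) ` (SIGMA u:A. E u))"
    by (rule card_image[symmetric]) (auto simp: inj_on_def)
  also have "\<dots> \<le> card B" using assms card_mono by blast
  finally show ?thesis .
qed

lemma card_letters_minus: "finite F \<Longrightarrow> card (letters k - F) \<ge> 2 * k - card F"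
  by (metis card_letters diff_card_le_card_Diff)

lemma reduced_words_0: "reduced_words k 0 = {[]}"
  by (auto simp: reduced_words_def)

lemma reduced_snoc_cases:
  assumes "w \<in> reduced_words k (Suc n)"
  obtains u x where "w = u @ [x]" "u \<in> reduced_words k n" "x \<in> letters k"
    "u = [] \<or> x \<noteq> inv_symbol (last u)"
proof -
  obtain u x where ux: "w = u @ [x]" using assms by (cases w rule: rev_cases) (auto simp: reduced_words_def)
  have l: "length u = n" using assms ux by (simp add: reduced_words_def)
  have "u = take n w" using ux l by simp
  hence 1: "u \<in> reduced_words k n" using reduced_take[OF assms, of n] by simp
  have 2: "x \<in> letters k" using assms ux by (simp add: reduced_words_def)
  have 3: "u = [] \<or> x \<noteq> inv_symbol (last u)"
  proof (cases "u = []")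
    case that: False
    have "x \<noteq> inv_symbol (last u)"
  proof -
    have "Suc (n - 1) < Suc n" using that l by (cases u) auto
    hence "w ! Suc (n - 1) \<noteq> inv_symbol (w ! (n - 1))"
      using assms unfolding reduced_words_def by blast
    thus ?thesis using that l ux by (cases "n") (auto simp: last_conv_nth nth_append)
  qed
    thus ?thesis ..
  qed simp
  show thesis using that ux 1 2 3 by blast
qed

lemma reduced_snocI:
  assumes "u \<in> reduced_words k n" "x \<in> letters k" "u = [] \<or> x \<noteq> inv_symbol (last u)"
  shows "u @ [x] \<in> reduced_words k (Suc n)"
proof -
  have l: "length u = n" using assms by (simp add: reduced_words_def)
  have "(u @ [x]) ! Suc j \<noteq> inv_symbol ((u @ [x]) ! j)" if "Suc j < Suc n" for j
  proof (cases "Suc j < n")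
    case True thus ?thesis using assms(1) l by (simp add: reduced_words_def nth_append)
  next
    case False
    hence "Suc j = n" using that by simp
    thus ?thesis using assms(3) l by (cases u rule: rev_cases) (auto simp: nth_append)
  qed
  thus ?thesis using assms by (simp add: reduced_words_def)
qed

text \<open>The exact number for n >= 1 is 2 * k * (2 * k - 1) ^ (n - 1); the cruder bound also
  covers n = 0 and loses only a constant factor.\<close>

lemma card_reduced_words_le:
  assumes "k \<ge> 1"
  shows "card (reduced_words k n) \<le> 2 * (2 * k - 1) ^ n"
proof -
  have *: "card (reduced_words k (Suc n)) \<le> 2 * k * (2 * k - 1) ^ n" for n
  proof (induction n)
    case 0
    have "card (reduced_words k (Suc 0)) \<le> card (letters k) * card (reduced_words k 0)"
      by (rule card_snoc_le[where E = "\<lambda>_. letters k"]) (auto elim!: reduced_snoc_cases)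
    thus ?case by (simp add: reduced_words_0 card_letters)
  next
    case (Suc n)
    have "card (reduced_words k (Suc (Suc n))) \<le> (2 * k - 1) * card (reduced_words k (Suc n))"
    proof (rule card_snoc_le[where E = "\<lambda>u. letters k - {inv_symbol (last u)}"])
      fix u assume u: "u \<in> reduced_words k (Suc n)"
      hence "last u \<in> letters k" by (cases u rule: rev_cases) (auto simp: reduced_words_def)
      thus "finite (letters k - {inv_symbol (last u)}) \<and> card (letters k - {inv_symbol (last u)}) \<le> 2 * k - 1"
        by (simp add: card_letters)
    next
      show "reduced_words k (Suc (Suc n)) \<subseteq> (\<lambda>(u, x). u @ [x]) ` (SIGMA u:reduced_words k (Suc n). letters k - {inv_symbol (last u)})"
      proof
        fix w assume "w \<in> reduced_words k (Suc (Suc n))"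
        then obtain u x where "w = u @ [x]" "u \<in> reduced_words k (Suc n)" "x \<in> letters k"
          "u = [] \<or> x \<noteq> inv_symbol (last u)" by (rule reduced_snoc_cases)
        moreover have "u \<noteq> []" using \<open>u \<in> _\<close> by (auto simp: reduced_words_def)
        ultimately show "w \<in> (\<lambda>(u, x). u @ [x]) ` (SIGMA u:reduced_words k (Suc n). letters k - {inv_symbol (last u)})"
          by auto
      qed
    qed simp
    also have "\<dots> \<le> (2 * k - 1) * (2 * k * (2 * k - 1) ^ n)" using Suc by simp
    finally show ?case by (simp add: mult_ac)
  qed
  show ?thesis
  proof (cases n)
    case 0 thus ?thesis by (simp add: reduced_words_0)
  next
    case (Suc j)
    have "2 * k * (2 * k - 1) ^ j \<le> 2 * (2 * k - 1) * (2 * k - 1) ^ j"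
      using assms by (intro mult_right_mono) auto
    from order.trans[OF *[of j] this] show ?thesis unfolding Suc by (simp only: power_Suc mult.assoc)
  qed
qed

lemma card_reduced_words_first_ge:
  assumes "finite F" "card F \<le> 2" "k \<ge> 2"
  shows "card {w \<in> reduced_words k (Suc n). hd w \<notin> F} \<ge> (2 * k - 1) ^ n"
proof (induction n)
  case 0
  have "(2 * k - card F) * card {[]::word} \<le> card {w \<in> reduced_words k (Suc 0). hd w \<notin> F}"
    using assms card_letters_minus[of F k]
    by (intro card_snoc_ge[where E = "\<lambda>_. letters k - F"]) (auto intro!: reduced_snocI[where u = "[]", simplified] simp: reduced_words_0)
  thus ?case using assms by simp
next
  case (Suc n)
  have "(2 * k - 1) * card {w \<in> reduced_words k (Suc n). hd w \<notin> F} \<le> card {w \<in> reduced_words k (Suc (Suc n)). hd w \<notin> F}"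
  proof (rule card_snoc_ge[where E = "\<lambda>u. letters k - {inv_symbol (last u)}"])
    show "(\<lambda>(u, x). u @ [x]) ` (SIGMA u:{w \<in> reduced_words k (Suc n). hd w \<notin> F}. letters k - {inv_symbol (last u)})
      \<subseteq> {w \<in> reduced_words k (Suc (Suc n)). hd w \<notin> F}"
    proof
      fix v assume "v \<in> (\<lambda>(u, x). u @ [x]) ` (SIGMA u:{w \<in> reduced_words k (Suc n). hd w \<notin> F}. letters k - {inv_symbol (last u)})"
      then obtain u x where v: "v = u @ [x]" and a: "u \<in> reduced_words k (Suc n)" "hd u \<notin> F"
        and a2: "x \<in> letters k" "x \<noteq> inv_symbol (last u)"
        by auto
      have "u \<noteq> []" using a by (auto simp: reduced_words_def)
      thus "v \<in> {w \<in> reduced_words k (Suc (Suc n)). hd w \<notin> F}"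
        using a a2 v by (auto intro: reduced_snocI)
    qed
  qed (use card_letters_minus[of "{_}" k] in auto)
  moreover have "(2 * k - 1) * (2 * k - 1) ^ n \<le> (2 * k - 1) * card {w \<in> reduced_words k (Suc n). hd w \<notin> F}"
    by (rule mult_le_mono2[OF Suc])
  ultimately show ?case unfolding power_Suc by (rule order.trans[rotated])
qed

text \<open>When the last letter is chosen, one letter is excluded by reducedness and at most two by
  \<open>G\<close>, so at least one of the 2 * k >= 4 letters is left. \<open>G\<close> may depend
  on the first letter in order to express cyclic reducedness.\<close>

lemma card_reduced_words_ends_ge:
  assumes "finite F" "card F \<le> 2" "\<And>u. finite (G u) \<and> card (G u) \<le> 2" "k \<ge> 2"
  shows "card {w \<in> reduced_words k (Suc (Suc n)). hd w \<notin> F \<and> last w \<notin> G (hd w)} \<ge> (2 * k - 1) ^ n"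
proof -
  have "1 * card {w \<in> reduced_words k (Suc n). hd w \<notin> F}
      \<le> card {w \<in> reduced_words k (Suc (Suc n)). hd w \<notin> F \<and> last w \<notin> G (hd w)}"
  proof (rule card_snoc_ge[where E = "\<lambda>u. letters k - ({inv_symbol (last u)} \<union> G (hd u))"])
    fix u :: word
    have "card ({inv_symbol (last u)} \<union> G (hd u)) \<le> 3"
      using assms(3)[of "hd u"] by (simp add: card_insert_if)
    thus "finite (letters k - ({inv_symbol (last u)} \<union> G (hd u))) \<and> 1 \<le> card (letters k - ({inv_symbol (last u)} \<union> G (hd u)))"
      using card_letters_minus[of "{inv_symbol (last u)} \<union> G (hd u)" k] assms(3)[of "hd u"] assms(4) by auto
  next
    show "(\<lambda>(u, x). u @ [x]) ` (SIGMA u:{w \<in> reduced_words k (Suc n). hd w \<notin> F}. letters k - ({inv_symbol (last u)} \<union> G (hd u)))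
      \<subseteq> {w \<in> reduced_words k (Suc (Suc n)). hd w \<notin> F \<and> last w \<notin> G (hd w)}"
    proof
      fix v assume "v \<in> (\<lambda>(u, x). u @ [x]) ` (SIGMA u:{w \<in> reduced_words k (Suc n). hd w \<notin> F}. letters k - ({inv_symbol (last u)} \<union> G (hd u)))"
      then obtain u x where v: "v = u @ [x]" and a: "u \<in> reduced_words k (Suc n)" "hd u \<notin> F"
        and a2: "x \<in> letters k" "x \<noteq> inv_symbol (last u)" "x \<notin> G (hd u)"
        by auto
      have "u \<noteq> []" using a by (auto simp: reduced_words_def)
      thus "v \<in> {w \<in> reduced_words k (Suc (Suc n)). hd w \<notin> F \<and> last w \<notin> G (hd w)}"
        using a a2 v by (auto intro: reduced_snocI)
    qed
  qed simp_all
  from order.trans[OF card_reduced_words_first_ge[OF assms(1,2,4), of n] this[unfolded mult_1]]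
  show ?thesis .
qed

lemma card_crw_ge:
  assumes "k \<ge> 2" "n \<ge> 2"
  shows "card (cyc_reduced_words k n) \<ge> (2 * k - 1) ^ (n - 2)"
proof -
  define j where "j = n - 2"
  have n: "n = Suc (Suc j)" using assms by (simp add: j_def)
  have "{w \<in> reduced_words k (Suc (Suc j)). hd w \<notin> {} \<and> last w \<notin> {inv_symbol (hd w)}} \<subseteq> cyc_reduced_words k n"
  proof
    fix w assume w: "w \<in> {w \<in> reduced_words k (Suc (Suc j)). hd w \<notin> {} \<and> last w \<notin> {inv_symbol (hd w)}}"
    hence "hd w \<noteq> inv_symbol (last w)" by auto
    thus "w \<in> cyc_reduced_words k n" using w n
      by (auto simp: cyc_reduced_words_def reduced_words_def letters_def successively_conv_nth)
  qed
  note sub = card_mono[OF finite_crw this]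
  have "(2 * k - 1) ^ j \<le> card {w \<in> reduced_words k (Suc (Suc j)). hd w \<notin> {} \<and> last w \<notin> {inv_symbol (hd w)}}"
    by (rule card_reduced_words_ends_ge) (use assms in auto)
  from order.trans[OF this sub] show ?thesis using n by simp
qed

section \<open>Orbits, faces and boundary paths\<close>

text \<open>The map is bijective on \<open>H\<close> only. Extended by the identity outside of
  \<open>H\<close>, it becomes a permutation, to which the general facts on cyclic orbits
  apply.\<close>

lemma orbit_bij_facts:
  assumes "finite H" "bij_betw f H H" "x \<in> H"
  shows bij_self_in_orbit: "x \<in> orbit f x"
    and bij_orbit_subset: "orbit f x \<subseteq> H"
    and bij_funpow_in: "(f ^^ j) x \<in> H"
    and bij_funpow_card_orbit: "(f ^^ card (orbit f x)) x = x"
    and bij_orbit_eq_image: "orbit f x = (\<lambda>j. (f ^^ j) x) ` {..<card (orbit f x)}"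
    and bij_orbit_eq: "\<And>y. y \<in> orbit f x \<Longrightarrow> orbit f y = orbit f x"
    and bij_finite_orbit: "finite (orbit f x)"
    and bij_card_orbit: "card (orbit f x) > 0"
proof -
  have fH: "f y \<in> H" if "y \<in> H" for y using assms(2) that by (auto simp: bij_betw_def)
  define g where "g = (\<lambda>y. if y \<in> H then f y else y)"
  have "bij_betw g H H" using assms(2) by (subst bij_betw_cong[of H g f]) (auto simp: g_def)
  hence g: "g permutes H" by (intro bij_imp_permutes) (auto simp: g_def)
  have perm: "permutation g" using g assms(1) permutation_permutes by blast
  have og: "orbit f y = orbit g y" if "y \<in> H" for y
    using fH that by (intro orbit_cong0[of _ H]) (auto simp: g_def)
  show self: "x \<in> orbit f x" using permutation_self_in_orbit[OF perm] og[OF assms(3)] by simp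
  show fin: "(f ^^ j) x \<in> H" for j using assms(3) fH by (induction j) auto
  show sub: "orbit f x \<subseteq> H" using fin by (auto simp: orbit_altdef)
  show f1: "finite (orbit f x)" using sub assms(1) finite_subset by blast
  have o: "orbit f x = (\<lambda>j. (f ^^ j) x) ` {0..<funpow_dist1 f x x}"
    using orbit_conv_funpow_dist1[OF self] .
  have i: "inj_on (\<lambda>j. (f ^^ j) x) {0..<funpow_dist1 f x x}"
    using inj_on_funpow_dist1[OF self] .
  have c: "card (orbit f x) = funpow_dist1 f x x"
    using card_image[OF i] o by simp
  show "(f ^^ card (orbit f x)) x = x" unfolding c by (rule funpow_dist1_prop[OF self])
  show "orbit f x = (\<lambda>j. (f ^^ j) x) ` {..<card (orbit f x)}"
    using o unfolding c by (auto simp: atLeast0LessThan)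
  show "orbit f y = orbit f x" if "y \<in> orbit f x" for y
    using that self orbit_cyclic_eq3[of f "orbit f x" y] cyclic_on_orbit'[OF perm]
    by (metis assms(3) cyclic_on_orbit' og orbit_cyclic_eq3 perm sub subsetD)
  show "card (orbit f x) > 0" using self f1 card_gt_0_iff by blast
qed

section \<open>Vertices and faces of a fatgraph\<close>

lemma fatgraphD:
  assumes "fatgraph Y"
  shows fg_finite: "finite (hedges Y)"
    and fg_bij: "bij_betw (nxt Y) (hedges Y) (hedges Y)"
    and fg_opp: "\<And>h. h \<in> hedges Y \<Longrightarrow> opp Y h \<in> hedges Y"
    and fg_opp_opp: "\<And>h. h \<in> hedges Y \<Longrightarrow> opp Y (opp Y h) = h"
    and fg_lab_opp: "\<And>h. h \<in> hedges Y \<Longrightarrow> lab Y (opp Y h) = inv_symbol (lab Y h)"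
    and fg_tag: "\<And>h. h \<in> hedges Y \<Longrightarrow> h \<in> tags Y \<longleftrightarrow> (\<exists>b. lab Y h = Tag b)"
    and fg_bd_next: "\<And>h. h \<in> hedges Y \<Longrightarrow> bd_next Y h \<in> hedges Y"
    and fg_bij_bd: "bij_betw (bd_next Y) (hedges Y) (hedges Y)"
proof -
  show "finite (hedges Y)" and b: "bij_betw (nxt Y) (hedges Y) (hedges Y)"
    and 1: "\<And>h. h \<in> hedges Y \<Longrightarrow> opp Y h \<in> hedges Y"
    and 2: "\<And>h. h \<in> hedges Y \<Longrightarrow> opp Y (opp Y h) = h"
    and "\<And>h. h \<in> hedges Y \<Longrightarrow> lab Y (opp Y h) = inv_symbol (lab Y h)"
    and "\<And>h. h \<in> hedges Y \<Longrightarrow> h \<in> tags Y \<longleftrightarrow> (\<exists>b. lab Y h = Tag b)"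
    using assms by (auto simp: fatgraph_def tags_def)
  have 3: "\<And>h. h \<in> hedges Y \<Longrightarrow> nxt Y h \<in> hedges Y" using b by (auto simp: bij_betw_def)
  show "\<And>h. h \<in> hedges Y \<Longrightarrow> bd_next Y h \<in> hedges Y" by (simp add: bd_next_def 1 3)
  have o: "bij_betw (opp Y) (hedges Y) (hedges Y)"
    by (rule bij_betwI[where g = "opp Y"]) (auto simp: 1 2)
  have "bij_betw (nxt Y \<circ> opp Y) (hedges Y) (hedges Y)" by (rule bij_betw_trans[OF o b])
  thus "bij_betw (bd_next Y) (hedges Y) (hedges Y)" by (simp add: bd_next_def comp_def cong: bij_betw_cong)
qed

lemma tags_subset: "tags Y \<subseteq> hedges Y"
  by (auto simp: tags_def)

lemma opp_tag: "h \<in> tags Y \<Longrightarrow> opp Y h = h"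
  by (auto simp: tags_def)

lemma vertex_facts:
  assumes "fatgraph Y" "h \<in> hedges Y"
  shows self_in_vertex: "h \<in> vertex Y h"
    and vertex_subset: "vertex Y h \<subseteq> hedges Y"
    and vertex_eq: "\<And>e. e \<in> vertex Y h \<Longrightarrow> vertex Y e = vertex Y h"
    and finite_vertex: "finite (vertex Y h)"
    and nxt_in_vertex: "nxt Y h \<in> vertex Y h"
    and valence_eq: "\<And>e. e \<in> vertex Y h \<Longrightarrow> valence Y e = valence Y h"
proof -
  note b = fg_finite[OF assms(1)] fg_bij[OF assms(1)] assms(2)
  show "h \<in> vertex Y h" unfolding vertex_def by (rule bij_self_in_orbit[OF b])
  show "vertex Y h \<subseteq> hedges Y" unfolding vertex_def by (rule bij_orbit_subset[OF b])
  show v: "vertex Y e = vertex Y h" if "e \<in> vertex Y h" for e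
    using that unfolding vertex_def by (rule bij_orbit_eq[OF b])
  show "finite (vertex Y h)" unfolding vertex_def by (rule bij_finite_orbit[OF b])
  show "nxt Y h \<in> vertex Y h" unfolding vertex_def by (rule orbit.base)
  show "valence Y e = valence Y h" if "e \<in> vertex Y h" for e
    using v[OF that] by (simp add: valence_def)
qed

lemma valence_bd_next:
  assumes "fatgraph Y" "h \<in> hedges Y"
  shows "valence Y (bd_next Y h) = valence Y (opp Y h)"
  using valence_eq[OF assms(1) fg_opp[OF assms]] nxt_in_vertex[OF assms(1) fg_opp[OF assms]]
  by (simp add: bd_next_def)

lemma valence_2_vertex:
  assumes "fatgraph Y" "h \<in> hedges Y" "valence Y h = 2"
  shows "vertex Y h - {h} = {nxt Y h}"
proof -
  note f = orbit_bij_facts[OF fg_finite[OF assms(1)] fg_bij[OF assms(1)] assms(2)]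
  have c: "card (orbit (nxt Y) h) = 2" using assms(3) by (simp add: valence_def vertex_def)
  have "vertex Y h = (\<lambda>j. (nxt Y ^^ j) h) ` {..<2}" using f(5) c by (simp add: vertex_def)
  also have "{..<2::nat} = {0, 1}" by auto
  finally have v: "vertex Y h = {h, nxt Y h}" by simp
  have "h \<noteq> nxt Y h" using c v by (auto simp: vertex_def)
  thus ?thesis using v by auto
qed

text \<open>In a cyclic order on three elements any two are consecutive. This is what forces two
  tags at one vertex to be adjacent in a boundary word.\<close>

lemma valence_3_adjacent:
  assumes "fatgraph Y" "h \<in> hedges Y" "valence Y h = 3" "e \<in> vertex Y h" "e \<noteq> h"
  shows "e = nxt Y h \<or> h = nxt Y e"
proof -
  note f = orbit_bij_facts[OF fg_finite[OF assms(1)] fg_bij[OF assms(1)] assms(2)]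
  have c: "card (orbit (nxt Y) h) = 3" using assms(3) by (simp add: valence_def vertex_def)
  have "vertex Y h = (\<lambda>j. (nxt Y ^^ j) h) ` {..<3}" using f(5) c by (simp add: vertex_def)
  also have "{..<3::nat} = {0, 1, 2}" by auto
  finally have "vertex Y h = {h, nxt Y h, (nxt Y ^^ 2) h}" by simp
  moreover have "nxt Y ((nxt Y ^^ 2) h) = h" using f(4) c by (simp add: numeral_3_eq_3 numeral_2_eq_2)
  ultimately show ?thesis using assms(4,5) by auto
qed

lemma mset_rotate: "mset (rotate x w) = mset w"
proof (induction x)
  case (Suc x)
  have "mset (rotate1 u) = mset u" for u :: "'a list" by (cases u) auto
  thus ?case using Suc by (simp add: rotate_def)
qed simp

lemma cyc_mset: "v \<in> cyc w \<Longrightarrow> mset v = mset w"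
  by (auto simp: cyc_iff mset_rotate)

lemma length_filter_mset: "mset v = mset w \<Longrightarrow> length (filter P v) = length (filter P w)"
  by (metis mset_filter size_mset)

lemma length_filter_inv_word:
  assumes "\<And>s. P (inv_symbol s) = P s"
  shows "length (filter P (inv_word w)) = length (filter P w)"
proof -
  have "length (filter P (inv_word w)) = length (filter (P \<circ> inv_symbol) w)"
    by (simp add: inv_word_def filter_map rev_filter[symmetric])
  also have "P \<circ> inv_symbol = P" using assms by auto
  finally show ?thesis .
qed

lemma in_copies: "W \<in># copies N B \<Longrightarrow> W = cyc B \<or> W = cyc (inv_word B)"
  by (auto simp: copies_def in_replicate_mset split: if_splits)

lemma face_facts:
  assumes "fatgraph Y" "h \<in> hedges Y"
  shows self_in_face: "h \<in> face Y h"
    and funpow_bd_next_in: "(bd_next Y ^^ j) h \<in> hedges Y"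
    and funpow_card_face: "(bd_next Y ^^ card (face Y h)) h = h"
    and face_eq_image: "face Y h = (\<lambda>j. (bd_next Y ^^ j) h) ` {..<card (face Y h)}"
    and card_face_pos: "card (face Y h) > 0"
    and finite_face: "finite (face Y h)"
proof -
  note b = fg_finite[OF assms(1)] fg_bij_bd[OF assms(1)] assms(2)
  show "h \<in> face Y h" unfolding face_def by (rule bij_self_in_orbit[OF b])
  show "(bd_next Y ^^ j) h \<in> hedges Y" by (rule bij_funpow_in[OF b])
  show "(bd_next Y ^^ card (face Y h)) h = h" unfolding face_def by (rule bij_funpow_card_orbit[OF b])
  show "face Y h = (\<lambda>j. (bd_next Y ^^ j) h) ` {..<card (face Y h)}"
    unfolding face_def by (rule bij_orbit_eq_image[OF b])
  show "card (face Y h) > 0" unfolding face_def by (rule bij_card_orbit[OF b])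
  show "finite (face Y h)" unfolding face_def by (rule bij_finite_orbit[OF b])
qed

lemma face_word_copies:
  assumes "fatgraph Y" "boundary Y = copies N B" "h \<in> hedges Y"
  shows "map (\<lambda>j. lab Y ((bd_next Y ^^ j) h)) [0..<card (face Y h)] \<in> cyc B \<union> cyc (inv_word B)"
proof -
  have "face_word Y (face Y h) \<in># boundary Y"
    using assms(3) fg_finite[OF assms(1)] by (auto simp: boundary_def)
  hence "face_word Y (face Y h) = cyc B \<or> face_word Y (face Y h) = cyc (inv_word B)"
    using in_copies assms(2) by metis
  moreover have "map (\<lambda>j. lab Y ((bd_next Y ^^ j) h)) [0..<card (face Y h)] \<in> face_word Y (face Y h)"
    using self_in_face[OF assms(1,3)] by (auto simp: face_word_def)
  ultimately show ?thesis by auto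
qed

lemma funpow_bd_next_mod:
  assumes "fatgraph Y" "h \<in> hedges Y"
  shows "(bd_next Y ^^ (j mod card (face Y h))) h = (bd_next Y ^^ j) h"
  by (rule funpow_mod_eq[OF funpow_card_face[OF assms]])

lemma boundary_reading:
  assumes "fatgraph Y" "boundary Y = copies N B" "h \<in> hedges Y"
  obtains v where "v \<in> cyc B \<union> cyc (inv_word B)" "length v = card (face Y h)" "v \<noteq> []"
    "\<And>j. lab Y ((bd_next Y ^^ j) h) = cnth v j" "length v = length B"
proof
  let ?v = "map (\<lambda>j. lab Y ((bd_next Y ^^ j) h)) [0..<card (face Y h)]"
  show v: "?v \<in> cyc B \<union> cyc (inv_word B)" by (rule face_word_copies[OF assms])
  show "length ?v = card (face Y h)" by simp
  show "?v \<noteq> []" using card_face_pos[OF assms(1,3)] by simp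
  show "lab Y ((bd_next Y ^^ j) h) = cnth ?v j" for j
    using card_face_pos[OF assms(1,3)] funpow_bd_next_mod[OF assms(1,3), of j] by (simp add: cnth_def)
  show "length ?v = length B" using v cyc_length by fastforce
qed

text \<open>Every half-edge lies on one of the 2 * N faces, and a face carries as many labels
  satisfying \<open>P\<close> as \<open>B\<close> has letters of this kind. As \<open>P\<close> is
  invariant under inversion, faces that read the inverse of \<open>B\<close> count the same.\<close>

lemma card_hedges_label_le:
  assumes "fatgraph Y" "boundary Y = copies N B" "\<And>s. P (inv_symbol s) = P s"
  shows "card {h \<in> hedges Y. P (lab Y h)} \<le> 2 * N * length (filter P B)"
proof -
  let ?F = "face Y ` hedges Y"
  have fin: "finite ?F" using fg_finite[OF assms(1)] by simp
  have cF: "card ?F = 2 * N"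
    using arg_cong[OF assms(2), of size] by (simp add: boundary_def copies_def)
  have "{h \<in> hedges Y. P (lab Y h)} \<subseteq> (\<Union>f\<in>?F. {h \<in> f. P (lab Y h)})"
    using self_in_face[OF assms(1)] by auto
  moreover have finf: "finite f" if "f \<in> ?F" for f
    using that finite_face[OF assms(1)] by auto
  have "finite (\<Union>f\<in>?F. {h \<in> f. P (lab Y h)})"
    by (intro finite_UN_I fin finite_subset[OF _ finf]) auto
  ultimately have "card {h \<in> hedges Y. P (lab Y h)} \<le> card (\<Union>f\<in>?F. {h \<in> f. P (lab Y h)})"
    by (intro card_mono)
  also have "\<dots> \<le> (\<Sum>f\<in>?F. card {h \<in> f. P (lab Y h)})" by (rule card_UN_le[OF fin])
  also have "\<dots> \<le> (\<Sum>f\<in>?F. length (filter P B))"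
  proof (rule sum_mono)
    fix f assume "f \<in> ?F"
    then obtain h where h: "h \<in> hedges Y" "f = face Y h" by auto
    let ?v = "map (\<lambda>j. lab Y ((bd_next Y ^^ j) h)) [0..<card (face Y h)]"
    have "length (filter P u) = length (filter P B)" if "u \<in> cyc B \<union> cyc (inv_word B)" for u
      using that length_filter_mset[OF cyc_mset, of u B P] length_filter_mset[OF cyc_mset, of u "inv_word B" P]
        length_filter_inv_word[of P B, OF assms(3)] by auto
    from this[OF face_word_copies[OF assms(1,2) h(1)]]
    have "length (filter P ?v) = length (filter P B)" .
    moreover have "length (filter P ?v) = card {j. j < card f \<and> P (lab Y ((bd_next Y ^^ j) h))}"
      by (simp add: length_filter_conv_card h(2) cong: conj_cong)
    moreover have "{h' \<in> f. P (lab Y h')} \<subseteq> (\<lambda>j. (bd_next Y ^^ j) h) ` {j. j < card f \<and> P (lab Y ((bd_next Y ^^ j) h))}"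
      using face_eq_image[OF assms(1) h(1)] h(2) by auto
    ultimately show "card {h \<in> f. P (lab Y h)} \<le> length (filter P B)"
      using surj_card_le[of "{j. j < card f \<and> P (lab Y ((bd_next Y ^^ j) h))}"] by simp
  qed
  finally show ?thesis using cF by simp
qed

lemma card_hedges_le:
  assumes "fatgraph Y" "boundary Y = copies N B"
  shows "card (hedges Y) \<le> 2 * N * length B"
  using card_hedges_label_le[OF assms, of "\<lambda>_. True"] by simp

lemma nth_in_subset: "set xs \<subseteq> A \<Longrightarrow> i < length xs \<Longrightarrow> xs ! i \<in> A"
  by (meson nth_mem subsetD)

section \<open>Reversed paths, and paths that follow a face\<close>

lemma reverse_path_length [simp]: "length (reverse_path Y \<gamma>) = length \<gamma>"
  by (simp add: reverse_path_def)

lemma reverse_path_nth: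
  "t < length \<gamma> \<Longrightarrow> reverse_path Y \<gamma> ! t = opp Y (\<gamma> ! (length \<gamma> - Suc t))"
  by (simp add: reverse_path_def rev_nth)

lemma reverse_reverse_path:
  assumes "fatgraph Y" "set \<gamma> \<subseteq> hedges Y"
  shows "reverse_path Y (reverse_path Y \<gamma>) = \<gamma>"
proof -
  have "opp Y (opp Y h) = h" if "h \<in> set \<gamma>" for h
    using that assms(2) fg_opp_opp[OF assms(1)] by blast
  thus ?thesis by (simp add: reverse_path_def rev_map[symmetric] map_idI)
qed

lemma immersed_path_reverse:
  assumes Y: "fatgraph Y" and "immersed_path Y \<gamma>"
  shows "immersed_path Y (reverse_path Y \<gamma>)"
proof -
  have s: "set \<gamma> \<subseteq> hedges Y - tags Y" and
    st: "\<And>t. Suc t < length \<gamma> \<Longrightarrow> \<gamma> ! Suc t \<in> vertex Y (opp Y (\<gamma> ! t)) \<and> \<gamma> ! Suc t \<noteq> opp Y (\<gamma> ! t)"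
    using assms(2) by (auto simp: immersed_path_def successively_conv_nth)
  have "set (reverse_path Y \<gamma>) \<subseteq> hedges Y - tags Y"
    using s fg_opp[OF Y] fg_opp_opp[OF Y] by (auto simp: reverse_path_def tags_def)
  moreover have "successively (\<lambda>d e. e \<in> vertex Y (opp Y d) \<and> e \<noteq> opp Y d) (reverse_path Y \<gamma>)"
    unfolding successively_conv_nth
  proof (intro allI impI)
    fix t assume t: "Suc t < length (reverse_path Y \<gamma>)"
    define j where "j = length \<gamma> - Suc (Suc t)"
    have j: "Suc j < length \<gamma>" "length \<gamma> - Suc t = Suc j" using t by (auto simp: j_def)
    have h: "\<gamma> ! j \<in> hedges Y" "\<gamma> ! Suc j \<in> hedges Y"
      using nth_in_subset[OF s, of j] nth_in_subset[OF s, of "Suc j"] j(1) by auto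
    have e: "reverse_path Y \<gamma> ! t = opp Y (\<gamma> ! Suc j)" "reverse_path Y \<gamma> ! Suc t = opp Y (\<gamma> ! j)"
      using t j by (auto simp: reverse_path_nth j_def)
    have "opp Y (\<gamma> ! j) \<in> vertex Y (\<gamma> ! Suc j)"
      using vertex_eq[OF Y fg_opp[OF Y h(1)], of "\<gamma> ! Suc j"] st[OF j(1)] self_in_vertex[OF Y fg_opp[OF Y h(1)]] by simp
    moreover have "opp Y (\<gamma> ! j) \<noteq> \<gamma> ! Suc j" using conjunct2[OF st[OF j(1)]] by (rule not_sym)
    ultimately show "reverse_path Y \<gamma> ! Suc t \<in> vertex Y (opp Y (reverse_path Y \<gamma> ! t)) \<and>
        reverse_path Y \<gamma> ! Suc t \<noteq> opp Y (reverse_path Y \<gamma> ! t)"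
      unfolding e using fg_opp_opp[OF Y] h by simp
  qed
  ultimately show ?thesis by (simp add: immersed_path_def)
qed

lemma in_boundary_reverse:
  assumes "fatgraph Y" "set \<gamma> \<subseteq> hedges Y"
  shows "in_boundary Y (reverse_path Y \<gamma>) \<longleftrightarrow> in_boundary Y \<gamma>"
  using reverse_reverse_path[OF assms] by (auto simp: in_boundary_def)

text \<open>In a folded fatgraph a path is determined by one of its edges and its label. The path
  and the face read the same word and share the edge at time t, so they agree at all later and all
  earlier times.\<close>

lemma folded_path_in_face:
  assumes Y: "fatgraph Y" "folded Y" and \<gamma>: "immersed_path Y \<gamma>" "t < length \<gamma>"
    and W: "W \<noteq> []"
    and per: "(bd_next Y ^^ length W) (\<gamma> ! t) = \<gamma> ! t"
    and lab1: "\<And>s. s < length \<gamma> \<Longrightarrow> lab Y (\<gamma> ! s) = cnth W (p + s)"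
    and lab2: "\<And>j. lab Y ((bd_next Y ^^ j) (\<gamma> ! t)) = cnth W (p + t + j)"
  shows "boundary_path Y \<gamma>"
proof -
  let ?n = "length W" and ?e = "\<gamma> ! t"
  have n: "?n > 0" using W by simp
  have s: "set \<gamma> \<subseteq> hedges Y" and
    st: "\<And>t. Suc t < length \<gamma> \<Longrightarrow> \<gamma> ! Suc t \<in> vertex Y (opp Y (\<gamma> ! t)) \<and> \<gamma> ! Suc t \<noteq> opp Y (\<gamma> ! t)"
    using \<gamma>(1) by (auto simp: immersed_path_def successively_conv_nth)
  have inj: "x = y" if "x \<in> vertex Y h" "y \<in> vertex Y h" "h \<in> hedges Y" "lab Y x = lab Y y" for x y h
    using Y(2) that by (auto simp: folded_def inj_on_def)
  have e: "?e \<in> hedges Y" by (rule nth_in_subset[OF s \<gamma>(2)])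
  \<comment> \<open>The half-edge of the face at time s. Adding \<open>?n * t\<close>, a multiple of
    the period, makes the times before t available too.\<close>
  define c where "c = (\<lambda>s. (bd_next Y ^^ (s + (?n * t - t))) ?e)"
  have tn: "t \<le> ?n * t" using n by (cases "length W") simp_all
  have mult: "(bd_next Y ^^ (?n * q)) ?e = ?e" for q
    using funpow_mod_eq[OF per, of "?n * q"] by simp
  have ct: "c t = ?e" using tn mult[of t] by (simp add: c_def)
  have cS: "c (Suc s) = bd_next Y (c s)" for s by (simp add: c_def)
  have cin: "c s \<in> hedges Y" for s unfolding c_def by (rule funpow_bd_next_in[OF Y(1) e])
  have clab: "lab Y (c s) = cnth W (p + s)" for s
  proof -
    have "lab Y (c s) = cnth W (p + t + (s + (?n * t - t)))" unfolding c_def by (rule lab2)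
    also have "p + t + (s + (?n * t - t)) = p + s + ?n * t" using tn by linarith
    also have "cnth W \<dots> = cnth W (p + s)" by (rule cnth_cong) simp
    finally show ?thesis .
  qed
  have fw: "t + j < length \<gamma> \<Longrightarrow> \<gamma> ! (t + j) = c (t + j)" for j
  proof (induction j)
    case (Suc j)
    hence IH: "\<gamma> ! (t + j) = c (t + j)" and l: "Suc (t + j) < length \<gamma>" by auto
    have "\<gamma> ! Suc (t + j) \<in> vertex Y (opp Y (c (t + j)))" using st[OF l] IH by simp
    moreover have "c (Suc (t + j)) \<in> vertex Y (opp Y (c (t + j)))"
      unfolding cS bd_next_def by (rule nxt_in_vertex[OF Y(1) fg_opp[OF Y(1) cin]])
    moreover have "lab Y (\<gamma> ! Suc (t + j)) = lab Y (c (Suc (t + j)))"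
      using lab1[OF l] clab by simp
    ultimately show ?case using inj fg_opp[OF Y(1) cin] by (metis add_Suc_right)
  qed (simp add: ct)
  have bw: "j \<le> t \<Longrightarrow> \<gamma> ! (t - j) = c (t - j)" for j
  proof (induction j)
    case (Suc j)
    define i where "i = t - Suc j"
    have i: "t - j = Suc i" "Suc i < length \<gamma>" using Suc.prems \<gamma>(2) by (auto simp: i_def)
    have IH: "\<gamma> ! Suc i = c (Suc i)" using Suc i by simp
    have hi: "\<gamma> ! i \<in> hedges Y" using nth_in_subset[OF s, of i] i(2) by auto
    have "c (Suc i) \<in> vertex Y (opp Y (\<gamma> ! i))" using st[OF i(2)] IH by simp
    hence 1: "opp Y (\<gamma> ! i) \<in> vertex Y (c (Suc i))"
      using vertex_eq[OF Y(1) fg_opp[OF Y(1) hi], of "c (Suc i)"] self_in_vertex[OF Y(1) fg_opp[OF Y(1) hi]] by simp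
    have "c (Suc i) \<in> vertex Y (opp Y (c i))"
      unfolding cS bd_next_def by (rule nxt_in_vertex[OF Y(1) fg_opp[OF Y(1) cin]])
    hence 2: "opp Y (c i) \<in> vertex Y (c (Suc i))"
      using vertex_eq[OF Y(1) fg_opp[OF Y(1) cin], of "c (Suc i)" i] self_in_vertex[OF Y(1) fg_opp[OF Y(1) cin]] by simp
    have "lab Y (opp Y (\<gamma> ! i)) = lab Y (opp Y (c i))"
      using fg_lab_opp[OF Y(1)] hi cin lab1[of i] clab i(2) by simp
    from inj[OF 1 2 cin this] have "\<gamma> ! i = c i" using fg_opp_opp[OF Y(1)] hi cin by metis
    thus ?case by (simp add: i_def)
  qed (simp add: ct)
  have all: "\<gamma> ! i = c i" if "i < length \<gamma>" for i
  proof (cases "i \<le> t")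
    case True thus ?thesis using bw[of "t - i"] by simp
  next
    case False thus ?thesis using fw[of "i - t"] that by simp
  qed
  have "\<gamma> ! Suc i = bd_next Y (\<gamma> ! i)" if "Suc i < length \<gamma>" for i
    using all[of i] all[of "Suc i"] that cS[of i] by simp
  thus ?thesis using s by (simp add: boundary_path_def successively_conv_nth)
qed

section \<open>Counting walks through the pieces\<close>

text \<open>A weight of at least 1 whose sum over the successors grows by at most the factor \<rho>
  dominates the number of walks, by induction on their length.\<close>

lemma walks_count:
  fixes pot :: "'a \<Rightarrow> real"
  assumes \<rho>: "\<rho> \<ge> 0" and pos: "\<And>x. x \<in> S \<Longrightarrow> pot x \<ge> 1"
    and step: "\<And>x. x \<in> S \<Longrightarrow> finite (succ x) \<and> succ x \<subseteq> S \<and> (\<Sum>y\<in>succ x. pot y) \<le> \<rho> * pot x"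
  shows "x \<in> S \<Longrightarrow> finite {xs. length xs = Suc l \<and> hd xs = x \<and> successively (\<lambda>a b. b \<in> succ a) xs} \<and>
    real (card {xs. length xs = Suc l \<and> hd xs = x \<and> successively (\<lambda>a b. b \<in> succ a) xs}) \<le> pot x * \<rho> ^ l"
proof (induction l arbitrary: x)
  case 0
  have "{xs. length xs = Suc 0 \<and> hd xs = x \<and> successively (\<lambda>a b. b \<in> succ a) xs} = {[x]}"
    by (auto simp: length_Suc_conv)
  thus ?case using pos[OF 0] by simp
next
  case (Suc l)
  let ?W = "\<lambda>l x. {xs. length xs = Suc l \<and> hd xs = x \<and> successively (\<lambda>a b. b \<in> succ a) xs}"
  have eq: "?W (Suc l) x = (\<Union>y\<in>succ x. (#) x ` ?W l y)"
  proof (intro set_eqI iffI)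
    fix xs assume "xs \<in> ?W (Suc l) x"
    then obtain ys where ys: "xs = x # ys" "length ys = Suc l" "successively (\<lambda>a b. b \<in> succ a) (x # ys)"
      by (cases xs) auto
    then obtain y zs where y: "ys = y # zs" by (cases ys) auto
    hence "ys \<in> ?W l y" "y \<in> succ x" using ys by auto
    thus "xs \<in> (\<Union>y\<in>succ x. (#) x ` ?W l y)" using ys(1) by blast
  next
    fix xs assume "xs \<in> (\<Union>y\<in>succ x. (#) x ` ?W l y)"
    then obtain y ys where y: "y \<in> succ x" "xs = x # ys" "length ys = Suc l" "hd ys = y" "successively (\<lambda>a b. b \<in> succ a) ys"
      by blast
    then obtain zs where "ys = y # zs" by (cases ys) auto
    thus "xs \<in> ?W (Suc l) x" using y by simp
  qed
  have sx: "finite (succ x)" "succ x \<subseteq> S" "(\<Sum>y\<in>succ x. pot y) \<le> \<rho> * pot x" using step[OF Suc.prems] by auto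
  have IH: "finite (?W l y)" "real (card (?W l y)) \<le> pot y * \<rho> ^ l" if "y \<in> succ x" for y
    using Suc.IH[of y] that sx(2) by auto
  have "real (card (?W (Suc l) x)) \<le> real (\<Sum>y\<in>succ x. card ((#) x ` ?W l y))"
    unfolding eq using card_UN_le[OF sx(1)] by (simp only: of_nat_le_iff)
  also have "\<dots> = (\<Sum>y\<in>succ x. real (card (?W l y)))"
    by (simp add: card_image)
  also have "\<dots> \<le> (\<Sum>y\<in>succ x. pot y * \<rho> ^ l)" by (intro sum_mono IH)
  also have "\<dots> = (\<Sum>y\<in>succ x. pot y) * \<rho> ^ l" by (simp add: sum_distrib_right)
  also have "\<dots> \<le> \<rho> * pot x * \<rho> ^ l" using sx(3) \<rho> by (intro mult_right_mono) auto
  finally have "real (card (?W (Suc l) x)) \<le> pot x * \<rho> ^ Suc l" by (simp add: mult_ac)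
  moreover have "finite (?W (Suc l) x)" unfolding eq using sx(1) IH(1) by blast
  ultimately show ?case by blast
qed

text \<open>
  \<open>Edge i h\<close> traverses \<open>h\<close> in the piece of the bead \<open>i\<close>; \<open>Lip i b j\<close> is at distance \<open>j\<close> on a lip left
  from the bead \<open>i\<close> through a tag labelled \<open>Tag b\<close>. Which tag is at the other end of the lip is left
  open, so that walks do not depend on the pairing of the tags.
\<close>

datatype 'h state = Edge nat 'h | Lip nat bool nat

definition enter :: "(nat \<Rightarrow> 'h fatgraph) \<Rightarrow> nat \<Rightarrow> 'h \<Rightarrow> 'h state" where
  "enter Ys i h = (case lab (Ys i) h of Tag b \<Rightarrow> Lip i b 0 | Gen _ _ \<Rightarrow> Edge i h)"

text \<open>Only the pieces of beads in \<open>A\<close> are consulted. Lips are open everywhere,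
  since their letters belong to no bead.\<close>

fun succs :: "(nat \<Rightarrow> 'h fatgraph) \<Rightarrow> nat set \<Rightarrow> nat \<Rightarrow> 'h state \<Rightarrow> 'h state set" where
  "succs Ys A m (Edge i h) =
     (if i \<in> A then enter Ys i ` (vertex (Ys i) (opp (Ys i) h) - {opp (Ys i) h}) else {})"
| "succs Ys A m (Lip i b j) =
     (if Suc j < m then {Lip i b (Suc j)}
      else let i' = (if b then Suc i else i - 1) in
        if i' \<in> A then
          (\<Union>h\<in>{h \<in> tags (Ys i'). lab (Ys i') h = Tag (\<not> b)}. enter Ys i' ` (vertex (Ys i') h - {h}))
        else {})"

definition states :: "(nat \<Rightarrow> 'h fatgraph) \<Rightarrow> nat set \<Rightarrow> nat \<Rightarrow> nat \<Rightarrow> 'h state set" where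
  "states Ys A M m = {Edge i h | i h. i \<in> A \<and> h \<in> hedges (Ys i) - tags (Ys i)} \<union> {Lip i b j | i b j. i \<le> M \<and> j < m}"

fun state_lab :: "(nat \<Rightarrow> 'h fatgraph) \<Rightarrow> (nat \<Rightarrow> bool \<Rightarrow> word) \<Rightarrow> 'h state \<Rightarrow> symbol" where
  "state_lab Ys lip (Edge i h) = lab (Ys i) h"
| "state_lab Ys lip (Lip i b j) = lip i b ! j"

definition walks :: "(nat \<Rightarrow> 'h fatgraph) \<Rightarrow> nat set \<Rightarrow> nat \<Rightarrow> nat \<Rightarrow> nat \<Rightarrow> 'h state list set" where
  "walks Ys A M m l = {xs. length xs = l \<and> set xs \<subseteq> states Ys A M m \<and> successively (\<lambda>x y. y \<in> succs Ys A m x) xs}"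

definition walk_words :: "(nat \<Rightarrow> 'h fatgraph) \<Rightarrow> nat set \<Rightarrow> nat \<Rightarrow> nat \<Rightarrow> (nat \<Rightarrow> bool \<Rightarrow> word) \<Rightarrow> nat \<Rightarrow> word set" where
  "walk_words Ys A M m lip l = map (state_lab Ys lip) ` walks Ys A M m l"

lemma succs_cong:
  assumes "\<And>i. i \<in> A \<Longrightarrow> Ys i = Zs i"
  shows "succs Ys A m x = succs Zs A m x"
  using assms by (cases x) (auto simp: enter_def Let_def)

lemma states_cong:
  assumes "\<And>i. i \<in> A \<Longrightarrow> Ys i = Zs i"
  shows "states Ys A M m = states Zs A M m"
  using assms unfolding states_def by (intro arg_cong2[where f = "(\<union>)"] Collect_cong) auto

text \<open>The source of independence: exchanging the pieces outside of \<open>A\<close> does not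
  change the words that can be read, as long as the lips stay the same.\<close>

lemma walk_words_cong:
  assumes "\<And>i. i \<in> A \<Longrightarrow> Ys i = Zs i"
    and "\<And>i b j. i \<le> M \<Longrightarrow> j < m \<Longrightarrow> lip i b ! j = lip' i b ! j"
  shows "walk_words Ys A M m lip l = walk_words Zs A M m lip' l"
proof -
  have w: "walks Ys A M m l = walks Zs A M m l"
    using succs_cong[of A Ys Zs] states_cong[of A Ys Zs] assms(1) by (simp add: walks_def)
  have s: "state_lab Ys lip x = state_lab Zs lip' x" if "x \<in> states Zs A M m" for x
    using that assms by (cases x) (auto simp: states_def)
  show ?thesis unfolding walk_words_def w
    by (intro image_cong refl map_cong) (use s in \<open>auto simp: walks_def\<close>)
qed

section \<open>The growth rate of walks\<close>

definition good_piece :: "nat \<Rightarrow> nat \<Rightarrow> word \<Rightarrow> 'h fatgraph \<Rightarrow> bool" where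
  "good_piece L N B Y \<longleftrightarrow> fatgraph Y \<and> trivalent Y \<and> long_edges L Y \<and> boundary Y = copies N B"

text \<open>The number of edges still to be run through after \<open>h\<close> up to the next branch
  vertex. The cap at \<open>L\<close> keeps the potential between 1 and \<rho> ^ L = 2, however long
  an edge of the fatgraph may be.\<close>

definition rem_length :: "nat \<Rightarrow> 'h fatgraph \<Rightarrow> 'h \<Rightarrow> nat" where
  "rem_length L Y h = (LEAST r. r = L \<or> valence Y ((bd_next Y ^^ Suc r) h) = 3)"

lemma rem_length_le: "rem_length L Y h \<le> L"
  unfolding rem_length_def by (rule Least_le) simp

lemma rem_length_eq_0: "valence Y (bd_next Y h) = 3 \<Longrightarrow> rem_length L Y h = 0"
  unfolding rem_length_def by (rule Least_equality) auto

lemma rem_length_geI: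
  assumes "s \<le> L" "\<And>r. r < s \<Longrightarrow> valence Y ((bd_next Y ^^ Suc r) h) \<noteq> 3"
  shows "rem_length L Y h \<ge> s"
proof (rule ccontr)
  assume "\<not> ?thesis"
  hence *: "rem_length L Y h < s" by simp
  have "rem_length L Y h = L \<or> valence Y ((bd_next Y ^^ Suc (rem_length L Y h)) h) = 3"
    unfolding rem_length_def by (rule LeastI[of _ L]) simp
  thus False using * assms by auto
qed

lemma rem_length_bd_next: "rem_length L Y (bd_next Y h) \<ge> rem_length L Y h - 1"
proof (rule rem_length_geI)
  show "rem_length L Y h - 1 \<le> L" using rem_length_le[of L Y h] by simp
  fix r assume "r < rem_length L Y h - 1"
  hence "Suc r < rem_length L Y h" by simp
  from not_less_Least[OF this[unfolded rem_length_def]]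
  show "valence Y ((bd_next Y ^^ Suc r) (bd_next Y h)) \<noteq> 3" by (simp add: funpow_swap1)
qed

lemma rem_length_branch:
  assumes "long_edges L Y" "h \<in> hedges Y - tags Y" "valence Y h = 3"
  shows "rem_length L Y h \<ge> L - 1"
proof (rule rem_length_geI)
  fix r assume "r < L - 1"
  hence "Suc r \<in> {1..<L}" by auto
  hence "valence Y ((bd_next Y ^^ Suc r) h) = 2"
    using assms unfolding long_edges_def by blast
  thus "valence Y ((bd_next Y ^^ Suc r) h) \<noteq> 3" by simp
qed simp

text \<open>
  With \<open>\<rho> ^ L = 2\<close>, the potential of a state pays for the branching at the end of the current edge or
  lip: it grows by at most the factor \<open>\<rho>\<close> in each step, summed over all successors. It can pay for
  the up to \<open>4 * N\<close> successors of the end of a lip because lips get longer and longer with \<open>n\<close>.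
\<close>

fun pot :: "real \<Rightarrow> nat \<Rightarrow> (nat \<Rightarrow> 'h fatgraph) \<Rightarrow> 'h state \<Rightarrow> real" where
  "pot \<rho> L Ys (Edge i h) = \<rho> ^ (L - rem_length L (Ys i) h)"
| "pot \<rho> L Ys (Lip i b j) = \<rho> ^ Suc j"

text \<open>Of an edge of length at least \<open>L\<close> just entered, one step at most has been
  used up; a lip just entered starts with potential \<rho>.\<close>

lemma enter_pot:
  assumes "good_piece L N B (Ys i)" "h \<in> hedges (Ys i)" "valence (Ys i) h = 3" "\<rho> \<ge> 1" "L \<ge> 1"
  shows "pot \<rho> L Ys (enter Ys i h) \<le> \<rho>"
proof (cases "lab (Ys i) h")
  case (Gen a b)
  have fg: "fatgraph (Ys i)" and le: "long_edges L (Ys i)" using assms(1) by (auto simp: good_piece_def)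
  have "h \<in> hedges (Ys i) - tags (Ys i)" using assms(2) Gen fg_tag[OF fg assms(2)] by simp
  from rem_length_branch[OF le this assms(3)]
  have "L - rem_length L (Ys i) h \<le> 1" by simp
  hence "\<rho> ^ (L - rem_length L (Ys i) h) \<le> \<rho> ^ 1" using assms(4) by (intro power_increasing) auto
  thus ?thesis using Gen by (simp add: enter_def)
qed (simp add: enter_def)

lemma enter_in_states:
  assumes "fatgraph (Ys i)" "h \<in> hedges (Ys i)" "i \<in> A" "A \<subseteq> {..M}" "m \<ge> 1"
  shows "enter Ys i h \<in> states Ys A M m"
  using assms fg_tag[OF assms(1,2)] by (cases "lab (Ys i) h") (auto simp: enter_def states_def)

lemma sum_image_card_le:
  fixes f :: "'b \<Rightarrow> real"
  assumes "finite T" "\<And>x. x \<in> T \<Longrightarrow> f (g x) \<le> c" "c \<ge> 0"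
  shows "sum f (g ` T) \<le> real (card T) * c"
proof -
  have "sum f (g ` T) \<le> real (card (g ` T)) * c"
    using sum_bounded_above[of "g ` T" f c] assms(2) by auto
  also have "\<dots> \<le> real (card T) * c"
    using card_image_le[OF assms(1), of g] assms(3) by (intro mult_right_mono) auto
  finally show ?thesis .
qed

lemma card_tags_le:
  assumes "good_piece L N B Y" "length (filter (\<lambda>s. s = Tag b) B) \<le> 1"
  shows "card {h \<in> tags Y. lab Y h = Tag b} \<le> 2 * N"
proof -
  have fg: "fatgraph Y" "boundary Y = copies N B" using assms(1) by (auto simp: good_piece_def)
  have "card {h \<in> hedges Y. lab Y h = Tag b} \<le> 2 * N * length (filter (\<lambda>s. s = Tag b) B)"
  proof (rule card_hedges_label_le[OF fg])
    show "(inv_symbol s = Tag b) = (s = Tag b)" for s by (cases s) auto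
  qed
  also have "\<dots> \<le> 2 * N * 1" by (rule mult_le_mono2[OF assms(2)])
  finally have 1: "card {h \<in> hedges Y. lab Y h = Tag b} \<le> 2 * N" by simp
  have "card {h \<in> tags Y. lab Y h = Tag b} \<le> card {h \<in> hedges Y. lab Y h = Tag b}"
    using fg_finite[OF fg(1)] tags_subset[of Y] by (intro card_mono) auto
  thus ?thesis using 1 by linarith
qed

lemma tag_valence: "trivalent Y \<Longrightarrow> fatgraph Y \<Longrightarrow> h \<in> tags Y \<Longrightarrow> valence Y h = 3"
  using self_in_vertex[of Y h] tags_subset[of Y] unfolding trivalent_def by blast

lemma card_vertex_minus:
  assumes "fatgraph Y" "h \<in> hedges Y"
  shows "card (vertex Y h - {h}) = valence Y h - 1"
  using self_in_vertex[OF assms] finite_vertex[OF assms] by (simp add: valence_def)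

text \<open>At a branch vertex the potential has reached \<rho> ^ L = 2, and the two ways on cost at
  most \<rho> each. Along an edge it is multiplied by at most \<rho>. The end of a lip carries
  \<rho> ^ m >= 4 * N, enough for at most 2 * N tags with two ways on from each.\<close>

lemma pot_step:
  assumes good: "\<And>i. i \<in> A \<Longrightarrow> good_piece L N (B i) (Ys i) \<and> (\<forall>b. length (filter (\<lambda>s. s = Tag b) (B i)) \<le> 1)"
    and A: "A \<subseteq> {..M}" and \<rho>: "\<rho> \<ge> 1" "\<rho> ^ L = 2" "\<rho> ^ m \<ge> 4 * real N" and L: "L \<ge> 1" and m: "m \<ge> 1"
    and x: "x \<in> states Ys A M m"
  shows "finite (succs Ys A m x) \<and> succs Ys A m x \<subseteq> states Ys A M m \<and>
    (\<Sum>y\<in>succs Ys A m x. pot \<rho> L Ys y) \<le> \<rho> * pot \<rho> L Ys x"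
proof (cases x)
  case (Edge i h)
  hence i: "i \<in> A" "h \<in> hedges (Ys i)" "h \<notin> tags (Ys i)" using x by (auto simp: states_def)
  have fg: "fatgraph (Ys i)" and tri: "trivalent (Ys i)" and gp: "good_piece L N (B i) (Ys i)"
    using good[OF i(1)] by (auto simp: good_piece_def)
  let ?g = "opp (Ys i) h"
  let ?T = "vertex (Ys i) ?g - {?g}"
  have g: "?g \<in> hedges (Ys i)" by (rule fg_opp[OF fg i(2)])
  have sub: "vertex (Ys i) ?g \<subseteq> hedges (Ys i)" by (rule vertex_subset[OF fg g])
  have fin: "finite ?T" using finite_vertex[OF fg g] by simp
  have succ: "succs Ys A m x = enter Ys i ` ?T" using Edge i by simp
  have "enter Ys i y \<in> states Ys A M m" if "y \<in> ?T" for y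
    using that sub by (intro enter_in_states[where Ys = Ys and i = i, OF fg _ i(1) A m]) auto
  hence 1: "succs Ys A m x \<subseteq> states Ys A M m" unfolding succ by blast
  have "(\<Sum>y\<in>succs Ys A m x. pot \<rho> L Ys y) \<le> \<rho> * pot \<rho> L Ys x"
  proof (cases "valence (Ys i) ?g = 3")
    case True
    have "rem_length L (Ys i) h = 0"
      by (rule rem_length_eq_0) (simp add: valence_bd_next[OF fg i(2)] True)
    hence px: "pot \<rho> L Ys x = 2" using Edge \<rho>(2) by simp
    have "(\<Sum>y\<in>succs Ys A m x. pot \<rho> L Ys y) \<le> real (card ?T) * \<rho>"
      unfolding succ
    proof (rule sum_image_card_le[OF fin])
      fix y assume "y \<in> ?T"
      hence "y \<in> hedges (Ys i)" "valence (Ys i) y = 3"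
        using sub valence_eq[OF fg g, of y] True by auto
      from enter_pot[where Ys = Ys and i = i, OF gp this \<rho>(1) L] show "pot \<rho> L Ys (enter Ys i y) \<le> \<rho>" .
    qed (use \<rho> in auto)
    also have "real (card ?T) * \<rho> = \<rho> * pot \<rho> L Ys x"
      using card_vertex_minus[OF fg g] True px by simp
    finally show ?thesis .
  next
    case False
    hence v: "valence (Ys i) ?g = 2" "vertex (Ys i) ?g \<inter> tags (Ys i) = {}"
      using tri g by (auto simp: trivalent_def)
    have T: "?T = {bd_next (Ys i) h}" using valence_2_vertex[OF fg g v(1)] by (simp add: bd_next_def)
    have nt: "bd_next (Ys i) h \<in> hedges (Ys i)" "bd_next (Ys i) h \<notin> tags (Ys i)" using T v(2) sub by auto
    have "enter Ys i (bd_next (Ys i) h) = Edge i (bd_next (Ys i) h)"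
      using nt fg_tag[OF fg nt(1)] by (cases "lab (Ys i) (bd_next (Ys i) h)") (auto simp: enter_def)
    hence "(\<Sum>y\<in>succs Ys A m x. pot \<rho> L Ys y) = \<rho> ^ (L - rem_length L (Ys i) (bd_next (Ys i) h))"
      unfolding succ T by simp
    also have "\<dots> \<le> \<rho> ^ Suc (L - rem_length L (Ys i) h)"
      using rem_length_bd_next[of L "Ys i" h] rem_length_le[of L "Ys i" h] \<rho>(1) by (intro power_increasing) auto
    finally show ?thesis using Edge by simp
  qed
  thus ?thesis using 1 fin succ by simp
next
  case (Lip i b j)
  hence i: "i \<le> M" "j < m" using x by (auto simp: states_def)
  show ?thesis
  proof (cases "Suc j < m")
    case True
    thus ?thesis using Lip i by (auto simp: states_def)
  next
    case False
    hence j: "Suc j = m" using i by simp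
    define i' where "i' = (if b then Suc i else i - 1)"
    have succ: "succs Ys A m x = (if i' \<in> A then
          (\<Union>h\<in>{h \<in> tags (Ys i'). lab (Ys i') h = Tag (\<not> b)}. enter Ys i' ` (vertex (Ys i') h - {h}))
        else {})" using Lip False by (simp add: i'_def Let_def)
    show ?thesis
    proof (cases "i' \<in> A")
      case False thus ?thesis using succ Lip \<rho> by simp
    next
      case True
      have fg: "fatgraph (Ys i')" and tri: "trivalent (Ys i')" and gp: "good_piece L N (B i') (Ys i')"
        using good[OF True] by (auto simp: good_piece_def)
      define H where "H = {h \<in> tags (Ys i'). lab (Ys i') h = Tag (\<not> b)}"
      define P where "P = (SIGMA h:H. vertex (Ys i') h - {h})"
      have H: "h \<in> hedges (Ys i')" "valence (Ys i') h = 3" if "h \<in> H" for h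
        using that tags_subset[of "Ys i'"] tag_valence[OF tri fg] by (auto simp: H_def)
      have finH: "finite H" using fg_finite[OF fg] tags_subset[of "Ys i'"] finite_subset unfolding H_def by fastforce
      have finP: "finite P" unfolding P_def using finH finite_vertex[OF fg H(1)] by auto
      have succ': "succs Ys A m x = (\<lambda>p. enter Ys i' (snd p)) ` P"
        unfolding succ P_def H_def using True by force
      have P: "snd p \<in> hedges (Ys i')" "valence (Ys i') (snd p) = 3" if "p \<in> P" for p
      proof -
        obtain h y where p: "p = (h, y)" "h \<in> H" "y \<in> vertex (Ys i') h" using \<open>p \<in> P\<close> by (auto simp: P_def)
        show "snd p \<in> hedges (Ys i')" using vertex_subset[OF fg H(1)[OF p(2)]] p by auto
        show "valence (Ys i') (snd p) = 3" using valence_eq[OF fg H(1)[OF p(2)] p(3)] H(2)[OF p(2)] p by simp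
      qed
      have cH: "card H \<le> 2 * N" unfolding H_def using card_tags_le[OF gp] good[OF True] by blast
      have "card P = (\<Sum>h\<in>H. card (vertex (Ys i') h - {h}))"
        unfolding P_def using finH finite_vertex[OF fg H(1)] by (subst card_SigmaI) auto
      also have "\<dots> = (\<Sum>h\<in>H. 2)" using H card_vertex_minus[OF fg] by (intro sum.cong) auto
      finally have cP: "card P \<le> 4 * N" using cH by simp
      have "(\<Sum>y\<in>succs Ys A m x. pot \<rho> L Ys y) \<le> real (card P) * \<rho>"
        unfolding succ' using enter_pot[where Ys = Ys and i = i', OF gp P \<rho>(1) L] \<rho> by (intro sum_image_card_le[OF finP]) auto
      also have "\<dots> \<le> 4 * real N * \<rho>" using cP \<rho> by (intro mult_right_mono) auto
      also have "\<dots> \<le> \<rho> ^ m * \<rho>" using \<rho> by (intro mult_right_mono) auto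
      also have "\<dots> = \<rho> * pot \<rho> L Ys x" using Lip j by simp
      finally have "(\<Sum>y\<in>succs Ys A m x. pot \<rho> L Ys y) \<le> \<rho> * pot \<rho> L Ys x" .
      moreover have "succs Ys A m x \<subseteq> states Ys A M m"
        unfolding succ' using enter_in_states[where Ys = Ys and i = i', OF fg P(1) True A m] by blast
      ultimately show ?thesis using finP succ' by simp
    qed
  qed
qed

lemma finite_states:
  assumes "\<And>i. i \<in> A \<Longrightarrow> finite (hedges (Ys i)) \<and> card (hedges (Ys i)) \<le> c" "A \<subseteq> {..M}"
  shows "finite (states Ys A M m)" and "card (states Ys A M m) \<le> Suc M * (c + 2 * m)"
proof -
  have fA: "finite A" "card A \<le> Suc M" using assms(2) finite_subset card_mono[of "{..M}" A] by auto
  let ?S1 = "(\<lambda>(i, h). Edge i h) ` (SIGMA i:A. hedges (Ys i))"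
  let ?S2 = "(\<lambda>(i, b, j). Lip i b j) ` ({..M} \<times> (UNIV :: bool set) \<times> {..<m}) :: 'a state set"
  have sub: "states Ys A M m \<subseteq> ?S1 \<union> ?S2"
    by (force simp: states_def image_iff)
  have f: "finite (SIGMA i:A. hedges (Ys i))" using fA assms(1) by auto
  have f1: "finite (?S1 \<union> ?S2)" using f by (intro finite_UnI finite_imageI) auto
  show "finite (states Ys A M m)" using finite_subset[OF sub f1] .
  have "card ?S1 \<le> card (SIGMA i:A. hedges (Ys i))" by (rule card_image_le[OF f])
  also have "\<dots> = (\<Sum>i\<in>A. card (hedges (Ys i)))" using fA assms(1) by (subst card_SigmaI) auto
  also have "\<dots> \<le> card A * c" using sum_bounded_above[of A "\<lambda>i. card (hedges (Ys i))" c] assms(1) by simp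
  also have "\<dots> \<le> Suc M * c" by (rule mult_le_mono1[OF fA(2)])
  finally have 1: "card ?S1 \<le> Suc M * c" .
  have "card ?S2 \<le> card ({..M} \<times> (UNIV :: bool set) \<times> {..<m})" by (intro card_image_le) auto
  also have "\<dots> = Suc M * (2 * m)" by (simp only: card_cartesian_product card_atMost card_lessThan card_UNIV_bool)
  finally have 2: "card ?S2 \<le> Suc M * (2 * m)" .
  have "card (states Ys A M m) \<le> card (?S1 \<union> ?S2)" by (rule card_mono[OF f1 sub])
  also have "\<dots> \<le> card ?S1 + card ?S2" by (rule card_Un_le)
  also have "\<dots> \<le> Suc M * (c + 2 * m)" using 1 2 by (simp only: distrib_left add_mono)
  finally show "card (states Ys A M m) \<le> Suc M * (c + 2 * m)" .
qed

text \<open>Walks are sorted by their first state: there are polynomially many states, each of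
  potential at most 2 * \<rho> ^ m.\<close>

lemma card_walk_words_le:
  assumes good: "\<And>i. i \<in> A \<Longrightarrow> good_piece L N (B i) (Ys i) \<and> (\<forall>b. length (filter (\<lambda>s. s = Tag b) (B i)) \<le> 1) \<and> length (B i) \<le> c"
    and A: "A \<subseteq> {..M}" and \<rho>: "\<rho> \<ge> 1" "\<rho> ^ L = 2" "\<rho> ^ m \<ge> 4 * real N" and L: "L \<ge> 1" and m: "m \<ge> 1" and l: "l \<ge> 1"
  shows "finite (walk_words Ys A M m lip l)"
    and "real (card (walk_words Ys A M m lip l)) \<le> real (Suc M * (2 * N * c + 2 * m)) * (2 * \<rho> ^ m) * \<rho> ^ l"
proof -
  let ?S = "states Ys A M m"
  have h: "finite (hedges (Ys i)) \<and> card (hedges (Ys i)) \<le> 2 * N * c" if "i \<in> A" for i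
  proof -
    have fg: "fatgraph (Ys i)" "boundary (Ys i) = copies N (B i)" and c: "length (B i) \<le> c"
      using good[OF that] by (auto simp: good_piece_def)
    show ?thesis using order.trans[OF card_hedges_le[OF fg] mult_le_mono2[OF c]] fg_finite[OF fg(1)] by simp
  qed
  have fS: "finite ?S" "card ?S \<le> Suc M * (2 * N * c + 2 * m)"
    using finite_states[of A Ys "2 * N * c" M m] h A by blast+
  have one: "pot \<rho> L Ys x \<ge> 1" for x using \<rho>(1) by (cases x) (simp_all del: power_Suc)
  have \<rho>m: "\<rho> ^ m \<ge> 1" using \<rho>(1) by simp
  have up: "pot \<rho> L Ys x \<le> 2 * \<rho> ^ m" if "x \<in> ?S" for x
  proof (cases x)
    case (Edge i h)
    have "pot \<rho> L Ys x \<le> \<rho> ^ L" using Edge \<rho>(1) by (simp add: power_increasing)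
    thus ?thesis using \<rho>m \<rho>(2) by simp
  next
    case (Lip i b j)
    hence "Suc j \<le> m" using that by (auto simp: states_def)
    hence "pot \<rho> L Ys x \<le> \<rho> ^ m" unfolding Lip pot.simps by (rule power_increasing[OF _ \<rho>(1)])
    thus ?thesis using \<rho>m by simp
  qed
  obtain l' where l': "l = Suc l'" using l by (cases l) auto
  let ?W = "\<lambda>x. {xs. length xs = Suc l' \<and> hd xs = x \<and> successively (\<lambda>a b. b \<in> succs Ys A m a) xs}"
  have wc: "finite (?W x) \<and> real (card (?W x)) \<le> pot \<rho> L Ys x * \<rho> ^ l'" if "x \<in> ?S" for x
  proof (rule walks_count[where S = ?S])
    show "finite (succs Ys A m y) \<and> succs Ys A m y \<subseteq> ?S \<and> sum (pot \<rho> L Ys) (succs Ys A m y) \<le> \<rho> * pot \<rho> L Ys y"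
      if "y \<in> ?S" for y using good by (intro pot_step[OF _ A \<rho> L m that]) blast
  qed (use \<rho> one that in auto)
  have sub: "walks Ys A M m l \<subseteq> (\<Union>x\<in>?S. ?W x)"
  proof
    fix xs assume xs: "xs \<in> walks Ys A M m l"
    hence "xs \<noteq> []" by (auto simp: walks_def l')
    hence "hd xs \<in> ?S" using xs by (auto simp: walks_def)
    thus "xs \<in> (\<Union>x\<in>?S. ?W x)" using xs by (auto simp: walks_def l')
  qed
  have finU: "finite (\<Union>x\<in>?S. ?W x)" using fS(1) wc by blast
  have fw: "finite (walks Ys A M m l)" using finite_subset[OF sub finU] .
  thus "finite (walk_words Ys A M m lip l)" by (simp add: walk_words_def)
  have "real (card (walk_words Ys A M m lip l)) \<le> real (card (walks Ys A M m l))"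
    unfolding walk_words_def using card_image_le[OF fw] by simp
  also have "\<dots> \<le> real (card (\<Union>x\<in>?S. ?W x))" using card_mono[OF finU sub] by simp
  also have "\<dots> \<le> real (\<Sum>x\<in>?S. card (?W x))" using card_UN_le[OF fS(1)] by (simp only: of_nat_le_iff)
  also have "\<dots> = (\<Sum>x\<in>?S. real (card (?W x)))" by simp
  also have "\<dots> \<le> (\<Sum>x\<in>?S. 2 * \<rho> ^ m * \<rho> ^ l)"
  proof (rule sum_mono)
    fix x assume x: "x \<in> ?S"
    have "real (card (?W x)) \<le> pot \<rho> L Ys x * \<rho> ^ l'" using wc[OF x] by simp
    also have "\<dots> \<le> 2 * \<rho> ^ m * \<rho> ^ l"
      using up[OF x] \<rho>(1) \<rho>m l' by (intro mult_mono) (auto intro: power_increasing simp del: power_Suc)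
    finally show "real (card (?W x)) \<le> 2 * \<rho> ^ m * \<rho> ^ l" .
  qed
  also have "\<dots> = real (card ?S) * (2 * \<rho> ^ m * \<rho> ^ l)" by simp
  also have "\<dots> \<le> real (Suc M * (2 * N * c + 2 * m)) * (2 * \<rho> ^ m * \<rho> ^ l)"
    using fS(2) \<rho>m \<rho>(1) by (intro mult_right_mono) (simp_all only: of_nat_le_iff, auto)
  finally show "real (card (walk_words Ys A M m lip l)) \<le> real (Suc M * (2 * N * c + 2 * m)) * (2 * \<rho> ^ m) * \<rho> ^ l"
    by (simp only: mult.assoc)
qed

section \<open>Paths in the joined fatgraph\<close>

text \<open>Keeps a path that leaves a lip from entering another lip at once. It has to run along an
  edge of the piece, so that the bead it has reached shows up as an \<open>Edge\<close>
  state.\<close>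

definition no_adjacent_tags :: "word \<Rightarrow> bool" where
  "no_adjacent_tags B \<longleftrightarrow> (\<forall>j. \<not> ((\<exists>b. cnth B j = Tag b) \<and> (\<exists>b. cnth B (Suc j) = Tag b)))"

lemma cnth_inv_word_Suc:
  assumes "w \<noteq> []"
  obtains c where "cnth (inv_word w) j = inv_symbol (cnth w (Suc c))"
    "cnth (inv_word w) (Suc j) = inv_symbol (cnth w c)"
proof
  define c where "c = length w * (j+2) - (j + 2)"
  have "length w * (j+2) \<ge> j + 2" using assms by (cases "length w") simp_all
  hence *: "Suc (Suc j + c) = length w * (j+2)" by (simp add: c_def)
  show "cnth (inv_word w) (Suc j) = inv_symbol (cnth w c)"
    using * by (intro cnth_inv_word assms) simp
  show "cnth (inv_word w) j = inv_symbol (cnth w (Suc c))"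
    using * by (intro cnth_inv_word assms) simp
qed

lemma inv_symbol_eq_Tag [simp]: "inv_symbol s = Tag b \<longleftrightarrow> s = Tag b"
  by (cases s) auto

lemma no_adjacent_tags_inv_word:
  assumes "no_adjacent_tags B" "B \<noteq> []" shows "no_adjacent_tags (inv_word B)"
  unfolding no_adjacent_tags_def
proof
  fix j
  obtain c where "cnth (inv_word B) j = inv_symbol (cnth B (Suc c))"
    "cnth (inv_word B) (Suc j) = inv_symbol (cnth B c)" using cnth_inv_word_Suc[OF assms(2)] .
  thus "\<not> ((\<exists>b. cnth (inv_word B) j = Tag b) \<and> (\<exists>b. cnth (inv_word B) (Suc j) = Tag b))"
    using assms(1) by (auto simp: no_adjacent_tags_def)
qed

lemma no_adjacent_tags_cyc:
  assumes "no_adjacent_tags B" "B \<noteq> []" "v \<in> cyc B" shows "no_adjacent_tags v"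
proof -
  obtain x where v: "v = rotate x B" using assms(3) by (auto simp: cyc_iff)
  show ?thesis unfolding no_adjacent_tags_def v
  proof
    fix j
    show "\<not> ((\<exists>b. cnth (rotate x B) j = Tag b) \<and> (\<exists>b. cnth (rotate x B) (Suc j) = Tag b))"
      using assms(1)[unfolded no_adjacent_tags_def, rule_format, of "x + j"] by (simp add: cnth_rotate[OF assms(2)])
  qed
qed

text \<open>Two tags at a trivalent vertex are consecutive in the cyclic order. Since the boundary
  stays at the vertex when it meets a tag, they would be adjacent letters of a boundary
  word.\<close>

lemma tags_not_adjacent:
  assumes Y: "good_piece L N B Y" and B: "no_adjacent_tags B" "B \<noteq> []"
    and h: "h \<in> tags Y" "y \<in> vertex Y h" "y \<noteq> h"
  shows "y \<notin> tags Y"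
proof
  assume y: "y \<in> tags Y"
  have fg: "fatgraph Y" "boundary Y = copies N B" "trivalent Y" using Y by (auto simp: good_piece_def)
  have *: False if "e \<in> tags Y" "nxt Y e \<in> tags Y" for e
  proof -
    have e: "e \<in> hedges Y" "nxt Y e \<in> hedges Y" using that subsetD[OF tags_subset[of Y]] by auto
    obtain v where v: "v \<in> cyc B \<union> cyc (inv_word B)" "\<And>j. lab Y ((bd_next Y ^^ j) e) = cnth v j"
      using boundary_reading[OF fg(1,2) e(1)] by metis
    have "lab Y e = cnth v 0" "lab Y (nxt Y e) = cnth v (Suc 0)"
      using v(2)[of 0] v(2)[of 1] opp_tag[OF that(1)] by (auto simp: bd_next_def)
    moreover have "no_adjacent_tags v"
      using v(1) no_adjacent_tags_cyc[OF B] no_adjacent_tags_cyc[OF no_adjacent_tags_inv_word[OF B]] B(2) by auto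
    ultimately show False using that fg_tag[OF fg(1)] e unfolding no_adjacent_tags_def by metis
  qed
  have "h \<in> hedges Y" using subsetD[OF tags_subset[of Y] h(1)] .
  from valence_3_adjacent[OF fg(1) this tag_valence[OF fg(3,1) h(1)] h(2,3)]
  show False using * h(1) y by auto
qed

text \<open>One spine with a fixed pairing of its tags. The length of a lip is prescribed only at
  tags that occur, because the last bead has no lip leading on.\<close>

locale joined_beads =
  fixes Ys :: "nat \<Rightarrow> 'h fatgraph" and B :: "nat \<Rightarrow> word" and L N M m :: nat
    and \<mu> :: "nat \<times> 'h \<Rightarrow> nat \<times> 'h" and lip :: "nat \<Rightarrow> symbol \<Rightarrow> word"
  assumes good: "\<And>i. i \<le> M \<Longrightarrow> good_piece L N (B i) (Ys i)"
    and nonadj: "\<And>i. i \<le> M \<Longrightarrow> no_adjacent_tags (B i) \<and> B i \<noteq> []"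
    and pairing: "tag_pairing B (disjoint_union {..M} Ys) \<mu>"
    and lip_len: "\<And>i h b. i \<le> M \<Longrightarrow> h \<in> tags (Ys i) \<Longrightarrow> lab (Ys i) h = Tag b \<Longrightarrow> length (lip i (Tag b)) = m"
    and m: "m \<ge> 1"
begin

definition U :: "(nat \<times> 'h) fatgraph" where "U = disjoint_union {..M} Ys"
definition Y :: "((nat \<times> 'h) \<times> nat) fatgraph" where "Y = join_tags U \<mu> (\<lambda>x. lip (fst x) (lab U x))"

lemma fgi: "i \<le> M \<Longrightarrow> fatgraph (Ys i)" and trii: "i \<le> M \<Longrightarrow> trivalent (Ys i)"
  and bdi: "i \<le> M \<Longrightarrow> boundary (Ys i) = copies N (B i)"
  using good by (auto simp: good_piece_def)

lemma U_simps [simp]: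
  "hedges U = (SIGMA i:{..M}. hedges (Ys i))" "opp U (i, h) = (i, opp (Ys i) h)"
  "nxt U (i, h) = (i, nxt (Ys i) h)" "lab U (i, h) = lab (Ys i) h"
  by (simp_all add: U_def disjoint_union_def)

lemma tags_U: "(i, h) \<in> tags U \<longleftrightarrow> i \<le> M \<and> h \<in> tags (Ys i)"
  by (auto simp: tags_def)

lemma tagD: "i \<le> M \<Longrightarrow> h \<in> tags (Ys i) \<Longrightarrow> \<exists>b. lab (Ys i) h = Tag b"
  using fg_tag[OF fgi, of i h] tags_subset[of "Ys i"] by blast

lemma mu_tag:
  assumes "i \<le> M" "h \<in> tags (Ys i)" "lab (Ys i) h = Tag b"
  obtains h' where "\<mu> (i, h) = ((if b then Suc i else i - 1), h')" "(if b then Suc i else i - 1) \<le> M"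
    "h' \<in> tags (Ys (if b then Suc i else i - 1))" "lab (Ys (if b then Suc i else i - 1)) h' = Tag (\<not> b)"
    "\<mu> (if b then Suc i else i - 1, h') = (i, h)" "\<not> b \<Longrightarrow> i > 0"
proof -
  obtain i' h' where mu: "\<mu> (i, h) = (i', h')" by (cases "\<mu> (i, h)")
  have "(i, h) \<in> tags U" using assms by (simp add: tags_U)
  hence *: "\<mu> (i, h) \<in> tags U" "\<mu> (\<mu> (i, h)) = (i, h)"
    "lab U (i, h) = Tag True \<longrightarrow> fst (\<mu> (i, h)) = Suc (fst (i, h)) \<and> lab U (\<mu> (i, h)) = Tag False"
    "lab U (i, h) = Tag False \<longrightarrow> fst (i, h) = Suc (fst (\<mu> (i, h))) \<and> lab U (\<mu> (i, h)) = Tag True"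
    using pairing unfolding tag_pairing_def U_def by blast+
  have "i' = (if b then Suc i else i - 1)" "lab (Ys i') h' = Tag (\<not> b)" "\<not> b \<Longrightarrow> i > 0"
    using *(3,4) assms(3) mu by (cases b; auto)+
  thus thesis using that[of h'] * mu by (auto simp: tags_U)
qed

lemma lip_length_tag: "(i, h) \<in> tags U \<Longrightarrow> length (lip i (lab (Ys i) h)) = m"
  using tagD lip_len by (fastforce simp: tags_U)

lemma hedges_Y: "((i, h), j) \<in> hedges Y \<longleftrightarrow> i \<le> M \<and> h \<in> hedges (Ys i) \<and> (if h \<in> tags (Ys i) then j < m else j = 0)"
  using lip_length_tag by (auto simp: Y_def join_tags_def tags_U)

lemma opp_Y: "i \<le> M \<Longrightarrow> opp Y ((i, h), j) = (if h \<in> tags (Ys i) then (\<mu> (i, h), m - 1 - j) else ((i, opp (Ys i) h), 0))"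
  using lip_length_tag[of i h] by (auto simp: Y_def join_tags_def tags_U)

lemma nxt_Y_0: "nxt Y ((i, h), 0) = ((i, nxt (Ys i) h), 0)"
  by (simp add: Y_def join_tags_def)

lemma nxt_Y_Suc: "i \<le> M \<Longrightarrow> h \<in> tags (Ys i) \<Longrightarrow> j > 0 \<Longrightarrow> nxt Y ((i, h), j) = (\<mu> (i, h), m - j)"
  using lip_length_tag[of i h] by (auto simp: Y_def join_tags_def tags_U)

lemma lab_Y: "i \<le> M \<Longrightarrow> lab Y ((i, h), j) = (if h \<in> tags (Ys i) then lip i (lab (Ys i) h) ! j else lab (Ys i) h)"
  by (auto simp: Y_def join_tags_def tags_U)

lemma vertex_Y_0: "vertex Y ((i, h), 0) = (\<lambda>y. ((i, y), 0)) ` vertex (Ys i) h"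
proof -
  have *: "(nxt Y ^^ n) ((i, h), 0) = ((i, (nxt (Ys i) ^^ n) h), 0)" for n
    by (induction n) (simp_all add: nxt_Y_0)
  show ?thesis unfolding vertex_def orbit_altdef * by auto
qed

text \<open>An inner vertex of a lip has valence 2; at distance j from one end, it is at distance m
  - j from the other.\<close>

lemma vertex_Y_lip:
  assumes x: "i \<le> M" "h \<in> tags (Ys i)" and j: "0 < j" "j < m" and e: "e \<in> vertex Y ((i, h), j)"
  shows "e = ((i, h), j) \<or> e = (\<mu> (i, h), m - j)"
proof -
  obtain b where b: "lab (Ys i) h = Tag b" using tagD[OF x] by blast
  define i' where "i' = (if b then Suc i else i - 1)"
  obtain h' where h': "\<mu> (i, h) = (i', h')" "i' \<le> M" "h' \<in> tags (Ys i')" "\<mu> (i', h') = (i, h)"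
    using mu_tag[OF x b] unfolding i'_def by metis
  have n1: "nxt Y ((i, h), j) = (\<mu> (i, h), m - j)" by (rule nxt_Y_Suc[OF x j(1)])
  have n2: "nxt Y (\<mu> (i, h), m - j) = ((i, h), j)"
    using nxt_Y_Suc[OF h'(2,3), of "m - j"] h' j by simp
  from e[unfolded vertex_def] show ?thesis
    by induction (use n1 n2 in auto)
qed

lemma step_edge:
  assumes "((i, h), j) \<in> hedges Y" "h \<notin> tags (Ys i)" "e \<in> vertex Y (opp Y ((i, h), j))" "e \<noteq> opp Y ((i, h), j)"
  obtains y where "e = ((i, y), 0)" "y \<in> vertex (Ys i) (opp (Ys i) h) - {opp (Ys i) h}"
proof -
  have i: "i \<le> M" using assms(1) by (simp add: hedges_Y)
  have o: "opp Y ((i, h), j) = ((i, opp (Ys i) h), 0)" using opp_Y[OF i] assms(2) by simp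
  show thesis using that assms(3,4) unfolding o vertex_Y_0 by auto
qed

text \<open>Inside a lip the only alternative to going on is turning back, which an immersed path
  never does.\<close>

lemma step_lip:
  assumes "((i, h), j) \<in> hedges Y" "h \<in> tags (Ys i)" "e \<in> vertex Y (opp Y ((i, h), j))" "e \<noteq> opp Y ((i, h), j)"
    and "Suc j < m"
  shows "e = ((i, h), Suc j)"
proof -
  have i: "i \<le> M" using assms(1) by (simp add: hedges_Y)
  obtain b where b: "lab (Ys i) h = Tag b" using tagD[OF i assms(2)] by blast
  define i' where "i' = (if b then Suc i else i - 1)"
  obtain h' where h': "\<mu> (i, h) = (i', h')" "i' \<le> M" "h' \<in> tags (Ys i')" "\<mu> (i', h') = (i, h)"
    using mu_tag[OF i assms(2) b] unfolding i'_def by metis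
  have o: "opp Y ((i, h), j) = ((i', h'), m - 1 - j)" using opp_Y[OF i] assms(2) h' by simp
  have "0 < m - 1 - j" "m - 1 - j < m" using assms(5) by auto
  from vertex_Y_lip[OF h'(2,3) this assms(3)[unfolded o]] assms(4)[unfolded o] h'(4) assms(5)
  show ?thesis by auto
qed

lemma step_lip_end:
  assumes "((i, h), j) \<in> hedges Y" "h \<in> tags (Ys i)" "lab (Ys i) h = Tag b"
    "e \<in> vertex Y (opp Y ((i, h), j))" "e \<noteq> opp Y ((i, h), j)" and "Suc j = m"
  obtains h' y where "(if b then Suc i else i - 1) \<le> M" "h' \<in> tags (Ys (if b then Suc i else i - 1))"
    "lab (Ys (if b then Suc i else i - 1)) h' = Tag (\<not> b)"
    "y \<in> vertex (Ys (if b then Suc i else i - 1)) h' - {h'}"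
    "e = ((if b then Suc i else i - 1, y), 0)" "y \<notin> tags (Ys (if b then Suc i else i - 1))"
    "\<not> b \<Longrightarrow> i > 0"
proof -
  have i: "i \<le> M" using assms(1) by (simp add: hedges_Y)
  define i' where "i' = (if b then Suc i else i - 1)"
  obtain h' where h': "\<mu> (i, h) = (i', h')" "i' \<le> M" "h' \<in> tags (Ys i')" "lab (Ys i') h' = Tag (\<not> b)" "\<not> b \<Longrightarrow> i > 0"
    using mu_tag[OF i assms(2,3)] unfolding i'_def by metis
  have o: "opp Y ((i, h), j) = ((i', h'), 0)" using opp_Y[OF i] assms(2,6) h' by auto
  obtain y where y: "y \<in> vertex (Ys i') h'" "e = ((i', y), 0)" "y \<noteq> h'"
    using assms(4,5) unfolding o vertex_Y_0 by auto
  have "y \<notin> tags (Ys i')"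
    using tags_not_adjacent[OF good[OF h'(2)]] nonadj[OF h'(2)] h'(3) y by blast
  thus thesis using that[of h' y] h' y unfolding i'_def[symmetric] by auto
qed

fun state_of :: "(nat \<times> 'h) \<times> nat \<Rightarrow> 'h state" where
  "state_of ((i, h), j) = (case lab (Ys i) h of Tag b \<Rightarrow> Lip i b j | Gen _ _ \<Rightarrow> Edge i h)"

lemma state_of_nontag: "i \<le> M \<Longrightarrow> h \<in> hedges (Ys i) \<Longrightarrow> h \<notin> tags (Ys i) \<Longrightarrow> state_of ((i, h), j) = Edge i h"
  using fg_tag[OF fgi, of i h] by (auto split: symbol.split)

lemma state_of_0: "state_of ((i, h), 0) = enter Ys i h"
  by (auto simp: enter_def split: symbol.split)

lemma state_of_Edge: "((i, h), j) \<in> hedges Y \<Longrightarrow> state_of ((i, h), j) = Edge i' h' \<longleftrightarrow> i' = i \<and> h' = h \<and> h \<notin> tags (Ys i)"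
  using fg_tag[OF fgi, of i h] by (auto simp: hedges_Y split: symbol.splits)

lemma state_lab_state_of:
  assumes "e \<in> hedges Y"
    and lip': "\<And>i b. i \<le> M \<Longrightarrow> (b \<Longrightarrow> i < M) \<Longrightarrow> lip' i b = lip i (Tag b)"
  shows "state_lab Ys lip' (state_of e) = lab Y e"
proof -
  obtain i h j where e: "e = ((i, h), j)" by (metis surj_pair)
  have i: "i \<le> M" "h \<in> hedges (Ys i)" using assms e by (auto simp: hedges_Y)
  show ?thesis
  proof (cases "h \<in> tags (Ys i)")
    case True
    obtain b where b: "lab (Ys i) h = Tag b" using tagD[OF i(1) True] by blast
    have "(if b then Suc i else i - 1) \<le> M" using mu_tag[OF i(1) True b] by blast
    hence "b \<Longrightarrow> i < M" by simp
    from lip'[OF i(1) this] show ?thesis using True b lab_Y[OF i(1)] e by simp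
  next
    case False
    thus ?thesis using state_of_nontag[OF i False] lab_Y[OF i(1)] e by (simp del: state_of.simps)
  qed
qed

lemma immersedD:
  assumes "immersed_path Y \<gamma>"
  shows "set \<gamma> \<subseteq> hedges Y"
    and "Suc t < length \<gamma> \<Longrightarrow> \<gamma> ! Suc t \<in> vertex Y (opp Y (\<gamma> ! t))"
    and "Suc t < length \<gamma> \<Longrightarrow> \<gamma> ! Suc t \<noteq> opp Y (\<gamma> ! t)"
  using assms by (auto simp: immersed_path_def successively_conv_nth)

text \<open>The translation of paths into walks. \<open>lip'\<close> has to agree with
  \<open>lip\<close> only where a lip exists, so its remaining values can be chosen
  conveniently.\<close>

lemma path_walk:
  assumes \<gamma>: "immersed_path Y \<gamma>" and A: "\<And>e i h. e \<in> set \<gamma> \<Longrightarrow> state_of e = Edge i h \<Longrightarrow> i \<in> A"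
    and lip': "\<And>i b. i \<le> M \<Longrightarrow> (b \<Longrightarrow> i < M) \<Longrightarrow> lip' i b = lip i (Tag b)"
  shows "map (lab Y) \<gamma> \<in> walk_words Ys A M m lip' (length \<gamma>)"
proof -
  note im = immersedD[OF \<gamma>]
  have st: "state_of e \<in> states Ys A M m" if "e \<in> set \<gamma>" for e
  proof -
    obtain i h j where e: "e = ((i, h), j)" by (metis surj_pair)
    have i: "i \<le> M" "h \<in> hedges (Ys i)" "if h \<in> tags (Ys i) then j < m else j = 0"
      using im(1) that e by (auto simp: hedges_Y)
    show ?thesis
    proof (cases "h \<in> tags (Ys i)")
      case True
      thus ?thesis using tagD[OF i(1) True] i e by (auto simp: states_def)
    next
      case False
      thus ?thesis using state_of_nontag[OF i(1,2) False] A[OF that] i e by (auto simp: states_def simp del: state_of.simps)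
    qed
  qed
  have succ: "state_of (\<gamma> ! Suc t) \<in> succs Ys A m (state_of (\<gamma> ! t))" if t: "Suc t < length \<gamma>" for t
  proof -
    obtain i h j where e: "\<gamma> ! t = ((i, h), j)" by (metis surj_pair)
    have d: "((i, h), j) \<in> hedges Y" using nth_in_subset[OF im(1), of t] t e by simp
    have i: "i \<le> M" "h \<in> hedges (Ys i)" "if h \<in> tags (Ys i) then j < m else j = 0" using d by (auto simp: hedges_Y)
    note st = im(2,3)[OF t, unfolded e]
    have in1: "\<gamma> ! t \<in> set \<gamma>" "\<gamma> ! Suc t \<in> set \<gamma>" using t by auto
    show ?thesis
    proof (cases "h \<in> tags (Ys i)")
      case False
      obtain y where y: "\<gamma> ! Suc t = ((i, y), 0)" "y \<in> vertex (Ys i) (opp (Ys i) h) - {opp (Ys i) h}"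
        using step_edge[OF d False st] .
      have "state_of (\<gamma> ! t) = Edge i h" using state_of_nontag[OF i(1,2) False] e by (simp del: state_of.simps)
      moreover from this have "i \<in> A" by (rule A[OF in1(1)])
      ultimately show ?thesis using y unfolding y(1) state_of_0 by simp
    next
      case True
      obtain b where b: "lab (Ys i) h = Tag b" using tagD[OF i(1) True] by blast
      have s: "state_of (\<gamma> ! t) = Lip i b j" using b e by simp
      show ?thesis
      proof (cases "Suc j < m")
        case sj: True
        show ?thesis using step_lip[OF d True st sj] s sj b by simp
      next
        case False
        hence sj: "Suc j = m" using i(3) True by simp
        define i' where "i' = (if b then Suc i else i - 1)"
        obtain h' y where y: "i' \<le> M" "h' \<in> tags (Ys i')" "lab (Ys i') h' = Tag (\<not> b)"
          "y \<in> vertex (Ys i') h' - {h'}" "\<gamma> ! Suc t = ((i', y), 0)" "y \<notin> tags (Ys i')"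
          using step_lip_end[OF d True b st sj] unfolding i'_def by metis
        have "((i', y), 0) \<in> hedges Y" using nth_in_subset[OF im(1) t] y(5) by simp
        hence "y \<in> hedges (Ys i')" by (simp add: hedges_Y)
        hence "state_of (\<gamma> ! Suc t) = Edge i' y" using state_of_nontag[OF y(1) _ y(6)] y(5) by (simp del: state_of.simps)
        hence "i' \<in> A" using A[OF in1(2)] by blast
        hence "enter Ys i' y \<in> succs Ys A m (Lip i b j)"
          using y(2-4) sj by (auto simp: Let_def i'_def[symmetric])
        thus ?thesis unfolding s y(5) state_of_0 .
      qed
    qed
  qed
  have "map state_of \<gamma> \<in> walks Ys A M m (length \<gamma>)"
    using st succ by (auto simp: walks_def successively_conv_nth)
  moreover have "map (lab Y) \<gamma> = map (state_lab Ys lip') (map state_of \<gamma>)"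
    using state_lab_state_of[OF _ lip'] im(1) by (auto simp: subset_iff)
  ultimately show ?thesis unfolding walk_words_def by blast
qed

text \<open>A discrete intermediate value argument: after the last time spent on an edge of a bead
  of index at most i, the path can only continue through a lip, and since lips join consecutive
  beads it leaves from the bead i itself.\<close>

lemma crossing:
  assumes \<gamma>: "immersed_path Y \<gamma>" and t: "t1 < t2" "t2 < length \<gamma>"
    and e1: "state_of (\<gamma> ! t1) = Edge i h1" and e2: "state_of (\<gamma> ! t2) = Edge (Suc i) h2"
  obtains t h where "t1 < t" "t + m \<le> t2" "i \<le> M" "h \<in> tags (Ys i)" "lab (Ys i) h = Tag True"
    "\<And>j. j < m \<Longrightarrow> \<gamma> ! (t + j) = ((i, h), j)"
proof -
  note im = immersedD[OF \<gamma>]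
  define T where "T = {t. t1 \<le> t \<and> t \<le> t2 \<and> (\<exists>i' h'. i' \<le> i \<and> state_of (\<gamma> ! t) = Edge i' h')}"
  have T: "finite T" "t1 \<in> T" using t e1 by (auto simp: T_def)
  define s where "s = Max T"
  have s: "s \<in> T" using Max_in[OF T(1)] T(2) by (auto simp: s_def)
  have max: "r \<notin> T" if "r > s" for r using that Max_ge[OF T(1)] unfolding s_def by (meson leD)
  obtain i' h' where i': "t1 \<le> s" "s \<le> t2" "i' \<le> i" "state_of (\<gamma> ! s) = Edge i' h'" using s by (auto simp: T_def)
  have st2: "s < t2" using i' e2 by (cases "s = t2") auto
  have ex: "\<exists>i h j. \<gamma> ! r = ((i, h), j) \<and> ((i, h), j) \<in> hedges Y" if "r < length \<gamma>" for r
    using nth_in_subset[OF im(1) that] by (cases "\<gamma> ! r") auto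
  obtain j0 where d0: "\<gamma> ! s = ((i', h'), j0)" "((i', h'), j0) \<in> hedges Y" "h' \<notin> tags (Ys i')"
    using ex[of s] st2 t state_of_Edge i'(4) by (metis order.strict_trans)
  have iM: "i' \<le> M" using d0 by (simp add: hedges_Y)
  have l1: "Suc s < length \<gamma>" using st2 t by simp
  obtain y where y: "\<gamma> ! Suc s = ((i', y), 0)"
    using step_edge[OF d0(2,3)] im(2,3)[OF l1] d0(1) by metis
  have yh: "((i', y), 0) \<in> hedges Y" using nth_in_subset[OF im(1) l1] y by simp
  have notE: "i'' > i" if "state_of (\<gamma> ! r) = Edge i'' h''" "s < r" "r \<le> t2" for r i'' h''
    using max[OF that(2)] that i'(1) by (fastforce simp: T_def)
  have yt: "y \<in> tags (Ys i')"
  proof (rule ccontr)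
    assume "y \<notin> tags (Ys i')"
    hence "state_of (\<gamma> ! Suc s) = Edge i' y" using state_of_Edge[OF yh] y by simp
    from notE[OF this] st2 i'(3) show False by simp
  qed
  obtain b where b: "lab (Ys i') y = Tag b" using tagD[OF iM yt] by blast
  \<comment> \<open>The time t2 is spent on an edge, so it cannot come while the path is on the lip;
    hence the lip is traversed to its end.\<close>
  have along: "j < m \<Longrightarrow> Suc s + j < t2 \<and> \<gamma> ! (Suc s + j) = ((i', y), j)" for j
  proof (induction j)
    case 0
    have "Suc s \<noteq> t2" using y b e2 by auto
    thus ?case using st2 y by simp
  next
    case (Suc j)
    hence IH: "Suc s + j < t2" "\<gamma> ! (Suc s + j) = ((i', y), j)" by auto
    have l: "Suc (Suc s + j) < length \<gamma>" using IH(1) t by simp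
    have dh: "((i', y), j) \<in> hedges Y" using nth_in_subset[OF im(1), of "Suc s + j"] l IH(2) by simp
    have g: "\<gamma> ! (Suc (Suc s + j)) = ((i', y), Suc j)"
      using step_lip[OF dh yt] im(2,3)[OF l] IH(2) Suc.prems by metis
    have "Suc (Suc s + j) \<noteq> t2" using g b e2 by auto
    thus ?case using g IH(1) by simp
  qed
  define r where "r = Suc s + (m - 1)"
  have r: "r < t2" "\<gamma> ! r = ((i', y), m - 1)" using along[of "m - 1"] m by (auto simp: r_def)
  have l: "Suc r < length \<gamma>" using r t by simp
  have dh: "((i', y), m - 1) \<in> hedges Y" using nth_in_subset[OF im(1), of r] l r(2) by simp
  have mm: "Suc (m - 1) = m" using m by simp
  obtain z where z: "(if b then Suc i' else i' - 1) \<le> M" "\<gamma> ! Suc r = ((if b then Suc i' else i' - 1, z), 0)"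
      "z \<notin> tags (Ys (if b then Suc i' else i' - 1))"
    using step_lip_end[OF dh yt b _ _ mm] im(2,3)[OF l] r(2) by metis
  have zh: "((if b then Suc i' else i' - 1, z), 0) \<in> hedges Y" using nth_in_subset[OF im(1) l] z(2) by simp
  have "state_of (\<gamma> ! Suc r) = Edge (if b then Suc i' else i' - 1) z" using state_of_Edge[OF zh] z by simp
  from notE[OF this] r have "(if b then Suc i' else i' - 1) > i" by (auto simp: r_def)
  hence bi: "b" "i' = i" using i'(3) by (auto split: if_splits)
  show thesis
  proof (rule that[of "Suc s" y])
    show "t1 < Suc s" using i'(1) by simp
    show "Suc s + m \<le> t2" using r m by (simp add: r_def)
    show "i \<le> M" "y \<in> tags (Ys i)" "lab (Ys i) y = Tag True" using iM yt b bi by auto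
    show "\<gamma> ! (Suc s + j) = ((i, y), j)" if "j < m" for j using along[OF that] bi by simp
  qed
qed

end

section \<open>Cuts and beads\<close>

definition matched :: "word \<Rightarrow> nat \<Rightarrow> bool" where
  "matched w x \<longleftrightarrow> w ! x = inv_symbol (w ! (length w - 1 - x))"

lemma length_slice: "b \<le> length w \<Longrightarrow> length (slice w a b) = b - a"
  by (simp add: slice_def)

lemma nth_slice: "b \<le> length w \<Longrightarrow> j < b - a \<Longrightarrow> slice w a b ! j = w ! (a + j)"
  by (simp add: slice_def)

text \<open>A lip is a maximal run of matched distances of length exactly m; in this form it is
  evident which letters decide about it.\<close>

lemma lip_at_iff:
  assumes "t \<ge> 1" "t + m < length w"
  shows "lip_at m w t \<longleftrightarrow> (\<forall>j<m. matched w (t + j)) \<and> \<not> matched w (t - 1) \<and> \<not> matched w (t + m)"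
proof -
  let ?n = "length w"
  have l: "length (slice w t (t + m)) = m" "length (slice w (?n - (t + m)) (?n - t)) = m"
    using assms by (simp_all add: length_slice)
  have "slice w t (t + m) ! j = w ! (t + j) \<and>
        inv_word (slice w (?n - (t + m)) (?n - t)) ! j = inv_symbol (w ! (?n - 1 - (t + j)))" if "j < m" for j
  proof -
    have "inv_word (slice w (?n - (t + m)) (?n - t)) ! j = inv_symbol (slice w (?n - (t + m)) (?n - t) ! (m - Suc j))"
      using that l(2) by (simp add: nth_inv_word)
    also have "slice w (?n - (t + m)) (?n - t) ! (m - Suc j) = w ! (?n - (t + m) + (m - Suc j))"
      using that assms by (intro nth_slice) auto
    also have "?n - (t + m) + (m - Suc j) = ?n - 1 - (t + j)" using that assms by simp
    finally show ?thesis using that assms by (simp add: nth_slice)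
  qed
  hence "slice w t (t + m) = inv_word (slice w (?n - (t + m)) (?n - t)) \<longleftrightarrow> (\<forall>j<m. matched w (t + j))"
    using l by (auto simp: list_eq_iff_nth_eq matched_def)
  moreover have "?n - t = ?n - 1 - (t - 1)" using assms by simp
  ultimately show ?thesis by (simp add: lip_at_def Let_def matched_def)
qed

definition first_lip :: "nat \<Rightarrow> nat \<Rightarrow> nat \<Rightarrow> word \<Rightarrow> nat \<Rightarrow> nat \<Rightarrow> bool" where
  "first_lip m st sc w a b \<longleftrightarrow> a + st \<le> b \<and> b + m \<le> a + st + sc \<and> lip_at m w b \<and> (\<forall>t\<in>{a + st..<b}. \<not> lip_at m w t)"

lemma next_cut_iff:
  "next_cut C \<delta> w a b \<longleftrightarrow>
     first_lip (lip_length C (length w)) (stem_length \<delta> (length w)) (scan_length \<delta> (length w)) w a b"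
  by (simp add: next_cut_def first_lip_def Let_def)

lemma first_lip_unique: "first_lip m st sc w a b \<Longrightarrow> first_lip m st sc w a b' \<Longrightarrow> b = b'"
  unfolding first_lip_def by (metis atLeastLessThan_iff linorder_neqE_nat)

definition agree_at :: "'a list \<Rightarrow> 'a list \<Rightarrow> nat \<Rightarrow> bool" where
  "agree_at w w' x \<longleftrightarrow> w ! x = w' ! x \<and> w ! (length w - 1 - x) = w' ! (length w - 1 - x)"

lemma lip_at_cong:
  assumes "length w = length w'" "t \<ge> 1" "t + m < length w" "\<And>x. t - 1 \<le> x \<Longrightarrow> x \<le> t + m \<Longrightarrow> agree_at w w' x"
  shows "lip_at m w t \<longleftrightarrow> lip_at m w' t"
proof -
  have "matched w x \<longleftrightarrow> matched w' x" if "t - 1 \<le> x" "x \<le> t + m" for x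
    using assms(4)[OF that] assms(1) by (simp add: matched_def agree_at_def)
  thus ?thesis using assms(1-3) by (simp add: lip_at_iff)
qed

text \<open>To check maximality, the scan looks at one letter beyond a lip on either side, hence the
  margins in the range of agreement.\<close>

lemma first_lip_cong:
  assumes "length w = length w'" "st \<ge> 1" "b + m < length w"
    "\<And>x. a + st - 1 \<le> x \<Longrightarrow> x \<le> b + m \<Longrightarrow> agree_at w w' x"
    and fl: "first_lip m st sc w a b"
  shows "first_lip m st sc w' a b"
proof -
  have "lip_at m w t \<longleftrightarrow> lip_at m w' t" if "a + st \<le> t" "t \<le> b" for t
    using that assms by (intro lip_at_cong) auto
  moreover have "a + st \<le> b" using fl by (simp add: first_lip_def)
  ultimately show ?thesis using fl by (auto simp: first_lip_def)
qed

definition cut_chain :: "nat \<Rightarrow> nat \<Rightarrow> nat \<Rightarrow> word \<Rightarrow> nat list \<Rightarrow> bool" where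
  "cut_chain m st sc w cuts \<longleftrightarrow> (\<forall>i<length cuts. first_lip m st sc w ((0 # cuts) ! i) (cuts ! i))"

lemma successively_next_cut:
  "successively (next_cut C \<delta> w) (0 # cuts) \<longleftrightarrow>
   cut_chain (lip_length C (length w)) (stem_length \<delta> (length w)) (scan_length \<delta> (length w)) w cuts"
  by (simp add: successively_conv_nth cut_chain_def next_cut_iff)

lemma cut_chain_0: "cut_chain m st sc w cuts \<Longrightarrow> cuts \<noteq> [] \<Longrightarrow> first_lip m st sc w 0 (cuts ! 0)"
  by (auto simp: cut_chain_def)

lemma cut_chain_Suc: "cut_chain m st sc w cuts \<Longrightarrow> Suc i < length cuts \<Longrightarrow> first_lip m st sc w (cuts ! i) (cuts ! Suc i)"
  by (auto simp: cut_chain_def)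

lemma cut_chain_first:
  assumes "cut_chain m st sc w cuts" "cuts \<noteq> []"
  shows "st \<le> cuts ! 0" "cuts ! 0 + m \<le> st + sc"
  using cut_chain_0[OF assms] by (auto simp: first_lip_def)

lemma cut_chain_gap:
  assumes "cut_chain m st sc w cuts" "Suc i < length cuts"
  shows "cuts ! i + st \<le> cuts ! Suc i" "cuts ! Suc i + m \<le> cuts ! i + st + sc"
  using cut_chain_Suc[OF assms] by (auto simp: first_lip_def)

lemma cut_chain_mono:
  assumes "cut_chain m st sc w cuts" "i \<le> j" "j < length cuts"
  shows "cuts ! i + (j - i) * st \<le> cuts ! j"
  using assms(2,3)
proof (induction j rule: dec_induct)
  case (step j)
  thus ?case using cut_chain_gap(1)[OF assms(1), of j] by (simp add: Suc_diff_le)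
qed simp

lemma cut_chain_mono':
  assumes "cut_chain m st sc w cuts" "i \<le> j" "j < length cuts"
  shows "cuts ! i \<le> cuts ! j"
  using cut_chain_mono[OF assms] by linarith

lemma cut_chain_upper:
  assumes "cut_chain m st sc w cuts" "i \<le> j" "j < length cuts"
  shows "cuts ! j \<le> cuts ! i + (j - i) * (st + sc)"
  using assms(2,3)
proof (induction j rule: dec_induct)
  case (step j)
  thus ?case using cut_chain_gap(2)[OF assms(1), of j] by (simp add: Suc_diff_le)
qed simp

lemma cut_chain_lip: "cut_chain m st sc w cuts \<Longrightarrow> i < length cuts \<Longrightarrow> lip_at m w (cuts ! i)"
  by (auto simp: cut_chain_def first_lip_def)

lemma cut_chain_take: "cut_chain m st sc w cuts \<Longrightarrow> cut_chain m st sc w (take j cuts)"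
  unfolding cut_chain_def by (auto simp: nth_Cons')

lemma cut_chain_ge:
  assumes "cut_chain m st sc w cuts" "i < length cuts" shows "cuts ! i \<ge> st"
  using cut_chain_mono'[OF assms(1), of 0 i] cut_chain_first(1)[OF assms(1)] assms(2) by (cases cuts) auto

lemma cut_chain_length_le:
  assumes "cut_chain m st sc w cuts" "st \<ge> 1" "cuts \<noteq> []" shows "length cuts \<le> last cuts"
proof -
  have "cuts ! 0 + (length cuts - 1) * st \<le> cuts ! (length cuts - 1)"
    using assms(3) cut_chain_mono[OF assms(1), of 0 "length cuts - 1"] by simp
  moreover have "length cuts - 1 \<le> (length cuts - 1) * st" using assms(2) by (cases st) auto
  moreover have "last cuts = cuts ! (length cuts - 1)" "length cuts > 0" using assms(3) by (auto simp: last_conv_nth)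
  moreover note cut_chain_first(1)[OF assms(1,3)] assms(2)
  ultimately show ?thesis by linarith
qed

text \<open>What the counting keeps of a bead decomposition. The room after the last cut makes all
  lips disjoint from their mirror images. A nonempty prefix of a valid list is valid again, so the
  number of cuts becomes a parameter of the counts.\<close>

definition valid_cuts :: "nat \<Rightarrow> nat \<Rightarrow> nat \<Rightarrow> word \<Rightarrow> nat list \<Rightarrow> bool" where
  "valid_cuts m st sc w cuts \<longleftrightarrow> cuts \<noteq> [] \<and> cut_chain m st sc w cuts \<and> 2 * (last cuts + m + 1) \<le> length w"

lemma valid_cuts_bound:
  assumes "valid_cuts m st sc w cuts" "i < length cuts"
  shows "2 * (cuts ! i + m + 1) \<le> length w"
proof -
  have c: "cut_chain m st sc w cuts" "cuts \<noteq> []" using assms(1) by (auto simp: valid_cuts_def)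
  have "cuts ! i \<le> last cuts" using cut_chain_mono'[OF c(1), of i "length cuts - 1"] assms(2) c(2)
    by (auto simp: last_conv_nth)
  thus ?thesis using assms by (simp add: valid_cuts_def)
qed

text \<open>The scan runs outwards from the midpoint and looks at most one letter beyond the lip
  that it finds; so each cut is decided by letters up to this distance, and the cuts agree one after
  the other.\<close>

lemma cut_chain_prefix_unique:
  assumes w: "length w = length w'" and st: "st \<ge> 1"
    and c: "cut_chain m st sc w cuts" "cut_chain m st sc w' cuts'"
    and l: "j < length cuts" "j < length cuts'"
    and ag: "\<And>x. x \<le> cuts ! j + m \<Longrightarrow> agree_at w w' x" and b: "cuts ! j + m < length w"
  shows "cuts ! j = cuts' ! j"
  using l ag b
proof (induction j)
  case 0
  have "first_lip m st sc w' 0 (cuts ! 0)"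
    using 0 cut_chain_0[OF c(1)] by (intro first_lip_cong[OF w st]) auto
  moreover have "first_lip m st sc w' 0 (cuts' ! 0)" using cut_chain_0[OF c(2)] 0 by auto
  ultimately show ?case by (rule first_lip_unique)
next
  case (Suc j)
  have le: "cuts ! j \<le> cuts ! Suc j" using cut_chain_mono'[OF c(1), of j "Suc j"] Suc.prems by simp
  have IH: "cuts ! j = cuts' ! j" using Suc.prems le by (intro Suc.IH) auto
  have "first_lip m st sc w' (cuts ! j) (cuts ! Suc j)"
    using Suc.prems cut_chain_Suc[OF c(1)] by (intro first_lip_cong[OF w st]) auto
  moreover have "first_lip m st sc w' (cuts ! j) (cuts' ! Suc j)" using cut_chain_Suc[OF c(2)] Suc.prems IH by auto
  ultimately show ?case by (rule first_lip_unique)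
qed

lemma valid_cuts_unique:
  assumes "valid_cuts m st sc w cuts" "valid_cuts m st sc w cuts'" "length cuts = length cuts'" "st \<ge> 1"
  shows "cuts = cuts'"
proof (rule nth_equalityI[OF assms(3)])
  fix j assume j: "j < length cuts"
  show "cuts ! j = cuts' ! j"
    using assms j valid_cuts_bound[OF assms(1) j]
    by (intro cut_chain_prefix_unique[where w = w and w' = w and m = m and st = st and sc = sc]) (auto simp: valid_cuts_def agree_at_def)
qed

text \<open>The letters of the bead between the cuts \<open>a\<close> and \<open>b\<close>, except for its lips and a margin of one letter.\<close>

definition core :: "nat \<Rightarrow> nat \<Rightarrow> nat \<Rightarrow> nat \<Rightarrow> nat set" where
  "core n m a b = {a + m + 1..<b - 1} \<union> {n - b + 1..<n - a - m - 1}"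

abbreviation pieces :: "(segment \<Rightarrow> 'h fatgraph) \<Rightarrow> word \<Rightarrow> nat list \<Rightarrow> nat \<Rightarrow> 'h fatgraph" where
  "pieces \<Phi> w cuts \<equiv> \<lambda>i. \<Phi> (segment_of w cuts i)"

abbreviation beads :: "nat \<Rightarrow> word \<Rightarrow> nat list \<Rightarrow> nat \<Rightarrow> word" where
  "beads m w cuts \<equiv> \<lambda>i. bead m (segment_of w cuts i)"

text \<open>The last bead has no lip leading on; the empty word as default makes this value
  independent of \<open>w\<close>, so that two words that agree on all lips have the same
  \<open>lip_fun\<close>.\<close>

definition lip_fun :: "nat \<Rightarrow> word \<Rightarrow> nat list \<Rightarrow> nat \<Rightarrow> bool \<Rightarrow> word" where
  "lip_fun m w cuts i b = (if b \<and> i \<ge> length cuts then [] else lip_word m w cuts i (Tag b))"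

lemma list_eq_slice:
  assumes "length w = length w'" "b \<le> length w" "\<And>y. a \<le> y \<Longrightarrow> y < b \<Longrightarrow> w ! y = w' ! y"
  shows "slice w a b = slice w' a b"
  using assms by (intro nth_equalityI) (auto simp: length_slice nth_slice)

lemma drop_slice: "drop a w = slice w a (length w)" and take_slice: "take b w = slice w 0 b"
  by (simp_all add: slice_def)

text \<open>The cuts before the bead are found from letters before its core, and the later ones by
  scanning on from its far cut, so a change in the core disturbs neither. The far cut itself has to
  be prescribed, since such a change may create an earlier lip.\<close>

lemma outside_core:
  assumes w: "length w = length w'" and st: "st \<ge> 1"
    and v: "valid_cuts m st sc w cuts" "valid_cuts m st sc w' cuts'" "length cuts = length cuts'"
    and i: "1 \<le> i" "i < length cuts" "cuts ! (i - 1) = cuts' ! (i - 1)" "cuts ! i = cuts' ! i"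
    and ag: "\<And>y. y < length w \<Longrightarrow> y \<notin> core (length w) m (cuts ! (i - 1)) (cuts ! i) \<Longrightarrow> w ! y = w' ! y"
  shows outside_core_cuts: "cuts = cuts'"
    and outside_core_segment: "j \<noteq> i \<Longrightarrow> segment_of w cuts j = segment_of w' cuts j"
    and outside_core_lip: "lip_fun m w cuts j b = lip_fun m w' cuts j b \<or> j > length cuts"
proof -
  let ?n = "length w" and ?a = "cuts ! (i - 1)" and ?b = "cuts ! i"
  have c: "cut_chain m st sc w cuts" "cut_chain m st sc w' cuts'" using v by (auto simp: valid_cuts_def)
  have bnd: "2 * (cuts ! j + m + 1) \<le> ?n" if "j < length cuts" for j by (rule valid_cuts_bound[OF v(1) that])
  have ab: "?a + st \<le> ?b" using cut_chain_gap(1)[OF c(1), of "i - 1"] i by simp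
  note bb = bnd[OF i(2)]
  have low: "w ! y = w' ! y" if "y \<le> ?a + m" for y
    using that ab bb st by (intro ag) (auto simp: core_def)
  have low': "w ! y = w' ! y" if "y < ?n" "y \<ge> ?n - ?a - m - 1" for y
    using that ab bb st by (intro ag) (auto simp: core_def)
  have mid: "w ! y = w' ! y" if "?b \<le> y + 1" "y \<le> ?n - ?b" for y
    using that ab bb st by (intro ag) (auto simp: core_def)
  have lowp: "agree_at w w' x" if "x \<le> ?a + m" for x
    using that low[of x] low'[of "?n - 1 - x"] bb ab by (simp add: agree_at_def)
  have midp: "agree_at w w' x" if "?b \<le> x + 1" "2 * x < ?n" for x
  proof -
    have "w ! x = w' ! x" using that bb by (intro mid) auto
    moreover have "w ! (?n - 1 - x) = w' ! (?n - 1 - x)" using that bb by (intro mid) auto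
    ultimately show ?thesis by (simp add: agree_at_def)
  qed
  have eq1: "cuts ! j = cuts' ! j" if "j < i" for j
  proof (rule cut_chain_prefix_unique[OF w st c])
    have "cuts ! j \<le> ?a" using that i by (intro cut_chain_mono'[OF c(1)]) auto
    thus "agree_at w w' x" if "x \<le> cuts ! j + m" for x using that by (intro lowp) simp
    show "cuts ! j + m < ?n" using bnd[of j] that i by simp
  qed (use that i v(3) in auto)
  have eq2: "j < length cuts \<Longrightarrow> cuts ! j = cuts' ! j" if "i \<le> j" for j
    using that
  proof (induction j rule: dec_induct)
    case base show ?case using i by simp
  next
    case (step j)
    have bj: "?b \<le> cuts ! j" using step by (intro cut_chain_mono'[OF c(1)]) auto
    have "first_lip m st sc w' (cuts ! j) (cuts ! Suc j)"
    proof (rule first_lip_cong[OF w st])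
      show "cuts ! Suc j + m < length w" using bnd[OF step.prems] by simp
      show "agree_at w w' x" if "cuts ! j + st - 1 \<le> x" "x \<le> cuts ! Suc j + m" for x
        using that bnd[OF step.prems] bj st by (intro midp) auto
      show "first_lip m st sc w (cuts ! j) (cuts ! Suc j)" by (rule cut_chain_Suc[OF c(1) step.prems])
    qed
    moreover have "first_lip m st sc w' (cuts ! j) (cuts' ! Suc j)"
      using cut_chain_Suc[OF c(2), of j] step v(3) by simp
    ultimately show ?case by (rule first_lip_unique)
  qed
  show "cuts = cuts'"
    using eq1 eq2 v(3) by (intro nth_equalityI) (auto simp: not_less[symmetric] dest: leI)
  show "segment_of w cuts j = segment_of w' cuts j" if "j \<noteq> i"
  proof -
    consider "j = 0" | "0 < j" "j < i" | "i < j" "j < length cuts" | "j \<ge> length cuts" using \<open>j \<noteq> i\<close> by linarith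
    thus ?thesis
    proof cases
      case 1
      have "cuts ! 0 \<le> ?a" using i by (intro cut_chain_mono'[OF c(1)]) auto
      hence "slice w (?n - cuts ! 0) ?n = slice w' (?n - cuts ! 0) ?n"
        using w bb ab by (intro list_eq_slice low') auto
      moreover have "slice w 0 (cuts ! 0) = slice w' 0 (cuts ! 0)"
        using \<open>cuts ! 0 \<le> ?a\<close> w bb ab by (intro list_eq_slice low) auto
      ultimately show ?thesis using 1 w by (simp add: segment_of_def Let_def drop_slice take_slice)
    next
      case 2
      have le: "cuts ! j \<le> ?a" using i(1,2) 2 by (intro cut_chain_mono'[OF c(1)]) auto
      have "cuts ! (j - 1) \<le> cuts ! j" using i(1,2) 2 by (intro cut_chain_mono'[OF c(1)]) auto
      note le = le this
      have "slice w (cuts ! (j - 1)) (cuts ! j) = slice w' (cuts ! (j - 1)) (cuts ! j)"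
        using le w bb ab by (intro list_eq_slice low) auto
      moreover have "slice w (?n - cuts ! j) (?n - cuts ! (j - 1)) = slice w' (?n - cuts ! j) (?n - cuts ! (j - 1))"
        using le w bb ab by (intro list_eq_slice low') auto
      ultimately show ?thesis using 2 w i by (simp add: segment_of_def Let_def)
    next
      case 3
      have "?b \<le> cuts ! (j - 1)" "cuts ! (j - 1) \<le> cuts ! j" using i(1,2) 3 by (auto intro!: cut_chain_mono'[OF c(1)])
      hence "slice w (cuts ! (j - 1)) (cuts ! j) = slice w' (cuts ! (j - 1)) (cuts ! j)"
        "slice w (?n - cuts ! j) (?n - cuts ! (j - 1)) = slice w' (?n - cuts ! j) (?n - cuts ! (j - 1))"
        using w bnd[OF 3(2)] by (auto intro!: list_eq_slice mid)
      thus ?thesis using 3 w i by (simp add: segment_of_def Let_def)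
    next
      case 4
      have "?b \<le> cuts ! (length cuts - 1)" using i by (intro cut_chain_mono'[OF c(1)]) auto
      hence "slice w (cuts ! (length cuts - 1)) (?n - cuts ! (length cuts - 1)) = slice w' (cuts ! (length cuts - 1)) (?n - cuts ! (length cuts - 1))"
        using w bb by (auto intro!: list_eq_slice mid)
      thus ?thesis using 4 w i by (simp add: segment_of_def Let_def)
    qed
  qed
  have sl: "slice w (cuts ! j) (cuts ! j + m) = slice w' (cuts ! j) (cuts ! j + m)" if "j < length cuts" for j
  proof (cases "j < i")
    case True
    hence "cuts ! j \<le> ?a" using i by (intro cut_chain_mono'[OF c(1)]) auto
    thus ?thesis using w bnd[OF that] by (intro list_eq_slice low) auto
  next
    case False
    hence "?b \<le> cuts ! j" using that by (intro cut_chain_mono'[OF c(1)]) auto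
    thus ?thesis using w bnd[OF that] by (intro list_eq_slice mid) auto
  qed
  show "lip_fun m w cuts j b = lip_fun m w' cuts j b \<or> j > length cuts"
  proof (cases "j \<le> length cuts")
    case True
    have "j - 1 < length cuts" using True i by linarith
    thus ?thesis using sl[of j] sl[of "j - 1"] by (cases b) (auto simp: lip_fun_def lip_word_def)
  qed simp
qed

section \<open>The shape of the beads\<close>

context
  fixes m st sc :: nat and w :: word and cuts :: "nat list" and k :: nat
  assumes v: "valid_cuts m st sc w cuts" and st: "m < st" and w: "set w \<subseteq> letters k"
begin

lemma cuts_facts:
  shows "cut_chain m st sc w cuts" "cuts \<noteq> []" "j < length cuts \<Longrightarrow> 2 * (cuts ! j + m + 1) \<le> length w"
    "j < length cuts \<Longrightarrow> st \<le> cuts ! j"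
  using v valid_cuts_bound[OF v] cut_chain_ge by (auto simp: valid_cuts_def)

lemma segment_of_First: "segment_of w cuts 0 = First (drop (length w - cuts ! 0) w @ take (cuts ! 0) w)"
  by (simp add: segment_of_def Let_def)

lemma segment_of_Last: "segment_of w cuts (length cuts) =
    Last (slice w (cuts ! (length cuts - 1)) (length w - cuts ! (length cuts - 1)))"
  using cuts_facts(2) by (simp add: segment_of_def Let_def)

lemma segment_of_Middle: "0 < i \<Longrightarrow> i < length cuts \<Longrightarrow> segment_of w cuts i =
    Middle (slice w (cuts ! (i - 1)) (cuts ! i)) (slice w (length w - cuts ! i) (length w - cuts ! (i - 1)))"
  by (simp add: segment_of_def Let_def)

lemma middle_bead:
  assumes "0 < i" "i < length cuts"
  defines "a \<equiv> cuts ! (i - 1)" and "b \<equiv> cuts ! i"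
  defines "g \<equiv> b - a - m"
  shows "beads m w cuts i = [Tag False] @ slice w (a + m) b @ [Tag True] @ slice w (length w - b) (length w - a - m)"
    and "g > 0" "a + m < b" "length (slice w (a + m) b) = g" "length (slice w (length w - b) (length w - a - m)) = g"
proof -
  have ab: "a + st \<le> b" using cut_chain_gap(1)[OF cuts_facts(1), of "i - 1"] assms(1,2) by (simp add: a_def b_def)
  have bn: "2 * (b + m + 1) \<le> length w" using cuts_facts(3)[OF assms(2)] by (simp add: b_def)
  show "g > 0" "a + m < b" "length (slice w (a + m) b) = g" "length (slice w (length w - b) (length w - a - m)) = g"
    using ab bn st by (auto simp: g_def length_slice)
  have l: "length (slice w (length w - b) (length w - a)) = b - a" using ab bn by (simp add: length_slice)
  have "drop m (slice w a b) = slice w (a + m) b" by (simp add: slice_def drop_take add.commute)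
  moreover have "take (b - a - m) (slice w (length w - b) (length w - a)) = slice w (length w - b) (length w - a - m)"
    using ab bn st by (simp add: slice_def min_def)
  ultimately show "beads m w cuts i = [Tag False] @ slice w (a + m) b @ [Tag True] @ slice w (length w - b) (length w - a - m)"
    unfolding segment_of_Middle[OF assms(1,2)] a_def[symmetric] b_def[symmetric] by (simp add: l)
qed

lemma set_slice: "set (slice u a b) \<subseteq> set u"
  unfolding slice_def using set_take_subset set_drop_subset by (meson order.trans)

lemma tagless: "set u \<subseteq> set w \<Longrightarrow> s \<in> set u \<Longrightarrow> s \<noteq> Tag b"
  using w letters_not_Tag by blast

lemma bead_shape:
  assumes "i \<le> length cuts"
  shows "(\<exists>u. beads m w cuts i = u @ [Tag True] \<and> u \<noteq> [] \<and> set u \<subseteq> set w) \<or>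
    (\<exists>u. beads m w cuts i = [Tag False] @ u \<and> u \<noteq> [] \<and> set u \<subseteq> set w) \<or>
    (\<exists>u v. beads m w cuts i = [Tag False] @ u @ [Tag True] @ v \<and> u \<noteq> [] \<and> v \<noteq> [] \<and> set u \<subseteq> set w \<and> set v \<subseteq> set w)"
    and "length (beads m w cuts i) \<le> length w + 2"
proof -
  consider "i = 0" | "0 < i" "i < length cuts" | "i = length cuts" "i > 0" using assms by linarith
  hence "((\<exists>u. beads m w cuts i = u @ [Tag True] \<and> u \<noteq> [] \<and> set u \<subseteq> set w) \<or>
    (\<exists>u. beads m w cuts i = [Tag False] @ u \<and> u \<noteq> [] \<and> set u \<subseteq> set w) \<or>
    (\<exists>u v. beads m w cuts i = [Tag False] @ u @ [Tag True] @ v \<and> u \<noteq> [] \<and> v \<noteq> [] \<and> set u \<subseteq> set w \<and> set v \<subseteq> set w)) \<and>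
    length (beads m w cuts i) \<le> length w + 2"
  proof cases
    case 1
    let ?u = "drop (length w - cuts ! 0) w @ take (cuts ! 0) w"
    have c0: "st \<le> cuts ! 0" "2 * (cuts ! 0 + m + 1) \<le> length w" using cuts_facts(2) cuts_facts(3,4)[of 0] by auto
    have "length ?u = 2 * cuts ! 0" using c0 by simp
    hence "0 < length ?u" using c0 st by simp
    hence "?u \<noteq> []" by (rule length_greater_0_conv[THEN iffD1])
    moreover have "set ?u \<subseteq> set w" using set_take_subset[of "cuts ! 0" w] set_drop_subset[of _ w] by auto
    ultimately show ?thesis using 1 c0 segment_of_First by auto
  next
    case 2
    note mb = middle_bead[OF 2]
    have bn: "2 * (cuts ! i + m + 1) \<le> length w" using cuts_facts(3)[OF 2(2)] .
    show ?thesis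
    proof (intro conjI disjI2 exI)
      show "beads m w cuts i = [Tag False] @ slice w (cuts ! (i - 1) + m) (cuts ! i) @ [Tag True] @ slice w (length w - cuts ! i) (length w - cuts ! (i - 1) - m)" by (rule mb(1))
      show "length (beads m w cuts i) \<le> length w + 2"
      proof -
        have "x + x \<le> length w" if "x \<le> cuts ! i" for x :: nat
        proof -
          have "x + x \<le> 2 * (cuts ! i + m + 1)" using that by simp
          thus ?thesis using bn by (rule order.trans)
        qed
        thus ?thesis unfolding mb(1) using mb(4,5) by simp
      qed
      show "slice w (cuts ! (i - 1) + m) (cuts ! i) \<noteq> []"
        "slice w (length w - cuts ! i) (length w - cuts ! (i - 1) - m) \<noteq> []"
        using mb(2,4,5) by (metis length_0_conv less_numeral_extra(3))+
    qed (rule set_slice)+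
  next
    case 3
    define c where "c = cuts ! (length cuts - 1)"
    have c: "2 * (c + m + 1) \<le> length w" using cuts_facts(3)[of "length cuts - 1"] 3 by (simp add: c_def)
    let ?s = "slice w c (length w - c)"
    let ?u = "drop m (take (length ?s - m) ?s)"
    have ls: "length ?s = length w - 2 * c" using c by (simp add: length_slice)
    have "length ?u = length w - 2 * c - 2 * m" using ls by simp
    hence "?u \<noteq> []" "length ?u \<le> length w" using c by auto
    moreover have "set ?u \<subseteq> set w" using set_slice[of w] set_take_subset[of _ ?s] set_drop_subset[of m "take (length ?s - m) ?s"] by blast
    moreover have "beads m w cuts i = [Tag False] @ ?u" using 3 segment_of_Last by (simp add: c_def)
    ultimately show ?thesis by auto
  qed
  thus "(\<exists>u. beads m w cuts i = u @ [Tag True] \<and> u \<noteq> [] \<and> set u \<subseteq> set w) \<or>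
    (\<exists>u. beads m w cuts i = [Tag False] @ u \<and> u \<noteq> [] \<and> set u \<subseteq> set w) \<or>
    (\<exists>u v. beads m w cuts i = [Tag False] @ u @ [Tag True] @ v \<and> u \<noteq> [] \<and> v \<noteq> [] \<and> set u \<subseteq> set w \<and> set v \<subseteq> set w)"
    "length (beads m w cuts i) \<le> length w + 2" by blast+
qed

lemma filter_tagless: "set u \<subseteq> set w \<Longrightarrow> filter (\<lambda>s. s = Tag b) u = []"
  using tagless by (auto simp: filter_empty_conv)

lemma bead_tag_count:
  assumes "i \<le> length cuts"
  shows "length (filter (\<lambda>s. s = Tag b) (beads m w cuts i)) \<le> 1"
  using bead_shape(1)[OF assms] by (elim disjE exE conjE) (auto simp: filter_tagless)

text \<open>Going around the bead, any two tags are separated by nonempty stretches of generators,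
  and a single tag is followed by a generator.\<close>

lemma bead_no_adjacent_tags:
  assumes "i \<le> length cuts"
  shows "no_adjacent_tags (beads m w cuts i) \<and> beads m w cuts i \<noteq> []"
proof -
  let ?B = "beads m w cuts i"
  have tl: "u ! j \<noteq> Tag b" if "set u \<subseteq> set w" "j < length u" for u j b
    using tagless[OF that(1) nth_mem[OF that(2)]] .
  have *: "no_adjacent_tags ?B" if "?B \<noteq> []" "\<And>j b b'. j < length ?B \<Longrightarrow> ?B ! j = Tag b \<Longrightarrow> ?B ! (Suc j mod length ?B) \<noteq> Tag b'"
    unfolding no_adjacent_tags_def
  proof (intro allI notI)
    fix j assume "(\<exists>b. cnth ?B j = Tag b) \<and> (\<exists>b. cnth ?B (Suc j) = Tag b)"
    then obtain b b' where "?B ! (j mod length ?B) = Tag b" "?B ! (Suc (j mod length ?B) mod length ?B) = Tag b'"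
      by (auto simp: cnth_def mod_Suc_eq)
    thus False using that(2)[of "j mod length ?B"] that(1) by auto
  qed
  consider u where "?B = u @ [Tag True]" "u \<noteq> []" "set u \<subseteq> set w"
    | u where "?B = [Tag False] @ u" "u \<noteq> []" "set u \<subseteq> set w"
    | u v where "?B = [Tag False] @ u @ [Tag True] @ v" "u \<noteq> []" "v \<noteq> []" "set u \<subseteq> set w" "set v \<subseteq> set w"
    using bead_shape(1)[OF assms] by blast
  thus ?thesis
  proof cases
    case 1
    have "?B ! (Suc j mod length ?B) \<noteq> Tag b'" if "j < length ?B" "?B ! j = Tag b" for j b b'
    proof -
      have "j = length u" using that tl[OF 1(3)] 1(1) by (cases "j < length u") (auto simp: nth_append)
      hence "Suc j mod length ?B = 0" using 1(1) by simp
      thus ?thesis using 1(1,2) tl[OF 1(3), of 0] by (simp add: nth_append)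
    qed
    thus ?thesis using * 1 by simp
  next
    case 2
    have "?B ! (Suc j mod length ?B) \<noteq> Tag b'" if "j < length ?B" "?B ! j = Tag b" for j b b'
    proof -
      have "j = 0" using that tl[OF 2(3)] 2(1) by (cases j) auto
      thus ?thesis using 2(1,2) tl[OF 2(3), of 0] by (simp add: nth_append)
    qed
    thus ?thesis using * 2 by simp
  next
    case 3
    have "?B ! (Suc j mod length ?B) \<noteq> Tag b'" if j: "j < length ?B" "?B ! j = Tag b" for j b b'
    proof -
      have "j = 0 \<or> j = Suc (length u)"
      proof (rule ccontr)
        assume "\<not> ?thesis"
        hence "j \<noteq> 0" "j - 1 \<noteq> length u" "j < length u + length v + 2" using j(1) 3(1) by auto
        hence "(j = Suc (j - 1) \<and> j - 1 < length u) \<or>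
            (j = Suc (Suc (length u + (j - length u - 2))) \<and> j - length u - 2 < length v)" by linarith
        then consider j' where "j = Suc j'" "j' < length u" | j' where "j = Suc (Suc (length u + j'))" "j' < length v"
          by blast
        thus False
          by cases (use j(2) 3(1) tl[OF 3(4)] tl[OF 3(5)] in \<open>auto simp: nth_append\<close>)
      qed
      thus ?thesis
      proof
        assume "j = 0"
        thus ?thesis using 3 tl[OF 3(4), of 0] by (simp add: nth_append)
      next
        assume "j = Suc (length u)"
        thus ?thesis using 3 tl[OF 3(5), of 0] by (simp add: nth_append)
      qed
    qed
    thus ?thesis using * 3 by simp
  qed
qed

end

section \<open>Counting words with stray paths and repetitions\<close>

lemma card_le_fiber:
  assumes "finite T" "f ` A \<subseteq> T" "\<And>y. y \<in> f ` A \<Longrightarrow> finite {x \<in> A. f x = y} \<and> real (card {x \<in> A. f x = y}) \<le> c" "c \<ge> 0"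
  shows "finite A" "real (card A) \<le> c * real (card T)"
proof -
  have fin: "finite (f ` A)" using assms(1,2) finite_subset by blast
  have A: "A = (\<Union>y\<in>f ` A. {x \<in> A. f x = y})" by auto
  show "finite A" by (subst A) (use fin assms(3) in blast)
  have "card A \<le> (\<Sum>y\<in>f ` A. card {x \<in> A. f x = y})"
    by (rule ord_eq_le_trans[OF arg_cong[OF A, of card] card_UN_le[OF fin]])
  hence "real (card A) \<le> real (\<Sum>y\<in>f ` A. card {x \<in> A. f x = y})" by (simp only: of_nat_le_iff)
  also have "\<dots> = (\<Sum>y\<in>f ` A. real (card {x \<in> A. f x = y}))" by simp
  also have "\<dots> \<le> (\<Sum>y\<in>f ` A. c)" using assms(3) by (intro sum_mono) blast
  also have "\<dots> = c * real (card (f ` A))" by simp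
  also have "\<dots> \<le> c * real (card T)"
    using card_mono[OF assms(1,2)] assms(4) by (intro mult_left_mono) auto
  finally show "real (card A) \<le> c * real (card T)" .
qed

lemma card_UN_real_le:
  assumes "finite I" "A \<subseteq> (\<Union>i\<in>I. S i)" "\<And>i. i \<in> I \<Longrightarrow> finite (S i) \<and> real (card (S i)) \<le> c"
  shows "real (card A) \<le> real (card I) * c"
proof -
  have fin: "finite (\<Union>i\<in>I. S i)" using assms by blast
  have "real (card A) \<le> real (card (\<Union>i\<in>I. S i))" using card_mono[OF fin assms(2)] by simp
  also have "\<dots> \<le> real (\<Sum>i\<in>I. card (S i))" using card_UN_le[OF assms(1), of S] by (simp only: of_nat_le_iff)
  also have "\<dots> = (\<Sum>i\<in>I. real (card (S i)))" by simp
  also have "\<dots> \<le> (\<Sum>i\<in>I. c)" using assms(3) by (intro sum_mono) blast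
  finally show ?thesis by simp
qed

text \<open>The letters outside the window, read cyclically from its end, form a reduced word of
  length n - l; once they are fixed, at most c fillings of the window remain.\<close>

lemma card_window_le:
  assumes A: "A \<subseteq> cyc_reduced_words k n" and x: "x + l \<le> n" and k: "k \<ge> 1" and c: "c \<ge> 0"
    and \<Lambda>: "\<And>w0. w0 \<in> A \<Longrightarrow> \<exists>\<Lambda>. finite \<Lambda> \<and> real (card \<Lambda>) \<le> c \<and>
      (\<forall>w\<in>A. (\<forall>y<n. y \<notin> {x..<x + l} \<longrightarrow> w ! y = w0 ! y) \<longrightarrow> slice w x (x + l) \<in> \<Lambda>)"
  shows "real (card A) \<le> c * (2 * (2 * real k - 1) ^ (n - l))"
proof -
  define f where "f = (\<lambda>w :: word. take (n - l) (rotate (x + l) w))"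
  have len: "length w = n" if "w \<in> A" for w using that A crw_length by blast
  have outside: "w ! y = w0 ! y" if "w \<in> A" "w0 \<in> A" "f w = f w0" "y < n" "y \<notin> {x..<x + l}" for w w0 y
  proof (cases "y < x")
    case True
    have "f w ! (n - (x + l) + y) = f w0 ! (n - (x + l) + y)" using that(3) by simp
    hence "rotate (x + l) w ! (n - (x + l) + y) = rotate (x + l) w0 ! (n - (x + l) + y)"
      using True x unfolding f_def by (subst (asm) (1 2) nth_take) auto
    thus ?thesis using True x len that(1,2) by (simp add: nth_rotate)
  next
    case False
    hence y: "y \<ge> x + l" using that(5) by auto
    have "f w ! (y - (x + l)) = f w0 ! (y - (x + l))" using that(3) by simp
    hence "rotate (x + l) w ! (y - (x + l)) = rotate (x + l) w0 ! (y - (x + l))"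
      using y that(4) x unfolding f_def by (subst (asm) (1 2) nth_take) auto
    thus ?thesis using y len that(1,2,4) by (simp add: nth_rotate)
  qed
  have fiber: "finite {w \<in> A. f w = y} \<and> real (card {w \<in> A. f w = y}) \<le> c" if "y \<in> f ` A" for y
  proof -
    obtain w0 where w0: "w0 \<in> A" "y = f w0" using \<open>y \<in> f ` A\<close> by blast
    obtain \<Lambda> where \<Lambda>': "finite \<Lambda>" "real (card \<Lambda>) \<le> c"
      "\<And>w. w \<in> A \<Longrightarrow> (\<forall>y<n. y \<notin> {x..<x + l} \<longrightarrow> w ! y = w0 ! y) \<Longrightarrow> slice w x (x + l) \<in> \<Lambda>"
      using \<Lambda>[OF w0(1)] by blast
    have inj: "inj_on (\<lambda>w. slice w x (x + l)) {w \<in> A. f w = y}"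
    proof (rule inj_onI)
      fix w w' assume w: "w \<in> {w \<in> A. f w = y}" "w' \<in> {w \<in> A. f w = y}" "slice w x (x + l) = slice w' x (x + l)"
      show "w = w'"
      proof (rule nth_equalityI)
        show "length w = length w'" using w len by auto
        fix z assume z: "z < length w"
        show "w ! z = w' ! z"
        proof (cases "z \<in> {x..<x + l}")
          case True
          have *: "slice u x (x + l) ! (z - x) = u ! z" if "u \<in> A" for u
          proof -
            have "z - x < l" "x + (z - x) = z" using True by auto
            thus ?thesis using x len[OF that] nth_slice[of "x + l" u "z - x" x] by simp
          qed
          show ?thesis using *[of w] *[of w'] w by auto
        next
          case False
          thus ?thesis using outside[of w w' z] w z len by auto
        qed
      qed
    qed
    have sub: "(\<lambda>w. slice w x (x + l)) ` {w \<in> A. f w = y} \<subseteq> \<Lambda>"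
      using \<Lambda>'(3) outside[OF _ w0(1)] w0(2) by auto
    show ?thesis
      using inj_on_finite[OF inj sub \<Lambda>'(1)] card_inj_on_le[OF inj sub \<Lambda>'(1)] \<Lambda>'(2) by linarith
  qed
  have sub: "f ` A \<subseteq> reduced_words k (n - l)"
    using A crw_rotate crw_subset_reduced reduced_take[of _ k n "n - l"] unfolding f_def by fastforce
  have "real (card A) \<le> c * real (card (reduced_words k (n - l)))"
    by (rule card_le_fiber(2)[OF _ sub fiber c]) simp_all
  also have "\<dots> \<le> c * real (2 * (2 * k - 1) ^ (n - l))"
    using card_reduced_words_le[OF k, of "n - l"] c by (intro mult_left_mono) (simp_all only: of_nat_le_iff)
  finally show ?thesis using k by (simp add: of_nat_diff)
qed

lemma slice_inv_word:
  assumes "x + l \<le> length w"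
  shows "slice (inv_word w) x (x + l) = inv_word (slice w (length w - x - l) (length w - x))"
proof (rule nth_equalityI)
  show "length (slice (inv_word w) x (x + l)) = length (inv_word (slice w (length w - x - l) (length w - x)))"
    using assms by (simp add: length_slice)
  fix j assume "j < length (slice (inv_word w) x (x + l))"
  hence j: "j < l" using assms by (simp add: length_slice)
  have "slice (inv_word w) x (x + l) ! j = inv_symbol (w ! (length w - Suc (x + j)))"
    using assms j by (simp add: nth_slice nth_inv_word)
  moreover have ls: "length (slice w (length w - x - l) (length w - x)) = l" using assms by (simp add: length_slice)
  have "inv_word (slice w (length w - x - l) (length w - x)) ! j = inv_symbol (slice w (length w - x - l) (length w - x) ! (l - Suc j))"
    using j ls by (simp add: nth_inv_word)
  moreover have "slice w (length w - x - l) (length w - x) ! (l - Suc j) = w ! (length w - x - l + (l - Suc j))"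
    using assms j by (intro nth_slice) auto
  moreover have "length w - x - l + (l - Suc j) = length w - Suc (x + j)" using assms j by simp
  ultimately show "slice (inv_word w) x (x + l) ! j = inv_word (slice w (length w - x - l) (length w - x)) ! j" by simp
qed

section \<open>Stray paths\<close>

definition orient :: "bool \<Rightarrow> word \<Rightarrow> word" where
  "orient bw w = (if bw then inv_word w else w)"

definition pieces_good :: "nat \<Rightarrow> nat \<Rightarrow> (segment \<Rightarrow> 'h fatgraph) \<Rightarrow> nat \<Rightarrow> word \<Rightarrow> nat list \<Rightarrow> bool" where
  "pieces_good L N \<Phi> m w cuts \<longleftrightarrow>
     (\<forall>j\<le>length cuts. good_piece L N (beads m w cuts j) (pieces \<Phi> w cuts j))"

definition bead_words :: "(segment \<Rightarrow> 'h fatgraph) \<Rightarrow> nat \<Rightarrow> word \<Rightarrow> nat list \<Rightarrow> nat set \<Rightarrow> nat \<Rightarrow> word set" where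
  "bead_words \<Phi> m w cuts A l =
     walk_words (pieces \<Phi> w cuts) A (length cuts) m (lip_fun m w cuts) l"

text \<open>
  Words that can be read, at a place inside the bead \<open>i\<close>, along a path which avoids this bead.
\<close>

definition strays :: "nat \<Rightarrow> nat \<Rightarrow> nat \<Rightarrow> nat \<Rightarrow> nat \<Rightarrow> nat \<Rightarrow> nat \<Rightarrow> (segment \<Rightarrow> 'h fatgraph) \<Rightarrow> nat \<Rightarrow> bool \<Rightarrow> word set" where
  "strays k n m st sc L N \<Phi> l bw = {w \<in> cyc_reduced_words k n. \<exists>cuts i x.
     valid_cuts m st sc w cuts \<and> pieces_good L N \<Phi> m w cuts \<and> 1 \<le> i \<and> i < length cuts \<and>
     cuts ! (i - 1) + m + 1 \<le> x \<and> x + l + 1 \<le> cuts ! i \<and>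
     slice (orient bw w) x (x + l) \<in> bead_words \<Phi> m w cuts ({..length cuts} - {i}) l}"

definition bead_word_bound :: "nat \<Rightarrow> nat \<Rightarrow> nat \<Rightarrow> real \<Rightarrow> nat \<Rightarrow> real" where
  "bead_word_bound n N m \<rho> l = real (Suc n * (2 * N * (n + 2) + 2 * m)) * (2 * \<rho> ^ m) * \<rho> ^ l"

lemma card_bead_words_le:
  assumes v: "valid_cuts m st sc w cuts" and p: "pieces_good L N \<Phi> m w cuts" and A: "A \<subseteq> {..length cuts}"
    and w: "length w = n" "set w \<subseteq> letters k" and st: "m < st"
    and \<rho>: "\<rho> \<ge> 1" "\<rho> ^ L = 2" "\<rho> ^ m \<ge> 4 * real N" and L: "L \<ge> 1" and m: "m \<ge> 1" and l: "l \<ge> 1"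
  shows "finite (bead_words \<Phi> m w cuts A l)" "real (card (bead_words \<Phi> m w cuts A l)) \<le> bead_word_bound n N m \<rho> l"
proof -
  have good: "good_piece L N (beads m w cuts i) (pieces \<Phi> w cuts i) \<and>
      (\<forall>b. length (filter (\<lambda>s. s = Tag b) (beads m w cuts i)) \<le> 1) \<and> length (beads m w cuts i) \<le> n + 2"
    if "i \<in> A" for i
    using that A p bead_tag_count[OF v st w(2)] bead_shape(2)[OF v st w(2)] w(1) unfolding pieces_good_def by auto
  note c = card_walk_words_le[where A = A and Ys = "pieces \<Phi> w cuts" and
      B = "beads m w cuts" and c = "n + 2" and L = L and N = N, OF good A \<rho> L m l]
  show "finite (bead_words \<Phi> m w cuts A l)" unfolding bead_words_def by (rule c(1))
  have "length cuts \<le> n"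
    using cut_chain_length_le[of m st sc w cuts] v st w(1) by (auto simp: valid_cuts_def)
  hence "real (Suc (length cuts) * (2 * N * (n + 2) + 2 * m)) * (2 * \<rho> ^ m) * \<rho> ^ l \<le> bead_word_bound n N m \<rho> l"
    unfolding bead_word_bound_def using \<rho>(1)
    by (intro mult_right_mono of_nat_mono mult_le_mono1) auto
  thus "real (card (bead_words \<Phi> m w cuts A l)) \<le> bead_word_bound n N m \<rho> l"
    using c(2)[where lip = "lip_fun m w cuts"] unfolding bead_words_def by linarith
qed

text \<open>The number of cuts, the bead, its two cuts and the place x account for the factor (n +
  1) ^ 5. The window lies in the core of the bead i and the path avoids this bead, so the set of
  readable words is determined by the letters outside the window, and only its few members can fill
  the window.\<close>

lemma card_strays_le:
  assumes st: "m < st" and k: "k \<ge> 1"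
    and \<rho>: "\<rho> \<ge> 1" "\<rho> ^ L = 2" "\<rho> ^ m \<ge> 4 * real N" and L: "L \<ge> 1" and m: "m \<ge> 1" and l: "l \<ge> 1"
  shows "real (card (strays k n m st sc L N \<Phi> l bw)) \<le>
    real (Suc n ^ 5) * (bead_word_bound n N m \<rho> l * (2 * (2 * real k - 1) ^ (n - l)))"
proof -
  define S where "S = (\<lambda>(M, i, a, b, x). {w \<in> cyc_reduced_words k n. \<exists>cuts. length cuts = M \<and>
     valid_cuts m st sc w cuts \<and> pieces_good L N \<Phi> m w cuts \<and> 1 \<le> i \<and> i < length cuts \<and> cuts ! (i - 1) = a \<and> cuts ! i = b \<and>
     a + m + 1 \<le> x \<and> x + l + 1 \<le> b \<and>
     slice (orient bw w) x (x + l) \<in> bead_words \<Phi> m w cuts ({..M} - {i}) l})"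
  define I where "I = {..n} \<times> {..n} \<times> {..n} \<times> {..n} \<times> {..n}"
  have cI: "card I = Suc n ^ 5" by (simp add: I_def card_cartesian_product power_eq_if)
  have sub: "strays k n m st sc L N \<Phi> l bw \<subseteq> (\<Union>d\<in>I. S d)"
  proof
    fix w assume "w \<in> strays k n m st sc L N \<Phi> l bw"
    then obtain cuts i x where w: "w \<in> cyc_reduced_words k n" "valid_cuts m st sc w cuts" "pieces_good L N \<Phi> m w cuts"
      "1 \<le> i" "i < length cuts" "cuts ! (i - 1) + m + 1 \<le> x" "x + l + 1 \<le> cuts ! i"
      "slice (orient bw w) x (x + l) \<in> bead_words \<Phi> m w cuts ({..length cuts} - {i}) l"
      unfolding strays_def by blast
    have n: "length w = n" using w(1) crw_length by blast
    have "length cuts \<le> n"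
      using cut_chain_length_le[of m st sc w cuts] w(2) st n by (auto simp: valid_cuts_def)
    moreover have "cuts ! i \<le> n" using valid_cuts_bound[OF w(2,5)] n by simp
    ultimately have I: "(length cuts, i, cuts ! (i - 1), cuts ! i, x) \<in> I" using w(5-7) by (auto simp: I_def)
    have "w \<in> S (length cuts, i, cuts ! (i - 1), cuts ! i, x)"
      unfolding S_def using w by auto
    thus "w \<in> (\<Union>d\<in>I. S d)" using I by blast
  qed
  have each: "finite (S d) \<and> real (card (S d)) \<le> bead_word_bound n N m \<rho> l * (2 * (2 * real k - 1) ^ (n - l))" if "d \<in> I" for d
  proof -
    obtain M i a b x where d: "d = (M, i, a, b, x)" by (metis surj_pair)
    have fin: "finite (S d)" unfolding S_def d by simp
    have pos: "bead_word_bound n N m \<rho> l \<ge> 0" using \<rho>(1) by (simp add: bead_word_bound_def)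
    show ?thesis
    proof (cases "S d = {}")
      case True thus ?thesis using k pos by simp
    next
      case False
      then obtain w1 cuts1 where w1: "w1 \<in> cyc_reduced_words k n" "valid_cuts m st sc w1 cuts1" "i < length cuts1" "cuts1 ! i = b"
        "x + l + 1 \<le> b"
        unfolding S_def d by blast
      have n1: "length w1 = n" using w1(1) crw_length by blast
      have xl: "2 * (x + l + m + 1) \<le> n" using valid_cuts_bound[OF w1(2,3)] w1(4,5) n1 by simp
      \<comment> \<open>The place of the window in \<open>w\<close> itself. If the inverse word is
        read, this is the mirror image, which belongs to the core of the same bead.\<close>
      define z where "z = (if bw then n - x - l else x)"
      have z: "z + l \<le> n" using xl by (auto simp: z_def)
      have "real (card (S d)) \<le> bead_word_bound n N m \<rho> l * (2 * (2 * real k - 1) ^ (n - l))"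
      proof (rule card_window_le[OF _ z k pos])
        show "S d \<subseteq> cyc_reduced_words k n" unfolding S_def d by auto
        fix w0 assume "w0 \<in> S d"
        then obtain cuts0 where w0: "w0 \<in> cyc_reduced_words k n" "length cuts0 = M"
          "valid_cuts m st sc w0 cuts0" "pieces_good L N \<Phi> m w0 cuts0" "1 \<le> i" "i < length cuts0" "cuts0 ! (i - 1) = a" "cuts0 ! i = b"
          "a + m + 1 \<le> x" "x + l + 1 \<le> b"
          unfolding S_def d by blast
        have n0: "length w0 = n" "set w0 \<subseteq> letters k" using w0(1) crw_length crw_letters by blast+
        define LW where "LW = bead_words \<Phi> m w0 cuts0 ({..M} - {i}) l"
        have LW: "finite LW" "real (card LW) \<le> bead_word_bound n N m \<rho> l"
          unfolding LW_def using w0(2) by (intro card_bead_words_le[OF w0(3,4) _ n0 st \<rho> L m l]; auto)+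
        show "\<exists>\<Lambda>. finite \<Lambda> \<and> real (card \<Lambda>) \<le> bead_word_bound n N m \<rho> l \<and>
          (\<forall>w\<in>S d. (\<forall>y<n. y \<notin> {z..<z + l} \<longrightarrow> w ! y = w0 ! y) \<longrightarrow> slice w z (z + l) \<in> \<Lambda>)"
        proof (intro exI[of _ "if bw then inv_word ` LW else LW"] conjI ballI impI)
          show "finite (if bw then inv_word ` LW else LW)" using LW(1) by simp
          show "real (card (if bw then inv_word ` LW else LW)) \<le> bead_word_bound n N m \<rho> l"
            using LW(2) card_image_le[OF LW(1), of inv_word] by auto
          fix w assume wS: "w \<in> S d" and ag: "\<forall>y<n. y \<notin> {z..<z + l} \<longrightarrow> w ! y = w0 ! y"
          then obtain cuts where w: "w \<in> cyc_reduced_words k n" "length cuts = M"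
            "valid_cuts m st sc w cuts" "pieces_good L N \<Phi> m w cuts" "1 \<le> i" "i < length cuts" "cuts ! (i - 1) = a" "cuts ! i = b"
            "slice (orient bw w) x (x + l) \<in> bead_words \<Phi> m w cuts ({..M} - {i}) l"
            unfolding S_def d by blast
          have n: "length w = n" using w(1) crw_length by blast
          have ag': "w ! y = w0 ! y" if "y < length w" "y \<notin> core (length w) m (cuts ! (i - 1)) (cuts ! i)" for y
          proof -
            have "y \<notin> {z..<z + l}" using that(2) w0(9,10) xl n w(7,8) by (auto simp: z_def core_def split: if_splits)
            thus ?thesis using ag that(1) n by auto
          qed
          have h: "length w = length w0" "st \<ge> 1" "length cuts = length cuts0"
            "cuts ! (i - 1) = cuts0 ! (i - 1)" "cuts ! i = cuts0 ! i"
            using n n0 st w w0 by auto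
          note oc = outside_core[OF h(1,2) w(3) w0(3) h(3) w(5,6) h(4,5)]
          have cuts: "cuts = cuts0" by (rule oc(1)) (rule ag')
          have seg: "segment_of w cuts0 j = segment_of w0 cuts0 j" if "j \<noteq> i" for j
            unfolding cuts[symmetric] by (rule oc(2)[OF _ that]) (rule ag')
          have lips: "lip_fun m w cuts0 j b = lip_fun m w0 cuts0 j b" if "j \<le> M" for j b
          proof -
            have "lip_fun m w cuts j b = lip_fun m w0 cuts j b \<or> j > length cuts" by (rule oc(3)) (rule ag')
            thus ?thesis using that w(2) cuts by auto
          qed
          have "bead_words \<Phi> m w cuts ({..M} - {i}) l = LW"
            unfolding bead_words_def LW_def cuts using seg lips w0(2) by (intro walk_words_cong) auto
          hence sl: "slice (orient bw w) x (x + l) \<in> LW" using w(9) by simp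
          show "slice w z (z + l) \<in> (if bw then inv_word ` LW else LW)"
          proof (cases bw)
            case True
            have "slice (inv_word w) x (x + l) = inv_word (slice w (n - x - l) (n - x))"
              using slice_inv_word[of x l w] xl n by simp
            moreover have "z + l = n - x" "z = n - x - l" using True xl by (auto simp: z_def)
            ultimately have "slice w z (z + l) = inv_word (slice (orient bw w) x (x + l))"
              using True by (simp add: orient_def)
            thus ?thesis using True sl by simp
          next
            case False
            thus ?thesis using sl by (simp add: z_def orient_def)
          qed
        qed
      qed
      thus ?thesis using fin by blast
    qed
  qed
  have "finite I" by (simp add: I_def)
  from card_UN_real_le[OF this sub each] show ?thesis unfolding cI .
qed

section \<open>Repeated and inversely repeated subwords\<close>

definition repeats :: "nat \<Rightarrow> nat \<Rightarrow> nat \<Rightarrow> word set" where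
  "repeats k n l = {w \<in> cyc_reduced_words k n. \<exists>x<n. \<exists>y<n. x \<noteq> y \<and> (\<forall>j<l. cnth w (x + j) = cnth w (y + j))}"

definition inverse_repeats :: "nat \<Rightarrow> nat \<Rightarrow> nat \<Rightarrow> word set" where
  "inverse_repeats k n l = {w \<in> cyc_reduced_words k n. \<exists>x<n. \<exists>y<n. \<forall>j<l. cnth w (x + j) = cnth (inv_word w) (y + j)}"

lemma card_determined_window_le:
  assumes A: "A \<subseteq> cyc_reduced_words k n" and x: "x + l \<le> n" and k: "k \<ge> 1"
    and det: "\<And>w w' y. w \<in> A \<Longrightarrow> w' \<in> A \<Longrightarrow> (\<And>z. z < n \<Longrightarrow> z \<notin> {x..<x + l} \<Longrightarrow> w ! z = w' ! z) \<Longrightarrow> y \<in> {x..<x + l} \<Longrightarrow> w ! y = w' ! y"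
  shows "real (card A) \<le> 2 * (2 * real k - 1) ^ (n - l)"
proof -
  have "real (card A) \<le> 1 * (2 * (2 * real k - 1) ^ (n - l))"
  proof (rule card_window_le[OF A x k])
    fix w0 assume w0: "w0 \<in> A"
    show "\<exists>\<Lambda>. finite \<Lambda> \<and> real (card \<Lambda>) \<le> 1 \<and>
      (\<forall>w\<in>A. (\<forall>y<n. y \<notin> {x..<x + l} \<longrightarrow> w ! y = w0 ! y) \<longrightarrow> slice w x (x + l) \<in> \<Lambda>)"
    proof (intro exI[of _ "{slice w0 x (x + l)}"] conjI ballI impI)
      fix w assume w: "w \<in> A" "\<forall>y<n. y \<notin> {x..<x + l} \<longrightarrow> w ! y = w0 ! y"
      have "length w = n" "length w0 = n" using w w0 A crw_length by blast+
      hence "slice w x (x + l) = slice w0 x (x + l)"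
        using x det[OF w(1) w0] w(2) by (intro list_eq_slice) auto
      thus "slice w x (x + l) \<in> {slice w0 x (x + l)}" by simp
    qed simp_all
  qed simp
  thus ?thesis by simp
qed

lemma rotate_inverse: "rotate (length w * x - x) (rotate x w) = w"
proof (cases "w = []")
  case False
  have "x \<le> length w * x" using False by (cases "length w") simp_all
  hence "rotate (length w * x - x) (rotate x w) = rotate (length w * x) w" by (simp add: rotate_rotate)
  also have "\<dots> = rotate ((length w * x) mod length w) w" by (rule rotate_conv_mod)
  finally show ?thesis by simp
qed simp

lemma card_rotated_le:
  assumes "\<And>w. w \<in> A \<Longrightarrow> rotate x w \<in> S" "finite S"
  shows "card A \<le> card S"
proof (rule card_inj_on_le)
  show "inj_on (rotate x) A" by (rule inj_onI) (metis rotate_inverse length_rotate)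
qed (use assms in auto)

text \<open>One occurrence is rotated to the start. The other one is then determined by earlier
  letters, by induction from left to right if the two overlap.\<close>

lemma card_repeats_le:
  assumes k: "k \<ge> 1" and l: "2 * l \<le> n"
  shows "real (card (repeats k n l)) \<le> real (n ^ 2) * (2 * (2 * real k - 1) ^ (n - l))"
proof -
  define T where "T = (\<lambda>d. {w \<in> cyc_reduced_words k n. \<forall>j<l. cnth w j = cnth w (d + j)})"
  have T: "real (card (T d)) \<le> 2 * (2 * real k - 1) ^ (n - l)" if d: "0 < d" "d + l \<le> n" for d
  proof (rule card_determined_window_le[OF _ d(2) k])
    show "T d \<subseteq> cyc_reduced_words k n" by (auto simp: T_def)
    fix w w' y assume w: "w \<in> T d" "w' \<in> T d" and ag: "\<And>z. z < n \<Longrightarrow> z \<notin> {d..<d + l} \<Longrightarrow> w ! z = w' ! z"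
    have n: "length w = n" "length w' = n" using w crw_length by (auto simp: T_def)
    show "y \<in> {d..<d + l} \<Longrightarrow> w ! y = w' ! y"
    proof (induction y rule: less_induct)
      case (less y)
      define j where "j = y - d"
      have j: "j < l" "y = d + j" "j < y" "y < n" using less.prems d by (auto simp: j_def)
      have "w ! y = w ! j" "w' ! y = w' ! j"
        using w j n by (auto simp: T_def cnth_def)
      moreover have "w ! j = w' ! j"
        using less.IH[OF j(3)] ag[of j] j by (cases "j \<in> {d..<d + l}") auto
      ultimately show ?case by simp
    qed
  qed
  define S where "S = (\<lambda>(x, y). {w \<in> cyc_reduced_words k n. x \<noteq> y \<and> (\<forall>j<l. cnth w (x + j) = cnth w (y + j))})"
  have le: "real (card (S (x, y))) \<le> 2 * (2 * real k - 1) ^ (n - l)" if xy: "x < y" "y < n" for x y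
  proof (cases "y - x + l \<le> n")
    case True
    have "card (S (x, y)) \<le> card (T (y - x))"
    proof (rule card_rotated_le[where x = x])
      fix w assume w: "w \<in> S (x, y)"
      hence "length w = n" using crw_length[of w k n] by (simp add: S_def)
      moreover from this have "w \<noteq> []" using xy by auto
      moreover note w
      ultimately show "rotate x w \<in> T (y - x)" using xy by (auto simp: S_def T_def cnth_rotate crw_rotate)
    qed (simp add: T_def)
    thus ?thesis using T[of "y - x"] True xy by simp
  next
    case False
    \<comment> \<open>If the second occurrence runs past the end of the rotated word, the roles are
      exchanged: since 2 * l <= n, it fits the other way round.\<close>
    define d where "d = n + x - y"
    have d: "0 < d" "d + l \<le> n" using False l xy by (auto simp: d_def)
    have "card (S (x, y)) \<le> card (T d)"
    proof (rule card_rotated_le[where x = y])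
      fix w assume w: "w \<in> S (x, y)"
      hence "length w = n" using crw_length[of w k n] by (simp add: S_def)
      moreover from this have "w \<noteq> []" using xy by auto
      ultimately have n: "length w = n" "w \<noteq> []" by auto
      have "cnth w (y + (d + j)) = cnth w (x + j)" for j
      proof -
        have "y + (d + j) = n + (x + j)" using xy by (simp add: d_def)
        thus ?thesis using n by (intro cnth_cong) (simp only: mod_add_self1)
      qed
      thus "rotate y w \<in> T d" using w n by (auto simp: S_def T_def cnth_rotate crw_rotate)
    qed (simp add: T_def)
    thus ?thesis using T[OF d] by simp
  qed
  have sym: "S (x, y) = S (y, x)" for x y by (auto simp: S_def)
  have each: "finite (S d) \<and> real (card (S d)) \<le> 2 * (2 * real k - 1) ^ (n - l)" if "d \<in> {..<n} \<times> {..<n}" for d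
  proof -
    obtain x y where d: "d = (x, y)" "x < n" "y < n" using \<open>d \<in> _\<close> by auto
    have pos: "0 \<le> 2 * (2 * real k - 1) ^ (n - l)" using k by simp
    have "real (card (S d)) \<le> 2 * (2 * real k - 1) ^ (n - l)"
      using le[of x y] le[of y x] d sym[of x y] pos by (cases x y rule: linorder_cases) (auto simp: S_def)
    moreover have "finite (S d)" by (simp add: S_def d)
    ultimately show ?thesis by blast
  qed
  have "repeats k n l \<subseteq> (\<Union>d\<in>{..<n} \<times> {..<n}. S d)" by (auto simp: repeats_def S_def)
  from card_UN_real_le[OF _ this each] show ?thesis by (simp add: card_cartesian_product power2_eq_square)
qed

text \<open>Here positions are matched by a reflection, which may map a window into itself. One of
  the two halves of a stretch of length 2 * h is always disjoint from its reflection and thus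
  determined by the other letters.\<close>

lemma card_inverse_repeats_le:
  assumes k: "k \<ge> 1" and l: "4 * h \<le> n" "2 * h \<le> l"
  shows "real (card (inverse_repeats k n l)) \<le> real (n ^ 2) * (2 * (2 * real k - 1) ^ (n - h))"
proof -
  define T where "T = (\<lambda>e. {w \<in> cyc_reduced_words k n. \<forall>j<2*h. cnth w j = inv_symbol (cnth w (e + n - j))})"
  have T: "real (card (T e)) \<le> 2 * (2 * real k - 1) ^ (n - h)" if e: "e < n" for e
  proof -
    \<comment> \<open>The reflection sends y to e - y modulo n. If e >= 2 * h - 1, it moves the
      first half beyond itself; otherwise it moves the second half below h or, wrapping around,
      beyond 2 * h, since 4 * h <= n.\<close>
    define z where "z = (if 2 * h \<le> e + 1 then 0 else h)"
    have zh: "z + h \<le> n" "z + h \<le> 2 * h" using l by (auto simp: z_def)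
    show ?thesis
    proof (rule card_determined_window_le[OF _ zh(1) k])
      show "T e \<subseteq> cyc_reduced_words k n" by (auto simp: T_def)
      fix w w' y assume w: "w \<in> T e" "w' \<in> T e" and ag: "\<And>x. x < n \<Longrightarrow> x \<notin> {z..<z + h} \<Longrightarrow> w ! x = w' ! x"
        and y: "y \<in> {z..<z + h}"
      have n: "length w = n" "length w' = n" using w crw_length by (auto simp: T_def)
      define r where "r = (if y \<le> e then e - y else e + n - y)"
      have r: "r < n" "r mod n = (e + n - y) mod n"

      proof -
        show "r < n" using e y zh l by (auto simp: r_def)
        show "r mod n = (e + n - y) mod n"
        proof (cases "y \<le> e")
          case True
          hence "e + n - y = (e - y) + n" by simp
          thus ?thesis using True by (simp only: r_def if_True mod_add_self2)
        qed (simp add: r_def)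
      qed
      have "r \<notin> {z..<z + h}"
        using y l by (auto simp: r_def z_def split: if_splits)
      hence 1: "w ! r = w' ! r" using ag r by blast
      have 2: "u ! y = inv_symbol (u ! r)" if "u \<in> T e" for u
      proof -
        have "length u = n" using that crw_length by (auto simp: T_def)
        moreover have "cnth u y = inv_symbol (cnth u (e + n - y))" using that y zh by (auto simp: T_def)
        moreover have "cnth u (e + n - y) = cnth u r" using r \<open>length u = n\<close> by (intro cnth_cong) simp
        moreover have "y < n" using y zh by auto
        ultimately show ?thesis using r by (simp add: cnth_nth)
      qed
      show "w ! y = w' ! y" using 1 2[OF w(1)] 2[OF w(2)] by simp
    qed
  qed
  define S where "S = (\<lambda>(x, y). {w \<in> cyc_reduced_words k n. \<forall>j<l. cnth w (x + j) = cnth (inv_word w) (y + j)})"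
  have each: "finite (S d) \<and> real (card (S d)) \<le> 2 * (2 * real k - 1) ^ (n - h)" if "d \<in> {..<n} \<times> {..<n}" for d
  proof -
    obtain x y where d: "d = (x, y)" "x < n" "y < n" using \<open>d \<in> _\<close> by auto
    \<comment> \<open>The letter y + j of the inverse word is the inverse of the letter x + e - j of
      \<open>w\<close>: so e represents - (x + y + 1) modulo n.\<close>
    define e where "e = (2 * n - (x + y + 1)) mod n"
    have e: "e < n" using d by (simp add: e_def)
    have "card (S d) \<le> card (T e)"
    proof (rule card_rotated_le[where x = x])
      fix w assume w: "w \<in> S d"
      hence "length w = n" using crw_length[of w k n] d by (simp add: S_def)
      moreover from this have "w \<noteq> []" using d by auto
      ultimately have n: "length w = n" "w \<noteq> []" by auto
      have "cnth w (x + j) = inv_symbol (cnth w (x + (e + n - j)))" if j: "j < 2 * h" for j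
      proof -
        have "cnth w (x + j) = cnth (inv_word w) (y + j)" using w j l d by (auto simp: S_def)
        also have "\<dots> = inv_symbol (cnth w (x + (e + n - j)))"
        proof (rule cnth_inv_word[OF n(2)])
          have eq: "Suc (y + j + (x + (e + n - j))) = (e + (x + y + 1)) + n" using j l by simp
          have "(e + (x + y + 1)) mod n = ((2 * n - (x + y + 1)) + (x + y + 1)) mod n"
            unfolding e_def by (rule mod_add_left_eq)
          also have "(2 * n - (x + y + 1)) + (x + y + 1) = 2 * n" using d by simp
          finally have "n dvd e + (x + y + 1)" by (simp add: dvd_eq_mod_eq_0)
          thus "length w dvd Suc (y + j + (x + (e + n - j)))" unfolding eq n(1) by (rule dvd_add) simp
        qed
        finally show ?thesis .
      qed
      thus "rotate x w \<in> T e" using w n d by (auto simp: S_def T_def cnth_rotate crw_rotate)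
    qed (simp add: T_def)
    moreover have "finite (S d)" by (simp add: S_def d)
    ultimately show ?thesis using T[OF e] by simp
  qed
  have "inverse_repeats k n l \<subseteq> (\<Union>d\<in>{..<n} \<times> {..<n}. S d)" by (auto simp: inverse_repeats_def S_def)
  from card_UN_real_le[OF _ this each] show ?thesis by (simp add: card_cartesian_product power2_eq_square)
qed

section \<open>Resampling lips\<close>

text \<open>Both occurrences of the lip at distance a are replaced together, so that they stay
  mutually inverse.\<close>

definition resample :: "nat \<Rightarrow> word \<Rightarrow> word \<Rightarrow> word" where
  "resample a u w = (let n = length w; m = length u in
     map (\<lambda>y. if a \<le> y \<and> y < a + m then u ! (y - a)
       else if n - a - m \<le> y \<and> y < n - a then inv_symbol (u ! (n - 1 - a - y)) else w ! y) [0..<n])"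

lemma length_resample [simp]: "length (resample a u w) = length w"
  by (simp add: resample_def Let_def)

lemma nth_resample:
  assumes "y < length w"
  shows "resample a u w ! y = (if a \<le> y \<and> y < a + length u then u ! (y - a)
       else if length w - a - length u \<le> y \<and> y < length w - a then inv_symbol (u ! (length w - 1 - a - y)) else w ! y)"
  using assms by (simp add: resample_def Let_def)

lemma nth_resample_outside:
  assumes "y < length w" "y < a \<or> a + length u \<le> y" "y < length w - a - length u \<or> length w - a \<le> y"
  shows "resample a u w ! y = w ! y"
  using assms by (auto simp: nth_resample)

lemma nth_resample_lip:
  assumes "a \<le> y" "y < a + length u" "y < length w"
  shows "resample a u w ! y = u ! (y - a)"
  using assms by (simp add: nth_resample)

lemma nth_resample_mirror:
  assumes "length w - a - length u \<le> y" "y < length w - a" "a + length u \<le> y"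
  shows "resample a u w ! y = inv_symbol (u ! (length w - 1 - a - y))"
  using assms by (simp add: nth_resample)

text \<open>Inversion exchanges the two occurrences and inverts each of them, so that
  \<open>u\<close> stands at a again; hence both directions of reading can be treated alike.\<close>

lemma inv_word_resample:
  assumes "2 * (a + length u) \<le> length w"
  shows "inv_word (resample a u w) = resample a u (inv_word w)"
proof (rule nth_equalityI)
  fix y assume "y < length (inv_word (resample a u w))"
  hence y: "y < length w" by simp
  define z where "z = length w - Suc y"
  have z: "z < length w" "y = length w - Suc z" using y by (auto simp: z_def)
  have "inv_word (resample a u w) ! y = inv_symbol (resample a u w ! z)"
    using y by (simp add: nth_inv_word z_def)
  also have "\<dots> = resample a u (inv_word w) ! y"
  proof -
    consider "a \<le> y" "y < a + length u" | "length w - a - length u \<le> y" "y < length w - a"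
      | "y < a \<or> a + length u \<le> y" "y < length w - a - length u \<or> length w - a \<le> y" by linarith
    thus ?thesis
    proof cases
      case 1
      hence zz: "length w - a - length u \<le> z" "z < length w - a" "a + length u \<le> z" "length w - 1 - a - z = y - a"
        using assms y by (auto simp: z_def)
      show ?thesis using nth_resample_mirror[OF zz(1-3)] nth_resample_lip[OF 1, of "inv_word w"] y zz(4) by simp
    next
      case 2
      hence zz: "a \<le> z" "z < a + length u" "a + length u \<le> y" "z - a = length w - 1 - a - y"
        using assms y by (auto simp: z_def)
      show ?thesis using nth_resample_lip[OF zz(1,2) z(1)] nth_resample_mirror[of "inv_word w" a u y] 2 zz(3,4) by simp
    next
      case 3
      hence "z < a \<or> a + length u \<le> z" "z < length w - a - length u \<or> length w - a \<le> z"
        using assms y by (auto simp: z_def)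
      thus ?thesis using 3 y z by (simp add: nth_resample_outside nth_inv_word)
    qed
  qed
  finally show "inv_word (resample a u w) ! y = resample a u (inv_word w) ! y" .
qed simp

lemma crw_iff_nth:
  assumes "n > 0"
  shows "w \<in> cyc_reduced_words k n \<longleftrightarrow> length w = n \<and> set w \<subseteq> letters k \<and>
    (\<forall>y. Suc y < n \<longrightarrow> w ! Suc y \<noteq> inv_symbol (w ! y)) \<and> w ! 0 \<noteq> inv_symbol (w ! (n - 1))"
proof (cases "length w = n")
  case True
  hence "w \<noteq> []" using assms by auto
  thus ?thesis using True
    by (simp add: cyc_reduced_words_def letters_def successively_conv_nth hd_conv_nth last_conv_nth)
qed (auto simp: cyc_reduced_words_def)

text \<open>Two letters are forbidden at each end of \<open>u\<close>, because the lip occurs twice,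
  once inverted, and neither occurrence may cancel with its neighbours.\<close>

definition fitting_lips :: "nat \<Rightarrow> nat \<Rightarrow> nat \<Rightarrow> word \<Rightarrow> word set" where
  "fitting_lips k m a w = {u \<in> reduced_words k m.
     hd u \<notin> {inv_symbol (w ! (a - 1)), w ! (length w - a)} \<and>
     last u \<notin> {inv_symbol (w ! (a + m)), w ! (length w - a - m - 1)}}"

lemma card_fitting_lips:
  assumes "k \<ge> 2" "m \<ge> 2" shows "card (fitting_lips k m a w) \<ge> (2 * k - 1) ^ (m - 2)"
proof -
  have m: "m = Suc (Suc (m - 2))" using assms by simp
  have c: "card {x, y} \<le> 2" for x y :: symbol by (simp add: card_insert_if)
  show ?thesis
    unfolding fitting_lips_def
    by (subst (2) m, rule card_reduced_words_ends_ge[where G = "\<lambda>_. {inv_symbol (w ! (a + m)), w ! (length w - a - m - 1)}"])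
      (use assms c in auto)
qed

lemma inv_symbol_neq_swap: "s \<noteq> inv_symbol t \<Longrightarrow> t \<noteq> inv_symbol s"
  by auto

lemma resample_crw:
  assumes w: "w \<in> cyc_reduced_words k n" and u: "u \<in> fitting_lips k m a w"
    and a: "a \<ge> 1" "2 * (a + m + 1) \<le> n" and m: "m \<ge> 1"
  shows "resample a u w \<in> cyc_reduced_words k n"
proof -
  have n: "length w = n" "n > 0" using w crw_length a by auto
  have u': "length u = m" "set u \<subseteq> letters k" "\<And>j. Suc j < m \<Longrightarrow> u ! Suc j \<noteq> inv_symbol (u ! j)" "u \<noteq> []"
    using u m by (auto simp: fitting_lips_def reduced_words_def)
  have hdu: "u ! 0 \<noteq> inv_symbol (w ! (a - 1))" "u ! 0 \<noteq> w ! (n - a)"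
    and lastu: "u ! (m - 1) \<noteq> inv_symbol (w ! (a + m))" "u ! (m - 1) \<noteq> w ! (n - a - m - 1)"
    using u u' n by (auto simp: fitting_lips_def hd_conv_nth last_conv_nth)
  note ww = w[unfolded crw_iff_nth[OF n(2)]]
  let ?v = "resample a u w"
  have lip1: "?v ! y = u ! (y - a)" if "a \<le> y" "y < a + m" for y
    using nth_resample_lip[of a y u w] that a n u' by simp
  have lip2: "?v ! y = inv_symbol (u ! (n - 1 - a - y))" if "n - a - m \<le> y" "y < n - a" for y
    using nth_resample_mirror[of w a u y] that a n u' by simp
  have out: "?v ! y = w ! y" if "y < n" "y < a \<or> a + m \<le> y" "y < n - a - m \<or> n - a \<le> y" for y
    using that n u' by (intro nth_resample_outside) auto
  have "?v ! y \<in> letters k" if "y < n" for y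
  proof -
    consider "a \<le> y" "y < a + m" | "n - a - m \<le> y" "y < n - a"
      | "y < a \<or> a + m \<le> y" "y < n - a - m \<or> n - a \<le> y" by linarith
    thus ?thesis
    proof cases
      case 1 thus ?thesis using lip1 u'(1,2) by (auto intro!: nth_in_subset)
    next
      case 2 thus ?thesis using lip2 u'(1,2) a by (auto intro!: nth_in_subset)
    next
      case 3 thus ?thesis using out that ww n by (auto intro!: nth_in_subset)
    qed
  qed
  hence "set ?v \<subseteq> letters k" using n by (auto simp: in_set_conv_nth)
  moreover have "?v ! Suc y \<noteq> inv_symbol (?v ! y)" if y: "Suc y < n" for y
  proof -
    have wy: "w ! Suc y \<noteq> inv_symbol (w ! y)" using ww y by blast
    consider "Suc y < a" | "Suc y = a" | "a \<le> y" "Suc y < a + m" | "Suc y = a + m" | "a + m \<le> y" "Suc y < n - a - m"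
      | "Suc y = n - a - m" | "n - a - m \<le> y" "Suc y < n - a" | "Suc y = n - a" | "n - a \<le> y" by linarith
    thus ?thesis
    proof cases
      case 1
      have "?v ! y = w ! y" "?v ! Suc y = w ! Suc y" using 1 a by (auto intro!: out)
      thus ?thesis using wy by simp
    next
      case 2
      have "?v ! y = w ! y" using 2 a by (intro out) auto
      thus ?thesis using lip1[of "Suc y"] hdu(1) 2 m by auto
    next
      case 3
      have "u ! Suc (y - a) \<noteq> inv_symbol (u ! (y - a))" using 3 by (intro u') simp
      thus ?thesis using lip1[of y] lip1[of "Suc y"] 3 by (simp add: Suc_diff_le)
    next
      case 4
      have "?v ! Suc y = w ! Suc y" using 4 a by (intro out) auto
      moreover have "?v ! y = u ! (m - 1)"
      proof -
        have "y - a = m - 1" "a \<le> y" "y < a + m" using 4 m by auto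
        thus ?thesis using lip1[of y] by simp
      qed
      ultimately show ?thesis using lastu(1) 4 by (metis inv_symbol_neq_swap)
    next
      case 5
      have "?v ! y = w ! y" "?v ! Suc y = w ! Suc y" using 5 a by (auto intro!: out)
      thus ?thesis using wy by simp
    next
      case 6
      have "?v ! y = w ! y" using 6 a by (intro out) auto
      moreover have "?v ! Suc y = inv_symbol (u ! (m - 1))"
      proof -
        have "n - 1 - a - Suc y = m - 1" using 6 a by linarith
        thus ?thesis using lip2[of "Suc y"] 6 a m by simp
      qed
      moreover have "y = n - a - m - 1" using 6 by simp
      ultimately show ?thesis using lastu(2) by simp
    next
      case 7
      define q where "q = n - 1 - a - Suc y"
      have q: "Suc q < m" "n - 1 - a - y = Suc q" using 7 a by (auto simp: q_def)
      have "?v ! Suc y = inv_symbol (u ! q)" using lip2[of "Suc y"] 7 by (simp add: q_def)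
      moreover have "?v ! y = inv_symbol (u ! Suc q)" using lip2[of y] 7 q by simp
      ultimately show ?thesis using u'(3)[OF q(1)] by auto
    next
      case 8
      have "?v ! Suc y = w ! Suc y" using 8 a by (intro out) auto
      moreover have "?v ! y = inv_symbol (u ! 0)"
      proof -
        have "n - 1 - a - y = 0" "n - a - m \<le> y" "y < n - a" using 8 m by auto
        thus ?thesis using lip2[of y] by simp
      qed
      ultimately show ?thesis using hdu(2) 8 by auto
    next
      case 9
      have "?v ! y = w ! y" "?v ! Suc y = w ! Suc y" using 9 a y by (auto intro!: out)
      thus ?thesis using wy by simp
    qed
  qed
  moreover have "?v ! 0 = w ! 0" "?v ! (n - 1) = w ! (n - 1)" using a n by (auto intro!: out)
  ultimately show ?thesis unfolding crw_iff_nth[OF n(2)] using ww n by auto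
qed

lemma resample_agree:
  assumes "x < a \<or> a + length u \<le> x" "2 * x < length w" "2 * (a + length u + 1) \<le> length w"
  shows "agree_at w (resample a u w) x"
proof -
  define z where "z = length w - 1 - x"
  have "x < length w - a - length u \<or> length w - a \<le> x" using assms by auto
  hence "resample a u w ! x = w ! x" using assms by (intro nth_resample_outside) auto
  moreover have "z < length w" "z < a \<or> a + length u \<le> z" "z < length w - a - length u \<or> length w - a \<le> z"
    using assms by (auto simp: z_def)
  hence "resample a u w ! z = w ! z" by (rule nth_resample_outside)
  ultimately show ?thesis by (simp add: agree_at_def z_def)
qed

text \<open>
  No earlier lip appears: it would have to end inside the new one, but lips cannot be extended.
\<close>

lemma resample_first_lip:
  assumes fl: "first_lip m st sc w c a" and u: "length u = m" and st: "st \<ge> 1" "m \<ge> 1" and a: "2 * (a + m + 1) \<le> length w"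
  shows "first_lip m st sc (resample a u w) c a"
proof -
  let ?v = "resample a u w"
  have ca: "c + st \<le> a" "a \<ge> 1" and la: "lip_at m w a" using fl st by (auto simp: first_lip_def)
  have mt: "matched ?v (a + j)" if "j < m" for j
  proof -
    have "?v ! (a + j) = u ! j" using nth_resample_lip[of a "a + j" u w] that a u by simp
    moreover have "?v ! (length w - 1 - (a + j)) = inv_symbol (u ! j)"
    proof -
      have "j \<le> length w - 1 - a" using that a by simp
      hence "length w - 1 - a - (length w - 1 - (a + j)) = j" by (simp only: diff_diff_left[symmetric] diff_diff_cancel)
      moreover have "length w - a - length u \<le> length w - 1 - (a + j)" "length w - 1 - (a + j) < length w - a"
        "a + length u \<le> length w - 1 - (a + j)" using that a u by auto
      ultimately show ?thesis using nth_resample_mirror[of w a u "length w - 1 - (a + j)"] by simp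
    qed
    ultimately show ?thesis by (simp add: matched_def)
  qed
  have ag: "matched ?v x \<longleftrightarrow> matched w x" if "x < a \<or> a + m \<le> x" "2 * x < length w" for x
    using resample_agree[of x a u w] that u a by (auto simp: agree_at_def matched_def)
  have "lip_at m ?v a"
    using la ca a mt ag[of "a - 1"] ag[of "a + m"] by (simp add: lip_at_iff)
  moreover have "\<not> lip_at m ?v t" if t: "t \<in> {c + st..<a}" for t
  proof (cases "t + m < a")
    case True
    have "lip_at m w t \<longleftrightarrow> lip_at m ?v t"
      using t True a st u by (intro lip_at_cong resample_agree) auto
    thus ?thesis using fl t by (auto simp: first_lip_def)
  next
    case False
    hence "t + m - a < m" "a + (t + m - a) = t + m" using t st by auto
    hence "matched ?v (t + m)" using mt[of "t + m - a"] by simp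
    thus ?thesis using t a st by (simp add: lip_at_iff)
  qed
  ultimately show ?thesis using fl by (auto simp: first_lip_def)
qed

text \<open>The trace left in \<open>w\<close> by a path that crosses the lip at distance a at a
  wrong time.\<close>

definition echo :: "nat \<Rightarrow> nat \<Rightarrow> word \<Rightarrow> nat \<Rightarrow> bool" where
  "echo l m w a \<longleftrightarrow> (\<exists>bw p. p \<noteq> a \<and> p \<le> a + l \<and> a \<le> p + l \<and>
     (\<forall>j<m. orient bw w ! (p + j) = orient bw w ! (a + j)))"

text \<open>Only an initial part of the cuts is listed. Its last lip is the one to be resampled
  next, so that the echoing lips can be counted one at a time.\<close>

definition echoes :: "nat \<Rightarrow> nat \<Rightarrow> nat \<Rightarrow> nat \<Rightarrow> nat \<Rightarrow> nat \<Rightarrow> nat \<Rightarrow> nat \<Rightarrow> word set" where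
  "echoes k n m st sc l i0 i = {w \<in> cyc_reduced_words k n. \<exists>cuts. length cuts = i \<and> cut_chain m st sc w cuts \<and>
     (\<forall>a\<in>set cuts. 2 * (a + l + m + 2) \<le> n) \<and> (\<forall>j. i0 \<le> j \<and> j < i \<longrightarrow> echo l m w (cuts ! j))}"

lemma cut_chain_unique:
  assumes "cut_chain m st sc w cuts" "cut_chain m st sc w cuts'" "length cuts = length cuts'" "st \<ge> 1"
    "\<forall>a\<in>set cuts. a + m < length w"
  shows "cuts = cuts'"
  using assms(3)
proof (rule nth_equalityI)
  fix j assume j: "j < length cuts"
  show "cuts ! j = cuts' ! j"
    using assms j by (intro cut_chain_prefix_unique[where w = w and w' = w and m = m and st = st and sc = sc])
      (auto simp: agree_at_def)
qed

text \<open>Even if the two occurrences overlap, every letter of the lip is traced back to one outside of it.\<close>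

lemma shift_determines:
  fixes w w' :: "nat \<Rightarrow> 'a"
  assumes p: "p \<noteq> a" "p \<le> a + l" "a \<le> p + l" "l \<le> a"
    and w: "\<And>j. j < m \<Longrightarrow> w (p + j) = w (a + j)" and w': "\<And>j. j < m \<Longrightarrow> w' (p + j) = w' (a + j)"
    and ag: "\<And>y. y < a \<or> (a + m \<le> y \<and> y < a + m + l) \<Longrightarrow> w y = w' y"
    and j: "j < m"
  shows "w (a + j) = w' (a + j)"
proof (cases "p < a")
  case True
  define s where "s = a - p"
  show ?thesis using j
  proof (induction j rule: less_induct)
    case (less j)
    have "w (p + j) = w' (p + j)"
    proof (cases "j < s")
      case True
      thus ?thesis by (intro ag) (auto simp: s_def)
    next
      case False
      hence "p + j = a + (j - s)" using True by (simp add: s_def)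
      moreover have "w (a + (j - s)) = w' (a + (j - s))" using less False True by (intro less.IH) (auto simp: s_def)
      ultimately show ?thesis by simp
    qed
    thus ?case using w[OF less.prems] w'[OF less.prems] by simp
  qed
next
  case False
  define s where "s = p - a"
  have s: "s > 0" "s \<le> l" "p = a + s" using False p by (auto simp: s_def)
  show ?thesis using j
  proof (induction "m - j" arbitrary: j rule: less_induct)
    case less
    have "w (p + j) = w' (p + j)"
    proof (cases "j + s < m")
      case True
      have "w (a + (j + s)) = w' (a + (j + s))" using s True by (intro less.hyps) auto
      thus ?thesis using s(3) by (simp add: ac_simps)
    next
      case False
      thus ?thesis using s less.prems by (intro ag) auto
    qed
    thus ?case using w[OF less.prems] w'[OF less.prems] by simp
  qed
qed

lemma matched_mirror: "matched w x \<Longrightarrow> x < length w \<Longrightarrow> inv_word w ! x = w ! x"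
  by (simp add: matched_def nth_inv_word)

text \<open>Double counting of the pairs of a word and a new label for its last lip. The label can
  be read off the resampled word, and the old lip can be restored once the place and the orientation
  of its echo are known, which makes at most 2 * (2 * l + 1) possibilities. So every word has many
  new labels, but every resampled word has few sources.\<close>

lemma card_echoes_step:
  assumes k: "k \<ge> 2" and m: "m \<ge> 2" and st: "l + m + 1 \<le> st" and i: "i0 \<le> i"
  shows "(2 * real k - 1) ^ (m - 2) * real (card (echoes k n m st sc l i0 (Suc i)))
    \<le> real (2 * (2 * l + 1)) * real (card (echoes k n m st sc l i0 i))"
proof -
  let ?A = "echoes k n m st sc l i0"
  define ok where "ok = (\<lambda>w cuts. length cuts = Suc i \<and> cut_chain m st sc w cuts \<and> (\<forall>a\<in>set cuts. 2 * (a + l + m + 2) \<le> n))"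
  \<comment> \<open>The last cut as a function of the word. Resampling does not change it, so it can
    be computed from either word.\<close>
  define pos where "pos = (\<lambda>w. last (SOME cuts. ok w cuts))"
  have ok_unique: "cuts = cuts'" if "ok w cuts" "ok w cuts'" "length w = n" for w cuts cuts'
    using that st by (intro cut_chain_unique[of m st sc w]) (auto simp: ok_def)
  have pos_eq: "pos w = last cuts" if "ok w cuts" "length w = n" for w cuts
    using ok_unique[OF _ that(1,2)] someI[of "ok w", OF that(1)] unfolding pos_def by blast
  have Suc_ok: "\<exists>cuts. ok w cuts \<and> length w = n \<and> w \<in> cyc_reduced_words k n \<and> (\<forall>j. i0 \<le> j \<and> j < Suc i \<longrightarrow> echo l m w (cuts ! j))"
    if "w \<in> ?A (Suc i)" for w
    using that crw_length unfolding echoes_def ok_def by blast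
  define P where "P = (SIGMA w:?A (Suc i). fitting_lips k m (pos w) w)"
  define F where "F = (\<lambda>(w, u). resample (pos w) u w)"
  have finA: "finite (?A j)" for j by (simp add: echoes_def)
  have finu: "finite (fitting_lips k m a w)" for a w by (simp add: fitting_lips_def)
  have facts: "\<exists>cuts. ok w cuts \<and> pos w = cuts ! i \<and> ok (resample (pos w) u w) cuts \<and> resample (pos w) u w \<in> ?A i
      \<and> pos (resample (pos w) u w) = pos w \<and> length w = n \<and> 2 * (pos w + l + m + 2) \<le> n \<and> st \<le> pos w \<and> length u = m
      \<and> echo l m w (pos w) \<and> lip_at m w (pos w)"
    if wu: "(w, u) \<in> P" for w u
  proof -
    obtain cuts where c: "ok w cuts" "length w = n" "w \<in> cyc_reduced_words k n" "\<And>j. i0 \<le> j \<Longrightarrow> j < Suc i \<Longrightarrow> echo l m w (cuts ! j)"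
      using Suc_ok[of w] wu unfolding P_def by blast
    have c': "length cuts = Suc i" "cut_chain m st sc w cuts" "\<And>j. j \<le> i \<Longrightarrow> 2 * (cuts ! j + l + m + 2) \<le> n"
      using c(1) by (auto simp: ok_def)
    have pos: "pos w = cuts ! i" using pos_eq[OF c(1,2)] c'(1) last_conv_nth[of cuts] by (cases cuts) auto
    define a where "a = cuts ! i"
    have u: "u \<in> fitting_lips k m a w" using wu pos by (simp add: P_def a_def)
    have lu: "length u = m" using u by (simp add: fitting_lips_def reduced_words_def)
    have a: "st \<le> a" "2 * (a + l + m + 2) \<le> n" using cut_chain_ge[OF c'(2), of i] c' by (auto simp: a_def)
    let ?v = "resample a u w"
    have v: "?v \<in> cyc_reduced_words k n" using a m st by (intro resample_crw[OF c(3) u]) auto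
    have before: "cuts ! j + st \<le> a" if "j < i" for j
    proof -
      have "st \<le> (i - j) * st" using that by (cases "i - j") auto
      moreover have "cuts ! j + (i - j) * st \<le> a"
        using cut_chain_mono[OF c'(2), of j i] that c'(1) unfolding a_def by simp
      ultimately show ?thesis by linarith
    qed
    have fl: "first_lip m st sc ?v ((0 # cuts) ! j) (cuts ! j)" if "j < Suc i" for j
    proof (cases "j = i")
      case True
      have "first_lip m st sc w ((0 # cuts) ! i) a" using c' by (auto simp: cut_chain_def a_def)
      from resample_first_lip[OF this lu] show ?thesis using True a m st c(2) by (simp add: a_def)
    next
      case False
      hence j: "j < i" using that by simp
      have flw: "first_lip m st sc w ((0 # cuts) ! j) (cuts ! j)"
        using c'(1,2) that unfolding cut_chain_def by metis
      show ?thesis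
      proof (rule first_lip_cong[OF _ _ _ _ flw])
        show "st \<ge> 1" using st by simp
        show "cuts ! j + m < length w" using before[OF j] a c(2) by simp
        fix x assume "x \<le> cuts ! j + m"
        hence "x < a" using before[OF j] st by simp
        moreover from this have "2 * x < length w" using a c(2) by simp
        moreover have "2 * (a + length u + 1) \<le> length w" using a c(2) lu by simp
        ultimately show "agree_at w ?v x" by (intro resample_agree) auto
      qed simp
    qed
    have okv: "ok ?v cuts" using fl c' by (auto simp: ok_def cut_chain_def all_set_conv_all_nth)
    \<comment> \<open>Earlier echoes survive: since st >= l + m + 1, both occurrences lie before the
      lip that is resampled.\<close>
    have echov: "echo l m ?v (cuts ! j)" if ij: "i0 \<le> j" "j < i" for j
    proof -
      obtain bw p where p: "p \<noteq> cuts ! j" "p \<le> cuts ! j + l" "cuts ! j \<le> p + l"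
        "\<And>j'. j' < m \<Longrightarrow> orient bw w ! (p + j') = orient bw w ! (cuts ! j + j')"
        using c(4)[of j] ij unfolding echo_def by auto
      have or: "orient bw ?v = resample a u (orient bw w)"
        using inv_word_resample[of a u w] a c(2) lu by (simp add: orient_def)
      have "resample a u (orient bw w) ! y = orient bw w ! y" if "y < a" for y
        using that a c(2) lu by (intro nth_resample_outside) (auto simp: orient_def)
      hence "orient bw ?v ! (p + j') = orient bw ?v ! (cuts ! j + j')" if "j' < m" for j'
        unfolding or using p(4)[OF that] before[OF \<open>j < i\<close>] p(2) st that by simp
      thus ?thesis unfolding echo_def using p(1-3) by blast
    qed
    have "?v \<in> ?A i"
      unfolding echoes_def
    proof (intro CollectI conjI exI[of _ "take i cuts"] v)
      show "cut_chain m st sc ?v (take i cuts)" using okv by (auto simp: ok_def intro: cut_chain_take)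
      show "\<forall>a\<in>set (take i cuts). 2 * (a + l + m + 2) \<le> n" using okv set_take_subset[of i cuts] by (auto simp: ok_def)
    qed (use echov c' in auto)
    moreover have "pos ?v = a" using pos_eq[OF okv] c(2) c'(1) pos pos_eq[OF c(1,2)] by (simp add: a_def)
    moreover have "lip_at m w a" using cut_chain_lip[OF c'(2), of i] c'(1) by (simp add: a_def)
    ultimately show ?thesis using c(1,2) okv pos a lu c(4)[of i] i unfolding a_def by auto
  qed
  have FA: "F ` P \<subseteq> ?A i" using facts by (fastforce simp: F_def)
  have fiber: "finite {x \<in> P. F x = v} \<and> real (card {x \<in> P. F x = v}) \<le> real (2 * (2 * l + 1))" if "v \<in> F ` P" for v
  proof -
    define a where "a = pos v"
    define R where "R = (\<lambda>w bw p. p \<noteq> a \<and> p \<le> a + l \<and> a \<le> p + l \<and> (\<forall>j<m. orient bw w ! (p + j) = orient bw w ! (a + j)))"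
    \<comment> \<open>Within a fibre a pair is recorded by the orientation and the place of one of
      its echoes.\<close>
    define g where "g = (\<lambda>(w, u :: word). SOME (bw, p). R w bw p)"
    have x: "resample a u w = v \<and> length w = n \<and> 2 * (a + l + m + 2) \<le> n \<and> st \<le> a \<and> length u = m \<and> lip_at m w a
        \<and> R w (fst (g (w, u))) (snd (g (w, u)))"
      if "(w, u) \<in> {x \<in> P. F x = v}" for w u
    proof -
      have wu: "(w, u) \<in> P" "F (w, u) = v" using that by auto
      obtain cuts where c: "ok w cuts" "pos (resample (pos w) u w) = pos w" "length w = n" "2 * (pos w + l + m + 2) \<le> n"
        "st \<le> pos w" "length u = m" "echo l m w (pos w)" "lip_at m w (pos w)" using facts[OF wu(1)] by blast
      have pw: "pos w = a" "resample a u w = v" using wu(2) c(2) by (auto simp: F_def a_def)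
      have "\<exists>z. case z of (bw, p) \<Rightarrow> R w bw p" using c(7) pw unfolding echo_def R_def by auto
      from someI_ex[OF this] have "R w (fst (g (w, u))) (snd (g (w, u)))" by (auto simp: g_def split: prod.splits)
      thus ?thesis using c pw by simp
    qed
    have inj: "inj_on g {x \<in> P. F x = v}"
    proof (rule inj_onI, clarify)
      fix w u w' u'
      assume "(w, u) \<in> P" "F (w', u') = F (w, u)" "(w', u') \<in> P" "v = F (w, u)" "g (w, u) = g (w', u')"
      hence gg: "g (w, u) = g (w', u')" and "(w, u) \<in> {x \<in> P. F x = v}" "(w', u') \<in> {x \<in> P. F x = v}" by auto
      note x1 = x[OF this(2)] and x2 = x[OF this(3)]
      obtain bw p where bp: "g (w, u) = (bw, p)" by (cases "g (w, u)")
      have bp': "g (w', u') = (bw, p)" using gg bp by simp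
      have "R w (fst (g (w, u))) (snd (g (w, u)))" "R w' (fst (g (w', u'))) (snd (g (w', u')))" using x1 x2 by blast+
      hence R1: "R w bw p" and R2: "R w' bw p" unfolding bp bp' by simp_all
      have n: "length w = n" "length w' = n" "length u = m" "length u' = m" "2 * (a + l + m + 2) \<le> n" "st \<le> a" using x1 x2 by auto
      have uu: "u = u'"
      proof (rule nth_equalityI)
        fix j assume "j < length u"
        hence "resample a u w ! (a + j) = u ! j" "resample a u' w' ! (a + j) = u' ! j" using n by (auto simp: nth_resample)
        thus "u ! j = u' ! j" using x1 x2 by simp
      qed (use n in simp)
      have out: "w ! y = w' ! y" if "y < n" "y < a \<or> a + m \<le> y" "y < n - a - m \<or> n - a \<le> y" for y
        using nth_resample_outside[of y w a u] nth_resample_outside[of y w' a u'] that n x1 x2 by simp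
      have oout: "orient bw w ! y = orient bw w' ! y" if "y < n" "y < a \<or> a + m \<le> y" "y < n - a - m \<or> n - a \<le> y" for y
      proof (cases bw)
        case True
        have "w ! (n - Suc y) = w' ! (n - Suc y)" using that n by (intro out) auto
        thus ?thesis using True that n by (simp add: orient_def nth_inv_word)
      qed (use out that in \<open>simp add: orient_def\<close>)
      have mw: "matched w (a + j) \<and> matched w' (a + j)" if "j < m" for j
        using x1 x2 that lip_at_iff[of a m w] lip_at_iff[of a m w'] n st by auto
      have lip: "w ! (a + j) = w' ! (a + j)" if "j < m" for j
      proof -
        have "orient bw w ! (a + j) = orient bw w' ! (a + j)"
        proof (rule shift_determines[where p = p and l = l and m = m])
          show "orient bw w ! y = orient bw w' ! y" if "y < a \<or> a + m \<le> y \<and> y < a + m + l" for y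
            using that n by (intro oout) auto
        qed (use R1 R2 that n st in \<open>auto simp: R_def\<close>)
        thus ?thesis using mw[OF that] matched_mirror n that by (cases bw) (auto simp: orient_def)
      qed
      have "w = w'"
      proof (rule nth_equalityI)
        fix y assume "y < length w"
        hence y: "y < n" using n by simp
        consider "a \<le> y" "y < a + m" | "n - a - m \<le> y" "y < n - a" | "y < a \<or> a + m \<le> y" "y < n - a - m \<or> n - a \<le> y" by linarith
        thus "w ! y = w' ! y"
        proof cases
          case 1 thus ?thesis using lip[of "y - a"] by simp
        next
          case 2
          define j where "j = n - 1 - y - a"
          have j: "j < m" "n - 1 - (a + j) = y" using 2 y n by (auto simp: j_def)
          have "inv_symbol (w ! y) = inv_symbol (w' ! y)"
            using mw[OF j(1)] lip[OF j(1)] j n unfolding matched_def by (metis diff_diff_left)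
          thus ?thesis by simp
        next
          case 3 thus ?thesis using out y by blast
        qed
      qed (use n in simp)
      thus "w = w' \<and> u = u'" using uu by simp
    qed
    have sub: "g ` {x \<in> P. F x = v} \<subseteq> UNIV \<times> {a - l..a + l}"
    proof
      fix z assume "z \<in> g ` {x \<in> P. F x = v}"
      then obtain w u where wu: "(w, u) \<in> {x \<in> P. F x = v}" "z = g (w, u)" by auto
      have "snd (g (w, u)) \<in> {a - l..a + l}" using x[OF wu(1)] by (auto simp: R_def)
      thus "z \<in> UNIV \<times> {a - l..a + l}" unfolding wu(2) by (simp only: mem_Times_iff UNIV_I simp_thms)
    qed
    have fin: "finite ((UNIV :: bool set) \<times> {a - l..a + l})" by simp
    have "l \<le> a"
    proof -
      obtain w u where "(w, u) \<in> {x \<in> P. F x = v}" using \<open>v \<in> F ` P\<close> by auto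
      from x[OF this] show ?thesis using st by simp
    qed
    hence c: "card ((UNIV :: bool set) \<times> {a - l..a + l}) = 2 * (2 * l + 1)" by (simp add: card_cartesian_product)
    show ?thesis using inj_on_finite[OF inj sub fin] card_inj_on_le[OF inj sub fin] unfolding c by (simp only: of_nat_le_iff)
  qed
  have "(2 * k - 1) ^ (m - 2) * card (?A (Suc i)) \<le> (\<Sum>w\<in>?A (Suc i). card (fitting_lips k m (pos w) w))"
    using sum_bounded_below[of "?A (Suc i)" "(2 * k - 1) ^ (m - 2)" "\<lambda>w. card (fitting_lips k m (pos w) w)"]
      card_fitting_lips[OF k m] by (simp add: mult.commute)
  also have "\<dots> = card P" unfolding P_def using finA finu by (simp add: card_SigmaI)
  finally have "real ((2 * k - 1) ^ (m - 2) * card (?A (Suc i))) \<le> real (card P)" by (simp only: of_nat_le_iff)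
  also have "\<dots> \<le> real (2 * (2 * l + 1)) * real (card (?A i))"
    by (rule card_le_fiber(2)[OF finA FA fiber]) simp_all
  finally show ?thesis using k by (simp add: of_nat_diff)
qed

lemma card_echoes_le:
  assumes k: "k \<ge> 2" and m: "m \<ge> 2" and st: "l + m + 1 \<le> st"
  shows "real (card (echoes k n m st sc l i0 (i0 + q)))
    \<le> (real (2 * (2 * l + 1)) / (2 * real k - 1) ^ (m - 2)) ^ q * real (card (cyc_reduced_words k n))"
proof (induction q)
  case 0
  have "card (echoes k n m st sc l i0 i0) \<le> card (cyc_reduced_words k n)"
    by (intro card_mono) (auto simp: echoes_def)
  thus ?case by simp
next
  case (Suc q)
  let ?T = "(2 * real k - 1) ^ (m - 2)" and ?c = "real (2 * (2 * l + 1))"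
  have T: "?T > 0" using k by simp
  have "real (card (echoes k n m st sc l i0 (Suc (i0 + q)))) \<le> ?c / ?T * real (card (echoes k n m st sc l i0 (i0 + q)))"
    using card_echoes_step[OF k m st, of i0 "i0 + q" n sc] T by (simp add: field_simps)
  also have "\<dots> \<le> ?c / ?T * ((?c / ?T) ^ q * real (card (cyc_reduced_words k n)))"
    using Suc T by (intro mult_left_mono) auto
  finally show ?case by (simp only: power_Suc add_Suc_right mult.assoc)
qed

section \<open>Long paths reading the relator itself\<close>

lemma ex_boundary_reading:
  assumes "fatgraph Y" "boundary Y = copies N B" "h \<in> hedges Y"
  shows "\<exists>v. v \<in> cyc B \<union> cyc (inv_word B) \<and> length v = card (face Y h) \<and> length v = length B \<and>
    (\<forall>j. lab Y ((bd_next Y ^^ j) h) = cnth v j)"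
  by (rule boundary_reading[OF assms]) blast

lemma immersed_path_take_drop: "immersed_path Y \<gamma> \<Longrightarrow> immersed_path Y (take a (drop b \<gamma>))"
  using set_take_subset[of a "drop b \<gamma>"] set_drop_subset[of b \<gamma>]
  by (auto simp: immersed_path_def successively_conv_nth)

lemma mod_eq_if_dvd_add:
  fixes x y z n :: nat
  assumes "n dvd x + z" "n dvd y + z" shows "x mod n = y mod n"
proof (cases "y \<le> x")
  case True
  have "n dvd x - y" using dvd_diff_nat[OF assms] by simp
  thus ?thesis using True by (simp add: mod_eq_dvd_iff_nat)
next
  case False
  have "n dvd y - x" using dvd_diff_nat[OF assms(2,1)] by simp
  hence "y mod n = x mod n" using False by (simp add: mod_eq_dvd_iff_nat)
  thus ?thesis ..
qed

lemma length_orient [simp]: "length (orient bw w) = length w"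
  by (simp add: orient_def)

lemma inv_word_orient: "inv_word (orient bw w) = orient (\<not> bw) w"
  by (simp add: orient_def)

definition reads :: "'h fatgraph \<Rightarrow> word \<Rightarrow> 'h list \<Rightarrow> nat \<Rightarrow> bool" where
  "reads Y W \<gamma> p \<longleftrightarrow> (\<forall>t<length \<gamma>. lab Y (\<gamma> ! t) = cnth W (p + t))"

text \<open>The starting position is a natural representative of - (p + length \<gamma>): the
  reversed path begins where the path has ended.\<close>

lemma reads_reverse:
  assumes Y: "fatgraph Y" "set \<gamma> \<subseteq> hedges Y" and W: "W \<noteq> []" and r: "reads Y W \<gamma> p"
  shows "reads Y (inv_word W) (reverse_path Y \<gamma>) (length W * (p + length \<gamma>) - (p + length \<gamma>))"
  unfolding reads_def
proof (intro allI impI)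
  let ?g = "length \<gamma>" and ?n = "length W"
  fix t assume "t < length (reverse_path Y \<gamma>)"
  hence t: "t < ?g" by simp
  define s where "s = ?g - Suc t"
  have s: "s < ?g" using t by (simp add: s_def)
  have "p + ?g \<le> ?n * (p + ?g)" using W by (cases ?n) simp_all
  hence eq: "Suc (?n * (p + ?g) - (p + ?g) + t + (p + s)) = ?n * (p + ?g)"
    using t unfolding s_def by linarith
  have "lab Y (reverse_path Y \<gamma> ! t) = inv_symbol (lab Y (\<gamma> ! s))"
    using t fg_lab_opp[OF Y(1) nth_in_subset[OF Y(2) s]] by (simp add: reverse_path_nth s_def)
  also have "\<dots> = inv_symbol (cnth W (p + s))" using r s by (simp add: reads_def)
  also have "\<dots> = cnth (inv_word W) (?n * (p + ?g) - (p + ?g) + t)"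
    by (rule cnth_inv_word[symmetric, OF W]) (simp only: eq dvd_triv_left)
  finally show "lab Y (reverse_path Y \<gamma> ! t) = cnth (inv_word W) (?n * (p + ?g) - (p + ?g) + t)" .
qed

text \<open>Cuts are measured from the midpoint of r_0 in both directions, so a path is compared
  with them on one half of the relator only. If the first quarter of the path crosses from one half
  to the other, the stretch starts at the crossing instead.\<close>

lemma half_window:
  fixes g n p :: nat
  assumes "g \<le> n" "p < n" "n \<ge> 4"
  obtains t0 where "t0 + g div 4 \<le> g"
    "2 * ((p + t0) mod n + g div 4) \<le> n + 1 \<or> (n \<le> 2 * ((p + t0) mod n) \<and> (p + t0) mod n + g div 4 \<le> n)"
proof -
  define h len where "h = (n + 1) div 2" and "len = g div 4"
  have len: "4 * len \<le> g" by (simp add: len_def)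
  have h: "n \<le> 2 * h" "2 * h \<le> n + 1" by (auto simp: h_def)
  consider "p + len \<le> h" | "p < h" "h < p + len" | "h \<le> p" "p + len \<le> n" | "h \<le> p" "n < p + len" by linarith
  thus thesis
  proof cases
    case 1
    have "(p + 0) mod n = p" using assms by simp
    thus thesis using that[of 0] 1 len h by (simp add: len_def[symmetric])
  next
    case 2
    have "(p + (h - p)) mod n = h" using 2 h assms by simp
    thus thesis using that[of "h - p"] 2 len h assms by (simp add: len_def[symmetric])
  next
    case 3
    have "(p + 0) mod n = p" using assms by simp
    thus thesis using that[of 0] 3 len h by (simp add: len_def[symmetric])
  next
    case 4
    have "(p + (n - p)) mod n = 0" using assms by simp
    thus thesis using that[of "n - p"] 4 len h assms by (simp add: len_def[symmetric])
  qed
qed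

text \<open>The spine of a relator without stray paths and repetitions. That it has no long run of
  echoes is assumed separately, where this is used.\<close>

locale typical_spine = joined_beads "pieces \<Phi> w cuts" "beads m w cuts" L N "length cuts" m \<mu> "lip_word m w cuts"
  for \<Phi> :: "segment \<Rightarrow> 'h fatgraph" and w :: word and cuts :: "nat list" and L N m :: nat and \<mu> +
  fixes k st sc l :: nat
  assumes w: "w \<in> cyc_reduced_words k (length w)"
    and v: "valid_cuts m st sc w cuts"
    and st: "l + m + 2 \<le> st" and l: "l \<ge> 1"
    and fY: "fatgraph Y" "folded Y" "boundary Y = copies N w"
    and nstray: "\<And>bw. w \<notin> strays k (length w) m st sc L N \<Phi> l bw"
    and nrep: "w \<notin> repeats k (length w) l" "inv_word w \<notin> repeats k (length w) l" "w \<notin> inverse_repeats k (length w) l"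
begin

abbreviation "n \<equiv> length w"
abbreviation "Ys \<equiv> \<lambda>i. pieces \<Phi> w cuts i"
abbreviation "B \<equiv> \<lambda>i. beads m w cuts i"

lemma wlet: "set w \<subseteq> letters k" using w crw_letters by blast
lemma mst: "m < st" using st by simp
lemma chain: "cut_chain m st sc w cuts" "cuts \<noteq> []" using v by (auto simp: valid_cuts_def)
lemma cut_bound: "i < length cuts \<Longrightarrow> 2 * cuts ! i + 2 * m + 2 \<le> n" using valid_cuts_bound[OF v, of i] by simp
lemma gap: "0 < i \<Longrightarrow> i < length cuts \<Longrightarrow> cuts ! (i - 1) + st \<le> cuts ! i"
  using cut_chain_gap(1)[OF chain(1), of "i - 1"] by simp
lemma wne: "w \<noteq> []" "n > 0"
proof -
  have "0 < length cuts" using chain(2) by simp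
  from cut_bound[OF this] show "n > 0" by linarith
  thus "w \<noteq> []" by simp
qed
lemma orient_ne: "orient bw w \<noteq> []" using wne by (cases bw) (auto simp: orient_def)

lemma bd_period:
  assumes "g \<in> hedges Y" shows "(bd_next Y ^^ n) g = g"
proof -
  obtain u :: word where u: "length u = card (face Y g)" "length u = length w"
    using ex_boundary_reading[OF fY(1,3) assms] by blast
  thus ?thesis using funpow_card_face[OF fY(1) assms] by simp
qed

text \<open>Every face reads \<open>w\<close> or its inverse from some place on, and in the absence
  of repetitions l letters determine the place and the direction.\<close>

lemma face_reads_unique:
  assumes g: "g \<in> hedges Y" and x: "x < n"
    and r: "\<And>j. j < l \<Longrightarrow> lab Y ((bd_next Y ^^ j) g) = cnth (orient bw w) (x + j)"
  shows "lab Y ((bd_next Y ^^ j) g) = cnth (orient bw w) (x + j)"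
proof -
  obtain u where u: "u \<in> cyc w \<union> cyc (inv_word w)" "\<And>j. lab Y ((bd_next Y ^^ j) g) = cnth u j"
    using ex_boundary_reading[OF fY(1,3) g] by blast
  obtain b' y where y: "y < n" "u = rotate y (orient b' w)"
  proof -
    have iw: "inv_word w \<noteq> []" using wne by simp
    show thesis
      using u(1) that[of _ False] that[of _ True] cyc_iff_less[OF wne(1), of u] cyc_iff_less[OF iw, of u]
      by (auto simp: orient_def)
  qed
  have lab: "lab Y ((bd_next Y ^^ j) g) = cnth (orient b' w) (y + j)" for j
    using u(2) y(2) cnth_rotate[OF orient_ne] by simp
  have e: "cnth (orient bw w) (x + j) = cnth (orient b' w) (y + j)" if "j < l" for j using r[OF that] lab by simp
  have iw: "inv_word w \<in> cyc_reduced_words k n" by (rule crw_inv_word[OF w])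
  have "b' = bw \<and> x = y"
  proof (rule ccontr)
    assume c: "\<not> (b' = bw \<and> x = y)"
    consider "b' = bw" "x \<noteq> y" | "bw = False" "b' = True" | "bw = True" "b' = False" using c by (cases bw; cases b'; auto)
    thus False
    proof cases
      case 1
      hence "orient bw w \<in> repeats k n l"
        unfolding repeats_def using e x y w iw by (auto simp: orient_def split: if_splits)
      thus False using nrep by (auto simp: orient_def split: if_splits)
    next
      case 2
      hence "w \<in> inverse_repeats k n l" unfolding inverse_repeats_def using e x y w by (auto simp: orient_def)
      thus False using nrep by simp
    next
      case 3
      hence "\<forall>j<l. cnth w (y + j) = cnth (inv_word w) (x + j)" using e by (auto simp: orient_def)
      hence "w \<in> inverse_repeats k n l" unfolding inverse_repeats_def using x y w by auto
      thus False using nrep by simp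
    qed
  qed
  thus ?thesis using lab by simp
qed

text \<open>At its \<open>Tag True\<close>, a middle bead jumps from the letter before the cut b to
  the letter n - b on the way back.\<close>

lemma bead_nth:
  assumes i: "0 < i" "i < length cuts"
  defines "b \<equiv> cuts ! i" and "g \<equiv> cuts ! i - cuts ! (i - 1) - m"
  shows "length (B i) = 2 * g + 2" "g \<ge> l + 2"
    and "\<And>j. j < length (B i) \<Longrightarrow> B i ! j = Tag True \<longleftrightarrow> j = g + 1"
    and "\<And>j. 1 \<le> j \<Longrightarrow> j \<le> g \<Longrightarrow> B i ! (g + 1 + j) = w ! (n - b + j - 1)"
    and "\<And>j. 1 \<le> j \<Longrightarrow> j \<le> g \<Longrightarrow> B i ! (g + 1 - j) = w ! (b - j)"
proof -
  define a where "a = cuts ! (i - 1)"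
  note mb = middle_bead[OF v mst wlet i, folded a_def b_def]
  have g: "g = b - a - m" by (simp add: g_def a_def b_def)
  have ab: "a + st \<le> b" using gap[OF i] by (simp add: a_def b_def)
  have bn: "2 * b + 2 * m + 2 \<le> n" using cut_bound[OF i(2)] by (simp add: b_def)
  show gl: "g \<ge> l + 2" using ab st by (simp add: g)
  define X Z where "X = slice w (a + m) b" and "Z = slice w (n - b) (n - a - m)"
  have XZ: "length X = g" "length Z = g" using mb(4,5) by (auto simp: X_def Z_def g)
  have Bi: "B i = Tag False # X @ Tag True # Z" using mb(1) by (simp add: X_def Z_def)
  show len: "length (B i) = 2 * g + 2" using Bi XZ by simp
  have Xn: "X ! j = w ! (a + m + j)" if "j < g" for j using that bn ab by (simp add: X_def nth_slice g)
  have Zn: "Z ! j = w ! (n - b + j)" if "j < g" for j using that bn ab by (simp add: Z_def nth_slice g)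
  have wn: "w ! y \<noteq> Tag t" if "y < n" for y t using wlet that letters_not_Tag nth_mem by blast
  show "B i ! j = Tag True \<longleftrightarrow> j = g + 1" if "j < length (B i)" for j
  proof -
    consider "j = 0" | j' where "j = Suc j'" "j' < g" | "j = g + 1" | j' where "j = g + 2 + j'" "j' < g"
    proof -
      have "j = 0 \<or> (j = Suc (j - 1) \<and> j - 1 < g) \<or> j = g + 1 \<or> (j = g + 2 + (j - g - 2) \<and> j - g - 2 < g)"
        using \<open>j < length (B i)\<close> len by linarith
      thus thesis using that by blast
    qed
    thus ?thesis
    proof cases
      case 1 thus ?thesis by (simp add: Bi)
    next
      case 2
      have "X ! j' \<noteq> Tag True" using Xn[OF 2(2)] wn[of "a + m + j'"] 2(2) bn ab by (simp add: g)
      thus ?thesis using 2 XZ by (simp add: Bi nth_append)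
    next
      case 3 thus ?thesis using XZ by (simp add: Bi nth_append)
    next
      case 4
      have "Z ! j' \<noteq> Tag True" using Zn[OF 4(2)] wn[of "n - b + j'"] 4(2) bn ab by (simp add: g)
      thus ?thesis using 4 XZ by (simp add: Bi nth_append)
    qed
  qed
  show "B i ! (g + 1 + j) = w ! (n - b + j - 1)" if "1 \<le> j" "j \<le> g" for j
  proof -
    obtain j' where j': "j = Suc j'" using \<open>1 \<le> j\<close> by (cases j) auto
    have "B i ! (g + 1 + j) = Z ! j'" using XZ j' by (simp add: Bi nth_append)
    thus ?thesis using Zn[of j'] that j' by simp
  qed
  show "B i ! (g + 1 - j) = w ! (b - j)" if "1 \<le> j" "j \<le> g" for j
  proof -
    define j' where "j' = g - j"
    have j': "g + 1 - j = Suc j'" "j' < g" "a + m + j' = b - j" using that ab st by (auto simp: j'_def g)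
    have "B i ! (g + 1 - j) = X ! j'" using XZ j' by (simp add: Bi nth_append)
    thus ?thesis using Xn[OF j'(2)] j'(3) by simp
  qed
qed

lemma nth_orient_mirror: "y < n \<Longrightarrow> orient True w ! y = inv_symbol (w ! (n - 1 - y))"
  by (simp add: orient_def nth_inv_word)

text \<open>The two values of the flag belong to the copies of the bead and of its inverse. As F is
  the length of the face, going j steps back is going F - j steps on.\<close>

lemma tag_neighbourhood:
  assumes i: "0 < i" "i < length cuts" and h: "h \<in> tags (Ys i)" "lab (Ys i) h = Tag True"
  shows "\<exists>bw F. (bd_next (Ys i) ^^ F) h = h \<and> l < F \<and> (\<forall>j. 1 \<le> j \<longrightarrow> j \<le> l + 1 \<longrightarrow>
    lab (Ys i) ((bd_next (Ys i) ^^ j) h) = orient bw w ! (n - cuts ! i + j - 1) \<and>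
    lab (Ys i) ((bd_next (Ys i) ^^ (F - j)) h) = orient bw w ! (cuts ! i - j))"
proof -
  define b g where "b = cuts ! i" and "g = cuts ! i - cuts ! (i - 1) - m"
  note bn = bead_nth[OF i, folded b_def g_def]
  let ?F = "length (B i)"
  have iM: "i \<le> length cuts" using i by simp
  have hh: "h \<in> hedges (Ys i)" using subsetD[OF tags_subset h(1)] .
  have bnd: "2 * b + 2 * m + 2 \<le> n" using cut_bound[OF i(2)] by (simp add: b_def)
  have "0 < b" "g \<le> b" using gap[OF i] st by (auto simp: b_def g_def)
  moreover have "g + m \<le> b" using gap[OF i] st by (simp add: b_def g_def)
  moreover note m
  ultimately have "g < b" by linarith
  note bnd = bnd this
  have Bne: "B i \<noteq> []" using bn(1) by auto
  obtain u where u: "u \<in> cyc (B i) \<union> cyc (inv_word (B i))" "length u = card (face (Ys i) h)"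
    "\<And>j. lab (Ys i) ((bd_next (Ys i) ^^ j) h) = cnth u j" "length u = ?F"
    using ex_boundary_reading[OF fgi[OF iM] bdi[OF iM] hh] by blast
  have per: "(bd_next (Ys i) ^^ ?F) h = h" using funpow_card_face[OF fgi[OF iM] hh] u(2,4) by simp
  have u0: "cnth u 0 = Tag True" using u(3)[of 0] h(2) by simp
  have g1: "cnth (B i) c = Tag True \<Longrightarrow> c mod ?F = g + 1" for c
    using bn(3)[of "c mod ?F"] Bne by (simp add: cnth_def)
  have Bn: "cnth (B i) (g + 1 + j) = w ! (n - b + j - 1)" "cnth (B i) (g + 1 - j) = w ! (b - j)" if "1 \<le> j" "j \<le> l + 1" for j
    using bn that by (auto simp: cnth_nth)
  have orF: "orient False w = w" by (simp add: orient_def)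
  from u(1) show ?thesis
  proof
    assume "u \<in> cyc (B i)"
    then obtain x where x: "u = rotate x (B i)" by (auto simp: cyc_iff)
    have ux: "cnth u j = cnth (B i) (x + j)" for j unfolding x by (rule cnth_rotate[OF Bne])
    have xg: "x mod ?F = g + 1" using g1[of x] ux[of 0] u0 by simp
    have "cnth u j = w ! (n - b + j - 1) \<and> cnth u (?F - j) = w ! (b - j)" if j: "1 \<le> j" "j \<le> l + 1" for j
    proof -
      have "(x + j) mod ?F = (g + 1 + j) mod ?F" using xg by (metis mod_add_left_eq)
      hence 1: "cnth u j = cnth (B i) (g + 1 + j)" unfolding ux by (rule cnth_cong)
      have "(x + (?F - j)) mod ?F = (g + 1 + (?F - j)) mod ?F" using xg by (metis mod_add_left_eq)
      also have "g + 1 + (?F - j) = (g + 1 - j) + ?F" using j bn(1,2) by simp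
      finally have "(x + (?F - j)) mod ?F = (g + 1 - j) mod ?F" by (simp only: mod_add_self2)
      hence 2: "cnth u (?F - j) = cnth (B i) (g + 1 - j)" unfolding ux by (rule cnth_cong)
      show ?thesis using 1 2 Bn[OF j] by simp
    qed
    thus ?thesis using per bn(1,2) u(3) orF by (intro exI[of _ False] exI[of _ ?F]) (auto simp: b_def)
  next
    assume "u \<in> cyc (inv_word (B i))"
    then obtain x where x: "u = rotate x (inv_word (B i))" by (auto simp: cyc_iff)
    have ux: "cnth u j = cnth (inv_word (B i)) (x + j)" for j unfolding x by (rule cnth_rotate) (use Bne in simp)
    define c0 where "c0 = ?F * Suc x - Suc x"
    have "Suc x \<le> ?F * Suc x" using Bne by (cases ?F) simp_all
    hence c0: "Suc (x + c0) = ?F * Suc x" by (simp add: c0_def)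
    have "cnth (inv_word (B i)) x = inv_symbol (cnth (B i) c0)"
      using c0 by (intro cnth_inv_word[OF Bne]) simp
    hence "cnth (B i) c0 = Tag True" using ux[of 0] u0 by (metis add_0_right inv_symbol_eq_Tag)
    hence c0g: "c0 mod ?F = g + 1" by (rule g1)
    have dv: "?F dvd Suc (x + (g + 1))"
    proof -
      have "(Suc x + c0 mod ?F) mod ?F = (Suc x + c0) mod ?F" by (rule mod_add_right_eq)
      also have "\<dots> = 0" using c0 by simp
      finally show ?thesis unfolding c0g by (simp add: dvd_eq_mod_eq_0)
    qed
    have "cnth u j = orient True w ! (n - b + j - 1) \<and> cnth u (?F - j) = orient True w ! (b - j)" if j: "1 \<le> j" "j \<le> l + 1" for j
    proof -
      have "cnth u j = inv_symbol (cnth (B i) (g + 1 - j))" unfolding ux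
      proof (rule cnth_inv_word[OF Bne])
        have "Suc (x + j + (g + 1 - j)) = Suc (x + (g + 1))" using j bn(2) by simp
        thus "?F dvd Suc (x + j + (g + 1 - j))" using dv by simp
      qed
      moreover have "cnth u (?F - j) = inv_symbol (cnth (B i) (g + 1 + j))" unfolding ux
      proof (rule cnth_inv_word[OF Bne])
        have "Suc (x + (?F - j) + (g + 1 + j)) = Suc (x + (g + 1)) + ?F" using j bn(1,2) by simp
        thus "?F dvd Suc (x + (?F - j) + (g + 1 + j))" using dv by (simp only: dvd_add_triv_right_iff)
      qed
      moreover have "orient True w ! (n - b + j - 1) = inv_symbol (w ! (b - j))"
        using nth_orient_mirror[of "n - b + j - 1"] j bnd bn(2) by simp
      moreover have "orient True w ! (b - j) = inv_symbol (w ! (n - b + j - 1))"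
        using nth_orient_mirror[of "b - j"] j bnd bn(2) by simp
      ultimately show ?thesis using Bn[OF j] by simp
    qed
    thus ?thesis using per bn(1,2) u(3) by (intro exI[of _ True] exI[of _ ?F]) (auto simp: b_def)
  qed
qed

lemma bd_next_Y_nontag:
  assumes "i \<le> length cuts" "x \<in> hedges (Ys i)" "x \<notin> tags (Ys i)"
  shows "bd_next Y ((i, x), 0) = ((i, bd_next (Ys i) x), 0)"
  using opp_Y[OF assms(1), of x 0] assms(3) by (simp add: bd_next_def nxt_Y_0)

lemma piece_walk_in_Y:
  assumes i: "i \<le> length cuts" and x: "x \<in> hedges (Ys i)"
    and nt: "\<And>s. s < j \<Longrightarrow> (bd_next (Ys i) ^^ s) x \<notin> tags (Ys i)"
  shows "(bd_next Y ^^ j) ((i, x), 0) = ((i, (bd_next (Ys i) ^^ j) x), 0)"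
  using nt
proof (induction j)
  case (Suc j)
  hence "(bd_next Y ^^ j) ((i, x), 0) = ((i, (bd_next (Ys i) ^^ j) x), 0)" by simp
  thus ?case using bd_next_Y_nontag[OF i funpow_bd_next_in[OF fgi[OF i] x, of j]] Suc.prems[of j] by simp
qed simp

text \<open>The letters read are generators, so no tag is met, and the face of the piece is followed
  in the spine as well.\<close>

lemma piece_reads_in_Y:
  assumes i: "i \<le> length cuts" and x: "x \<in> hedges (Ys i)"
    and r: "\<And>s. s < l \<Longrightarrow> \<exists>y<n. lab (Ys i) ((bd_next (Ys i) ^^ s) x) = orient bw w ! y"
  shows "j \<le> l \<Longrightarrow> (bd_next Y ^^ j) ((i, x), 0) = ((i, (bd_next (Ys i) ^^ j) x), 0)"
    and "j < l \<Longrightarrow> lab Y ((bd_next Y ^^ j) ((i, x), 0)) = lab (Ys i) ((bd_next (Ys i) ^^ j) x)"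
    and "((i, x), 0) \<in> hedges Y"
proof -
  have nt: "(bd_next (Ys i) ^^ s) x \<notin> tags (Ys i)" if s: "s < l" for s
  proof
    assume "(bd_next (Ys i) ^^ s) x \<in> tags (Ys i)"
    then obtain b where b: "lab (Ys i) ((bd_next (Ys i) ^^ s) x) = Tag b" using tagD[OF i] by blast
    obtain y where y: "y < n" "lab (Ys i) ((bd_next (Ys i) ^^ s) x) = orient bw w ! y" using r[OF s] by blast
    have "set (orient bw w) \<subseteq> letters k" using wlet by (auto simp: orient_def)
    hence "orient bw w ! y \<in> letters k" using y(1) by (intro nth_in_subset) auto
    thus False using letters_not_Tag b y(2) by metis
  qed
  show "(bd_next Y ^^ j) ((i, x), 0) = ((i, (bd_next (Ys i) ^^ j) x), 0)" if "j \<le> l" for j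
    using that nt by (intro piece_walk_in_Y[OF i x]) auto
  thus "lab Y ((bd_next Y ^^ j) ((i, x), 0)) = lab (Ys i) ((bd_next (Ys i) ^^ j) x)" if "j < l" for j
    using that nt[OF that] lab_Y[OF i] by simp
  show "((i, x), 0) \<in> hedges Y" using nt[of 0] l i x by (simp add: hedges_Y)
qed

text \<open>The l letters of the piece next to the lip determine what the face of the spine that
  runs there reads. This face and the path, or its reverse, then read the same word and share an
  edge, so by foldedness they never part.\<close>

lemma sync_in_boundary:
  assumes \<beta>: "immersed_path Y \<beta>" "reads Y (orient bw w) \<beta> p" and t: "t < length \<beta>"
    and e: "\<beta> ! t = ((i, h), 0)" and i: "0 < i" "i < length cuts" and h: "h \<in> tags (Ys i)" "lab (Ys i) h = Tag True"
    and pos: "(p + t) mod n = cuts ! i"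
  shows "in_boundary Y \<beta>"
proof -
  have iM: "i \<le> length cuts" using i by simp
  have hh: "h \<in> hedges (Ys i)" using subsetD[OF tags_subset h(1)] .
  define b where "b = cuts ! i"
  have bnd: "2 * b + 2 * m + 2 \<le> n" "l < b"
    using cut_bound[OF i(2)] gap[OF i] st by (auto simp: b_def)
  obtain b' F where nb: "(bd_next (Ys i) ^^ F) h = h" "l < F"
    "\<And>j. 1 \<le> j \<Longrightarrow> j \<le> l + 1 \<Longrightarrow> lab (Ys i) ((bd_next (Ys i) ^^ j) h) = orient b' w ! (n - b + j - 1)"
    "\<And>j. 1 \<le> j \<Longrightarrow> j \<le> l + 1 \<Longrightarrow> lab (Ys i) ((bd_next (Ys i) ^^ (F - j)) h) = orient b' w ! (b - j)"
    using tag_neighbourhood[OF i h] unfolding b_def by blast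
  have s\<beta>: "set \<beta> \<subseteq> hedges Y" using \<beta>(1) by (auto simp: immersed_path_def)
  have eY: "((i, h), 0) \<in> hedges Y" using nth_in_subset[OF s\<beta> t] e by simp
  \<comment> \<open>If the copy of the bead at the tag has the orientation of the path, the l
    letters before the tag lead onto the lip. Otherwise the l letters after the tag are used, for
    the reversed path.\<close>
  show ?thesis
  proof (cases "b' = bw")
    case True
    define x where "x = (bd_next (Ys i) ^^ (F - l)) h"
    have x: "x \<in> hedges (Ys i)" unfolding x_def by (rule funpow_bd_next_in[OF fgi[OF iM] hh])
    have xs: "(bd_next (Ys i) ^^ s) x = (bd_next (Ys i) ^^ (F - (l - s))) h" if "s \<le> l" for s
    proof -
      have "F - (l - s) = s + (F - l)" using that nb(2) by simp
      thus ?thesis by (simp add: x_def funpow_add)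
    qed
    have xl: "lab (Ys i) ((bd_next (Ys i) ^^ s) x) = orient bw w ! (b - l + s)" if "s < l" for s
    proof -
      have "b - (l - s) = b - l + s" using that bnd by simp
      thus ?thesis using xs[of s] nb(4)[of "l - s"] that True by simp
    qed
    have "\<exists>y<n. lab (Ys i) ((bd_next (Ys i) ^^ s) x) = orient bw w ! y" if "s < l" for s
      using xl[OF that] that bnd by (intro exI[of _ "b - l + s"]) auto
    note pr = piece_reads_in_Y[OF iM x this]
    have "lab Y ((bd_next Y ^^ j) ((i, x), 0)) = cnth (orient bw w) (b - l + j)" for j
    proof (rule face_reads_unique[OF pr(3)])
      show "b - l < n" using bnd by simp
      show "lab Y ((bd_next Y ^^ j) ((i, x), 0)) = cnth (orient bw w) (b - l + j)" if "j < l" for j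
        using pr(2)[OF _ that] xl[OF that] that bnd by (simp add: cnth_nth)
    qed
    moreover have "(bd_next Y ^^ l) ((i, x), 0) = ((i, h), 0)"
      using pr(1)[OF _ order.refl] xs[of l] nb(1) by simp
    ultimately have lab2: "lab Y ((bd_next Y ^^ j) ((i, h), 0)) = cnth (orient bw w) (b + j)" for j
    proof -
      have "(bd_next Y ^^ j) ((i, h), 0) = (bd_next Y ^^ (j + l)) ((i, x), 0)"
        using \<open>(bd_next Y ^^ l) ((i, x), 0) = ((i, h), 0)\<close> by (simp add: funpow_add)
      moreover have "b - l + (j + l) = b + j" using bnd by simp
      ultimately show ?thesis using \<open>\<And>j. lab Y ((bd_next Y ^^ j) ((i, x), 0)) = cnth (orient bw w) (b - l + j)\<close> by metis
    qed
    have "boundary_path Y \<beta>"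
    proof (rule folded_path_in_face[OF fY(1,2) \<beta>(1) t orient_ne])
      show "(bd_next Y ^^ length (orient bw w)) (\<beta> ! t) = \<beta> ! t" using bd_period[OF eY] e by simp
      show "lab Y (\<beta> ! s) = cnth (orient bw w) (p + s)" if "s < length \<beta>" for s using \<beta>(2) that by (simp add: reads_def)
      show "lab Y ((bd_next Y ^^ j) (\<beta> ! t)) = cnth (orient bw w) (p + t + j)" for j
      proof -
        have "(b + j) mod n = (p + t + j) mod n" using pos unfolding b_def by (metis mod_add_left_eq)
        hence "cnth (orient bw w) (b + j) = cnth (orient bw w) (p + t + j)" by (intro cnth_cong) simp
        thus ?thesis using lab2 e by simp
      qed
    qed
    thus ?thesis by (simp add: in_boundary_def)
  next
    case False
    hence b': "b' = (\<not> bw)" by auto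
    define W where "W = orient b' w"
    have Wi: "inv_word (orient bw w) = W" by (simp add: W_def b' inv_word_orient)
    define x where "x = bd_next (Ys i) h"
    have x: "x \<in> hedges (Ys i)" unfolding x_def by (rule fg_bd_next[OF fgi[OF iM] hh])
    have xs: "(bd_next (Ys i) ^^ s) x = (bd_next (Ys i) ^^ Suc s) h" for s by (simp add: x_def funpow_swap1)
    have xl: "lab (Ys i) ((bd_next (Ys i) ^^ s) x) = W ! (n - b + s)" if "s < l" for s
      using nb(3)[of "Suc s"] xs[of s] that by (simp add: W_def)
    have "\<exists>y<n. lab (Ys i) ((bd_next (Ys i) ^^ s) x) = orient b' w ! y" if "s < l" for s
      using xl[OF that] that bnd by (intro exI[of _ "n - b + s"]) (auto simp: W_def)
    note pr = piece_reads_in_Y[OF iM x this]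
    have lab2: "lab Y ((bd_next Y ^^ j) ((i, x), 0)) = cnth W (n - b + j)" for j
      unfolding W_def
    proof (rule face_reads_unique[OF pr(3)])
      show "n - b < n" using bnd by simp
      show "lab Y ((bd_next Y ^^ j) ((i, x), 0)) = cnth (orient b' w) (n - b + j)" if "j < l" for j
        using pr(2)[OF _ that] xl[OF that] that bnd by (simp add: cnth_nth W_def)
    qed
    define o' where "o' = opp Y ((i, h), 0)"
    have o': "o' \<in> hedges Y" unfolding o'_def by (rule fg_opp[OF fY(1) eY])
    have bo: "bd_next Y o' = ((i, x), 0)"
      using fg_opp_opp[OF fY(1) eY] opp_tag[OF h(1)] by (simp add: bd_next_def o'_def x_def nxt_Y_0)
    \<comment> \<open>By periodicity, n - 1 steps forward are one step back.\<close>
    define f where "f = (bd_next Y ^^ (n - 1)) ((i, x), 0)"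
    have f: "f \<in> hedges Y" unfolding f_def by (rule funpow_bd_next_in[OF fY(1) pr(3)])
    have "bd_next Y f = (bd_next Y ^^ Suc (n - 1)) ((i, x), 0)" by (simp add: f_def)
    also have "\<dots> = ((i, x), 0)" using bd_period[OF pr(3)] wne by simp
    finally have fo: "f = o'"
      using bo fg_bij_bd[OF fY(1)] f o' unfolding bij_betw_def inj_on_def by metis
    have labo: "lab Y ((bd_next Y ^^ j) o') = cnth W (n - b + (j + (n - 1)))" for j
      using lab2[of "j + (n - 1)"] unfolding fo[symmetric] f_def by (simp add: funpow_add)
    let ?R = "reverse_path Y \<beta>" and ?g = "length \<beta>"
    define p' where "p' = n * (p + ?g) - (p + ?g)"
    have rd: "reads Y W ?R p'"
      using reads_reverse[OF fY(1) s\<beta> orient_ne \<beta>(2)] unfolding Wi p'_def by simp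
    define T where "T = ?g - Suc t"
    have T: "T < length ?R" using t by (simp add: T_def)
    have RT: "?R ! T = o'" using t e by (simp add: reverse_path_nth T_def o'_def Suc_diff_Suc)
    have "boundary_path Y ?R"
    proof (rule folded_path_in_face[OF fY(1,2) immersed_path_reverse[OF fY(1) \<beta>(1)] T])
      show "W \<noteq> []" unfolding W_def by (rule orient_ne)
      show "(bd_next Y ^^ length W) (?R ! T) = ?R ! T" using bd_period[OF o'] RT by (simp add: W_def)
      show "lab Y (?R ! s) = cnth W (p' + s)" if "s < length ?R" for s using rd that by (simp add: reads_def)
      show "lab Y ((bd_next Y ^^ j) (?R ! T)) = cnth W (p' + T + j)" for j
      proof -
        have le: "p + ?g \<le> n * (p + ?g)" using wne by (cases n) simp_all
        have "(n - b + (n - 1)) mod n = (p' + T) mod n"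
        proof (rule mod_eq_if_dvd_add)
          have "p' + T + (p + t + 1) = n * (p + ?g)" using le t unfolding p'_def T_def by linarith
          thus "n dvd p' + T + (p + t + 1)" by simp
          have eq: "n - b + (n - 1) + (p + t + 1) = (n - b) + (p + t) + n" using wne by simp
          have "((n - b) + (p + t)) mod n = ((n - b) + b) mod n" using pos unfolding b_def by (metis mod_add_right_eq)
          also have "(n - b) + b = n" using bnd by simp
          finally have "n dvd (n - b) + (p + t)" by (simp only: mod_self dvd_eq_mod_eq_0)
          thus "n dvd n - b + (n - 1) + (p + t + 1)" unfolding eq by (rule dvd_add) simp
        qed
        hence "(n - b + (n - 1) + j) mod n = (p' + T + j) mod n" by (metis mod_add_left_eq)
        hence "cnth W (n - b + (n - 1) + j) = cnth W (p' + T + j)" by (intro cnth_cong) (simp only: W_def length_orient)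
        moreover have "n - b + (j + (n - 1)) = n - b + (n - 1) + j" by (simp only: ac_simps)
        ultimately have "cnth W (n - b + (j + (n - 1))) = cnth W (p' + T + j)" by (simp only:)
        thus ?thesis using labo RT by simp
      qed
    qed
    thus ?thesis by (simp add: in_boundary_def)
  qed
qed

text \<open>A path that avoided the bead i for the whole window would make \<open>w\<close> a member
  of \<open>strays\<close>.\<close>

lemma window_visits:
  assumes \<beta>: "immersed_path Y \<beta>" "reads Y (orient bw w) \<beta> p" and i: "1 \<le> i" "i < length cuts"
    and t: "t + l \<le> length \<beta>" "(p + t) mod n = x"
    and x: "cuts ! (i - 1) + m + 1 \<le> x" "x + l + 1 \<le> cuts ! i"
  obtains s h where "t \<le> s" "s < t + l" "state_of (\<beta> ! s) = Edge i h"
proof -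
  note thesisI = that
  show thesis
  proof (rule ccontr)
  assume "\<not> thesis"
  hence no: "state_of (\<beta> ! s) \<noteq> Edge i h" if "t \<le> s" "s < t + l" for s h
    using thesisI[OF that] by blast
  define \<eta> where "\<eta> = take l (drop t \<beta>)"
  have len: "length \<eta> = l" using t by (simp add: \<eta>_def)
  have im: "immersed_path Y \<eta>" unfolding \<eta>_def by (rule immersed_path_take_drop[OF \<beta>(1)])
  have bnd: "2 * cuts ! i + 2 * m + 2 \<le> n" by (rule cut_bound[OF i(2)])
  have "map (lab Y) \<eta> \<in> walk_words Ys ({..length cuts} - {i}) (length cuts) m (lip_fun m w cuts) (length \<eta>)"
  proof (rule path_walk[OF im])
    fix e i' h assume e: "e \<in> set \<eta>" "state_of e = Edge i' h"
    then obtain s where s: "s < l" "e = \<beta> ! (t + s)" using len t by (auto simp: in_set_conv_nth \<eta>_def)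
    have "i' \<noteq> i" using no[of "t + s"] s e by auto
    moreover have "i' \<le> length cuts"
    proof -
      have "e \<in> hedges Y" using im e by (auto simp: immersed_path_def)
      thus ?thesis using e(2) by (cases e) (auto simp: hedges_Y split: symbol.splits)
    qed
    ultimately show "i' \<in> {..length cuts} - {i}" by simp
  qed (auto simp: lip_fun_def)
  moreover have "map (lab Y) \<eta> = slice (orient bw w) x (x + l)"
  proof (rule nth_equalityI)
    show "length (map (lab Y) \<eta>) = length (slice (orient bw w) x (x + l))"
      using len x bnd by (simp add: length_slice)
    fix s assume "s < length (map (lab Y) \<eta>)"
    hence s: "s < l" using len by simp
    have "map (lab Y) \<eta> ! s = cnth (orient bw w) (p + (t + s))"
      using \<beta>(2) s t(1) len by (simp add: \<eta>_def reads_def)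
    also have "\<dots> = cnth (orient bw w) (x + s)"
    proof (rule cnth_cong)
      have "(p + t + s) mod n = (x + s) mod n" using t(2) by (metis mod_add_left_eq)
      thus "(p + (t + s)) mod length (orient bw w) = (x + s) mod length (orient bw w)" by (simp add: add.assoc)
    qed
    also have "\<dots> = slice (orient bw w) x (x + l) ! s" using s x bnd by (simp add: cnth_nth nth_slice)
    finally show "map (lab Y) \<eta> ! s = slice (orient bw w) x (x + l) ! s" .
  qed
  moreover have "pieces_good L N \<Phi> m w cuts" using good by (simp add: pieces_good_def)
  ultimately have "w \<in> strays k n m st sc L N \<Phi> l bw"
    unfolding strays_def bead_words_def using w v i x len by auto
  thus False using nstray by blast
  qed
qed

text \<open>Windows of length l right before and right after the lip show the path in the bead i and
  then in the bead i + 1. So it crosses a lip between them, starting at most l letters too early or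
  too late, and at any wrong time its reading is an echo.\<close>

lemma lip_passed:
  assumes \<beta>: "immersed_path Y \<beta>" "reads Y (orient bw w) \<beta> p"
    and t0: "(p + t0) mod n = x0" "t0 + len \<le> length \<beta>"
    and i: "1 \<le> i" "Suc i < length cuts" and c: "x0 + l + 1 \<le> cuts ! i" "cuts ! i + m + 1 + l \<le> x0 + len"
  shows "in_boundary Y \<beta> \<or> echo l m w (cuts ! i)"
proof -
  define c where "c = cuts ! i"
  have bnd: "2 * cuts ! Suc i + 2 * m + 2 \<le> n" by (rule cut_bound[OF i(2)])
  have gaps: "cuts ! (i - 1) + st \<le> c" "c + st \<le> cuts ! Suc i" using gap[of i] gap[of "Suc i"] i by (auto simp: c_def)
  have pos: "(p + (t0 + (y - x0))) mod n = y" if "x0 \<le> y" "y < n" for y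
  proof -
    have "(p + (t0 + (y - x0))) mod n = (x0 + (y - x0)) mod n"
      using t0(1) by (metis add.assoc mod_add_left_eq)
    thus ?thesis using that by simp
  qed
  obtain t1 h1 where t1: "t0 + (c - l - 1 - x0) \<le> t1" "t1 < t0 + (c - l - 1 - x0) + l" "state_of (\<beta> ! t1) = Edge i h1"
  proof (rule window_visits[OF \<beta> i(1), of "t0 + (c - l - 1 - x0)" "c - l - 1"])
    show "t0 + (c - l - 1 - x0) + l \<le> length \<beta>" using t0(2) c by (simp add: c_def)
    show "(p + (t0 + (c - l - 1 - x0))) mod n = c - l - 1" using c gaps bnd by (intro pos) (auto simp: c_def)
    show "cuts ! (i - 1) + m + 1 \<le> c - l - 1" using gaps st by simp
    show "c - l - 1 + l + 1 \<le> cuts ! i" using gaps st by (simp add: c_def)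
  qed (use i that in auto)
  obtain t2 h2 where t2: "t0 + (c + m + 1 - x0) \<le> t2" "t2 < t0 + (c + m + 1 - x0) + l" "state_of (\<beta> ! t2) = Edge (Suc i) h2"
  proof (rule window_visits[OF \<beta>, of "Suc i" "t0 + (c + m + 1 - x0)" "c + m + 1"])
    show "t0 + (c + m + 1 - x0) + l \<le> length \<beta>" using t0(2) c by (simp add: c_def)
    show "(p + (t0 + (c + m + 1 - x0))) mod n = c + m + 1" using c gaps bnd st by (intro pos) (auto simp: c_def)
    show "cuts ! (Suc i - 1) + m + 1 \<le> c + m + 1" by (simp add: c_def)
    show "c + m + 1 + l + 1 \<le> cuts ! Suc i" using gaps st by simp
  qed (use i that in auto)
  have t12: "t1 < t2" using t1(2) t2(1) c by (simp add: c_def)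
  have t2l: "t2 < length \<beta>" using t2(2) t0(2) c by (simp add: c_def)
  have "\<exists>t h. t1 < t \<and> t + m \<le> t2 \<and> i \<le> length cuts \<and> h \<in> tags (Ys i) \<and> lab (Ys i) h = Tag True \<and>
    (\<forall>j<m. \<beta> ! (t + j) = ((i, h), j))"
    by (rule crossing[OF \<beta>(1) t12 t2l t1(3) t2(3)]) blast
  then obtain t h where th: "t1 < t" "t + m \<le> t2" "i \<le> length cuts" "h \<in> tags (Ys i)" "lab (Ys i) h = Tag True"
    "\<And>j. j < m \<Longrightarrow> \<beta> ! (t + j) = ((i, h), j)" by blast
  \<comment> \<open>The position in the relator at which the path starts on the lip, to be compared
    with the cut c.\<close>
  define y where "y = x0 + (t - t0)"
  have tt: "t0 \<le> t" "t = t0 + (y - x0)" using t1(1) th(1) by (auto simp: y_def)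
  have y: "y \<le> c + l" "c \<le> y + l" "y + m < c + m + 1 + l"
    using t1(1) t2(2) th(1,2) tt c unfolding y_def c_def by linarith+
  have yn: "y + m < n" using y gaps bnd st by linarith
  have iM: "i < length cuts" using i by simp
  have "x0 \<le> y" "y < n" using yn by (auto simp: y_def)
  from pos[OF this] have ptm: "(p + t) mod n = y" unfolding tt(2)[symmetric] .
  show ?thesis
  proof (cases "y = c")
    case True
    have "\<beta> ! t = ((i, h), 0)" using th(6)[of 0] m by simp
    from sync_in_boundary[OF \<beta> _ this _ iM th(4,5)] show ?thesis
      using ptm True t2l th(2) m i by (simp add: c_def)
  next
    case False
    have "orient bw w ! (y + j) = orient bw w ! (c + j)" if j: "j < m" for j
    proof -
      have "lab Y (\<beta> ! (t + j)) = cnth (orient bw w) (p + (t + j))"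
        using \<beta>(2) j th(2) t2l by (simp add: reads_def)
      also have "\<dots> = cnth (orient bw w) (y + j)"
      proof (rule cnth_cong)
        have "(p + t + j) mod n = (y + j) mod n" using ptm by (metis mod_add_left_eq mod_mod_trivial)
        thus "(p + (t + j)) mod length (orient bw w) = (y + j) mod length (orient bw w)" by (simp add: add.assoc)
      qed
      also have "\<dots> = orient bw w ! (y + j)" using yn j by (simp add: cnth_nth)
      finally have 1: "lab Y (\<beta> ! (t + j)) = orient bw w ! (y + j)" .
      have "lab Y (\<beta> ! (t + j)) = slice w c (c + m) ! j"
        using th(6)[OF j] lab_Y[OF th(3)] th(4,5) by (simp add: lip_word_def c_def)
      also have "\<dots> = w ! (c + j)" using j gaps bnd by (simp add: nth_slice)
      \<comment> \<open>A word and its inverse agree on a lip, so the orientation does not matter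
        here.\<close>
      also have "\<dots> = orient bw w ! (c + j)"
      proof -
        have "lip_at m w c" unfolding c_def by (rule cut_chain_lip[OF chain(1) iM])
        moreover have "c \<ge> 1" "c + m < length w" using gaps bnd st by auto
        ultimately have "matched w (c + j)" using j by (simp add: lip_at_iff)
        thus ?thesis using matched_mirror[of w "c + j"] j \<open>c + m < length w\<close> by (simp add: orient_def)
      qed
      finally show ?thesis using 1 by simp
    qed
    thus ?thesis unfolding echo_def c_def[symmetric] using False y by blast
  qed
qed

text \<open>The stretch passes q consecutive lips. Were the path not in the boundary, each of them
  would have an echo, which is excluded.\<close>

lemma long_path_in_boundary_half:
  assumes \<beta>: "immersed_path Y \<beta>" "reads Y (orient bw w) \<beta> p"
    and t0: "(p + t0) mod n = x0" "t0 + len \<le> length \<beta>" "2 * (x0 + len) \<le> n + 1"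
    and q: "\<And>i0. w \<notin> echoes k n m st sc l i0 (i0 + q)" "q \<ge> 1"
    and last: "n \<le> 2 * last cuts + 3 * (st + sc) + 6"
    and len: "(q + 6) * (st + sc) + 2 * l + m + 10 \<le> len"
  shows "in_boundary Y \<beta>"
proof -
  have t03: "2 * x0 + 2 * len \<le> n + 1" using t0(3) by simp
  define G where "G = st + sc"
  define M where "M = length cuts"
  have lastM: "last cuts = cuts ! (M - 1)" "M \<ge> 1" using chain(2) by (auto simp: last_conv_nth M_def Suc_le_eq)
  have qG: "(q + 6) * G = q * G + 6 * G" by (simp add: distrib_right)
  define Q where "Q = q * G"
  have len': "Q + 6 * G + 2 * l + m + 10 \<le> len" using len qG by (simp add: G_def Q_def)
  have c0: "cuts ! 0 \<le> G" using cut_chain_first(2)[OF chain] by (simp add: G_def)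
  have lastG: "n \<le> 2 * cuts ! (M - 1) + 3 * G + 6" using last lastM by (simp add: G_def)
  have M2: "M \<ge> 2"
  proof (rule ccontr)
    assume "\<not> ?thesis"
    hence "M - 1 = 0" by simp
    hence "n \<le> 2 * cuts ! 0 + 3 * G + 6" using lastG by simp
    thus False using c0 len' t03 by linarith
  qed
  let ?P = "\<lambda>i. 1 \<le> i \<and> i < M \<and> x0 + l + 1 \<le> cuts ! i"
  have exP: "?P (M - 1)" using M2 lastG t03 len' by (intro conjI; linarith)
  \<comment> \<open>The first lip that is passed with a full window before it; its index is at least
    1 because \<open>strays\<close> concerns middle beads.\<close>
  define i0 where "i0 = (LEAST i. ?P i)"
  have P0: "?P i0" unfolding i0_def by (rule LeastI[of ?P, OF exP])
  \<comment> \<open>Two gaps suffice: one beyond the previous cut in general, and if the index is 1,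
    both cuts lie within two gaps of the midpoint.\<close>
  have up0: "cuts ! i0 \<le> x0 + l + 1 + 2 * G"
  proof (cases "i0 = 1")
    case True
    have "cuts ! Suc 0 + m \<le> cuts ! 0 + st + sc" using M2 by (intro cut_chain_gap(2)[OF chain(1)]) (simp add: M_def)
    thus ?thesis using True c0 by (simp add: G_def)
  next
    case False
    hence "\<not> ?P (i0 - 1)" using P0 by (intro not_less_Least[of "i0 - 1" ?P, folded i0_def]) simp
    hence "cuts ! (i0 - 1) < x0 + l + 1" using P0 False by auto
    moreover have "cuts ! Suc (i0 - 1) + m \<le> cuts ! (i0 - 1) + st + sc" using P0 False
      by (intro cut_chain_gap(2)[OF chain(1)]) (simp add: M_def)
    ultimately show ?thesis using P0 by (simp add: G_def)
  qed
  have room: "Suc (i0 + r) < M \<and> cuts ! (i0 + r) \<le> x0 + l + 1 + 2 * G + Q" if r: "r < q" for r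
  proof -
    have rG: "r * G \<le> Q" using r by (simp add: Q_def)
    \<comment> \<open>If the cuts ran out here, the last one would be too far from the middle of the
      word.\<close>
    have *: "i0 + r < M - 1"
    proof (rule ccontr)
      assume "\<not> ?thesis"
      hence le: "M - 1 - i0 \<le> r" "i0 \<le> M - 1" using P0 by auto
      have "cuts ! (M - 1) \<le> cuts ! i0 + (M - 1 - i0) * (st + sc)"
        using le M2 by (intro cut_chain_upper[OF chain(1)]) (auto simp: M_def)
      moreover have "(M - 1 - i0) * (st + sc) \<le> r * G" using le by (simp add: G_def)
      ultimately have "cuts ! (M - 1) \<le> x0 + l + 1 + 2 * G + Q" using up0 rG by linarith
      thus False using lastG t03 len' by linarith
    qed
    have "cuts ! (i0 + r) \<le> cuts ! i0 + (i0 + r - i0) * (st + sc)"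
      using * by (intro cut_chain_upper[OF chain(1)]) (auto simp: M_def)
    hence "cuts ! (i0 + r) \<le> cuts ! i0 + r * G" by (simp add: G_def)
    thus ?thesis using * up0 rG by linarith
  qed
  show ?thesis
  proof (rule ccontr)
    assume nb: "\<not> in_boundary Y \<beta>"
    have ec: "echo l m w (cuts ! (i0 + r))" if r: "r < q" for r
    proof -
      have mono: "cuts ! i0 \<le> cuts ! (i0 + r)" using room[OF r] by (intro cut_chain_mono'[OF chain(1)]) (auto simp: M_def)
      have "in_boundary Y \<beta> \<or> echo l m w (cuts ! (i0 + r))"
      proof (rule lip_passed[OF \<beta> t0(1,2)])
        show "x0 + l + 1 \<le> cuts ! (i0 + r)" using mono P0 by linarith
        show "cuts ! (i0 + r) + m + 1 + l \<le> x0 + len" using room[OF r] len' by linarith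
      qed (use P0 room[OF r] in \<open>auto simp: M_def\<close>)
      thus ?thesis using nb by blast
    qed
    have "w \<in> echoes k n m st sc l i0 (i0 + q)"
      unfolding echoes_def
    proof (intro CollectI conjI exI[of _ "take (i0 + q) cuts"] w allI impI ballI)
      have lt: "Suc (i0 + (q - 1)) < M" using room[of "q - 1"] q(2) by simp
      show "length (take (i0 + q) cuts) = i0 + q" using lt q(2) by (simp add: M_def)
      show "cut_chain m st sc w (take (i0 + q) cuts)" by (rule cut_chain_take[OF chain(1)])
      show "2 * (a + l + m + 2) \<le> n" if a: "a \<in> set (take (i0 + q) cuts)" for a
      proof -
        obtain j where j: "j < i0 + q" "j < M" "a = cuts ! j"
          using a by (auto simp: in_set_conv_nth M_def)
        have "a \<le> cuts ! (i0 + (q - 1))" unfolding j(3) using j lt q(2)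
          by (intro cut_chain_mono'[OF chain(1)]) (auto simp: M_def)
        hence "a \<le> x0 + l + 1 + 2 * G + Q" using room[of "q - 1"] q(2) by simp
        thus ?thesis using t03 len' by simp
      qed
      show "echo l m w (take (i0 + q) cuts ! j)" if "i0 \<le> j \<and> j < i0 + q" for j
      proof -
        have "j - i0 < q" and j: "i0 + (j - i0) = j" using that by auto
        from ec[OF this(1)] show ?thesis using that unfolding j by simp
      qed
    qed
    thus False using q(1) by blast
  qed
qed

text \<open>If the chosen stretch lies in the second half of the relator, the reversed path reads
  the inverse word in the first half.\<close>

lemma long_path_in_boundary:
  assumes \<gamma>: "immersed_path Y \<gamma>" "reads Y (orient bw w) \<gamma> p" and g: "length \<gamma> \<le> n"
    and q: "\<And>i0. w \<notin> echoes k n m st sc l i0 (i0 + q)" "q \<ge> 1"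
    and last: "n \<le> 2 * last cuts + 3 * (st + sc) + 6"
    and len: "(q + 6) * (st + sc) + 2 * l + m + 10 \<le> length \<gamma> div 4"
  shows "in_boundary Y \<gamma>"
proof -
  define g where "g = length \<gamma>"
  define len where "len = g div 4"
  have n4: "n \<ge> 4" using len \<open>length \<gamma> \<le> n\<close> by linarith
  have s: "set \<gamma> \<subseteq> hedges Y" using \<gamma>(1) by (auto simp: immersed_path_def)
  have p': "reads Y (orient bw w) \<gamma> (p mod n)"
  proof -
    have "cnth (orient bw w) (p mod n + t) = cnth (orient bw w) (p + t)" for t
      by (rule cnth_cong) (simp add: mod_add_left_eq)
    thus ?thesis using \<gamma>(2) by (simp add: reads_def)
  qed
  have pn: "p mod n < n" by (rule mod_less_divisor[OF wne(2)])
  define P where "P = p mod n"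
  obtain t0 where t0: "t0 + len \<le> g"
    "2 * ((P + t0) mod n + len) \<le> n + 1 \<or> (n \<le> 2 * ((P + t0) mod n) \<and> (P + t0) mod n + len \<le> n)"
    using half_window[OF g[folded g_def] pn n4] unfolding len_def P_def by metis
  define x0 where "x0 = (P + t0) mod n"
  from t0(2) show ?thesis
  proof
    assume "2 * ((P + t0) mod n + len) \<le> n + 1"
    thus ?thesis using t0(1) len q last g
      by (intro long_path_in_boundary_half[OF \<gamma>(1) p', of t0 x0 len q]) (auto simp: x0_def P_def len_def g_def)
  next
    assume r: "n \<le> 2 * ((P + t0) mod n) \<and> (P + t0) mod n + len \<le> n"
    let ?R = "reverse_path Y \<gamma>"
    define P' where "P' = n * (P + g) - (P + g)"
    define t0' where "t0' = g - t0 - len"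
    have rd: "reads Y (orient (\<not> bw) w) ?R P'"
      using reads_reverse[OF fY(1) s orient_ne p'] unfolding inv_word_orient P'_def P_def g_def by simp
    have le: "P + g \<le> n * (P + g)" using wne by (cases n) simp_all
    have "(P' + t0') mod n = (n - x0 - len) mod n"
    proof (rule mod_eq_if_dvd_add)
      have "P' + t0' + (P + t0 + len) = n * (P + g)" using le t0(1) unfolding P'_def t0'_def by linarith
      thus "n dvd P' + t0' + (P + t0 + len)" by simp
      have "(n - x0 - len) + (P + t0 + len) = (n - x0) + (P + t0)" using r by (simp add: x0_def)
      moreover have "((n - x0) + (P + t0)) mod n = ((n - x0) + x0) mod n" unfolding x0_def by (simp add: mod_add_right_eq)
      moreover have "x0 \<le> n" using r by (simp add: x0_def)
      ultimately show "n dvd n - x0 - len + (P + t0 + len)" by (simp add: dvd_eq_mod_eq_0)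
    qed
    moreover have "n - x0 - len < n"
    proof -
      have "x0 > 0" using r n4 unfolding x0_def by linarith
      thus ?thesis using n4 by simp
    qed
    ultimately have x': "(P' + t0') mod n = n - x0 - len" by simp
    have "n - x0 - len + len = n - x0" "n - x0 + x0 = n" "n \<le> 2 * x0" using r by (auto simp: x0_def)
    hence "2 * (n - x0 - len + len) \<le> n + 1" by simp
    hence "in_boundary Y ?R"
      using x' t0(1) len q last g
      by (intro long_path_in_boundary_half[OF immersed_path_reverse[OF fY(1) \<gamma>(1)] rd, of t0' "n - x0 - len" len q])
        (auto simp: t0'_def len_def g_def)
    thus ?thesis using in_boundary_reverse[OF fY(1) s] by simp
  qed
qed

end

section \<open>Probability of failure at a fixed length\<close>

lemma finite_cyclic_words: "finite (cyclic_words k n)"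
  by (simp add: cyclic_words_def)

lemma cyclic_words_cyc: "c \<in> cyclic_words k n \<Longrightarrow> w \<in> c \<Longrightarrow> w \<in> cyc_reduced_words k n \<and> c = cyc w"
  unfolding cyclic_words_def using crw_cyc cyc_eq by blast

lemma card_crw_pos: "k \<ge> 2 \<Longrightarrow> n \<ge> 2 \<Longrightarrow> card (cyc_reduced_words k n) > 0"
proof -
  assume "k \<ge> 2" "n \<ge> 2"
  hence "0 < (2 * k - 1) ^ (n - 2)" by simp
  also have "\<dots> \<le> card (cyc_reduced_words k n)" by (rule card_crw_ge) fact+
  finally show ?thesis .
qed

text \<open>A cyclic word has at most n linear representatives, so passing from words to cyclic
  words costs at most a factor n.\<close>

lemma card_crw_le_cyclic:
  assumes "n \<ge> 1"
  shows "card (cyc_reduced_words k n) \<le> n * card (cyclic_words k n)"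
proof -
  have "cyc_reduced_words k n \<subseteq> (\<Union>c\<in>cyclic_words k n. c)"
    using self_in_cyc by (auto simp: cyclic_words_def)
  moreover have fin: "finite (\<Union>c\<in>cyclic_words k n. c)"
    using finite_cyclic_words finite_cyc by (auto simp: cyclic_words_def)
  ultimately have "card (cyc_reduced_words k n) \<le> card (\<Union>c\<in>cyclic_words k n. c)" by (rule card_mono[rotated])
  also have "\<dots> \<le> (\<Sum>c\<in>cyclic_words k n. card c)" by (rule card_UN_le[OF finite_cyclic_words])
  also have "\<dots> \<le> (\<Sum>c\<in>cyclic_words k n. n)"
  proof (rule sum_mono)
    fix c assume "c \<in> cyclic_words k n"
    then obtain w where w: "w \<in> cyc_reduced_words k n" "c = cyc w" by (auto simp: cyclic_words_def)
    have "length w = n" using w(1) by (rule crw_length)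
    moreover from this have "w \<noteq> []" using assms by auto
    ultimately show "card c \<le> n" using card_cyc_le[of w] w(2) by simp
  qed
  finally show ?thesis by (simp add: mult.commute)
qed

lemma prob_cyclic_word_meets:
  assumes k: "k \<ge> 2" and n: "n \<ge> 2" and V: "V \<subseteq> cyc_reduced_words k n"
  shows "measure_pmf.prob (pmf_of_set (cyclic_words k n)) {c. c \<inter> V \<noteq> {}}
    \<le> real n * (real (card V) / real (card (cyc_reduced_words k n)))"
proof -
  let ?S = "cyclic_words k n"
  have pos: "card (cyc_reduced_words k n) > 0" by (rule card_crw_pos[OF k n])
  have ne: "?S \<noteq> {}" using pos by (auto simp: cyclic_words_def)
  have cS: "card ?S > 0" using ne finite_cyclic_words card_gt_0_iff by blast
  have finV: "finite V" using V finite_crw finite_subset by blast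
  have "?S \<inter> {c. c \<inter> V \<noteq> {}} \<subseteq> cyc ` V" using cyclic_words_cyc by blast
  hence 1: "card (?S \<inter> {c. c \<inter> V \<noteq> {}}) \<le> card V" using surj_card_le[OF finV] by blast
  have 2: "real (card (cyc_reduced_words k n)) \<le> real n * real (card ?S)"
    using card_crw_le_cyclic[of n k] n by (metis One_nat_def Suc_1 Suc_leD of_nat_le_iff of_nat_mult)
  have "measure_pmf.prob (pmf_of_set ?S) {c. c \<inter> V \<noteq> {}} = real (card (?S \<inter> {c. c \<inter> V \<noteq> {}})) / real (card ?S)"
    by (rule measure_pmf_of_set[OF ne finite_cyclic_words])
  also have "\<dots> \<le> real (card V) / real (card ?S)" using 1 by (intro divide_right_mono) auto
  also have "\<dots> \<le> real n * (real (card V) / real (card (cyc_reduced_words k n)))"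
  proof -
    have "real (card V) * real (card (cyc_reduced_words k n)) \<le> real (card V) * (real n * real (card ?S))"
      using 2 by (intro mult_left_mono) auto
    thus ?thesis using pos cS by (simp add: field_simps)
  qed
  finally show ?thesis .
qed

text \<open>By Fubini's theorem, a bound that holds for every value of the first component holds for
  the pair.\<close>

lemma prob_pair_pmf_le:
  assumes "\<And>x. x \<in> set_pmf p \<Longrightarrow> measure_pmf.prob q {y. Q x y} \<le> B" "B \<ge> 0"
  shows "measure_pmf.prob (pair_pmf p q) {(x, y). Q x y} \<le> B"
proof -
  have "emeasure (pair_pmf p q) {(x, y). Q x y} = (\<integral>\<^sup>+z. indicator {(x, y). Q x y} z \<partial>pair_pmf p q)"
    by simp
  also have "\<dots> = (\<integral>\<^sup>+x. \<integral>\<^sup>+y. indicator {(x, y). Q x y} (x, y) \<partial>q \<partial>p)" by (rule nn_integral_pair_pmf')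
  also have "\<dots> = (\<integral>\<^sup>+x. emeasure q {y. Q x y} \<partial>p)"
  proof (rule nn_integral_cong)
    fix x
    have "(\<integral>\<^sup>+y. indicator {(x, y). Q x y} (x, y) \<partial>q) = (\<integral>\<^sup>+y. indicator {y. Q x y} y \<partial>q)"
      by (intro nn_integral_cong) (auto simp: indicator_def)
    thus "(\<integral>\<^sup>+y. indicator {(x, y). Q x y} (x, y) \<partial>q) = emeasure q {y. Q x y}" by simp
  qed
  also have "\<dots> \<le> (\<integral>\<^sup>+x. ennreal B \<partial>p)"
    using assms(1) by (intro nn_integral_mono_AE) (auto simp: AE_measure_pmf_iff measure_pmf.emeasure_eq_measure intro: ennreal_leI)
  also have "\<dots> = ennreal B" by simp
  finally show ?thesis using assms(2) by (simp add: measure_pmf.emeasure_eq_measure)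
qed

lemma card_prefix_in_le:
  assumes \<Lambda>: "finite \<Lambda>" and a: "a \<le> n" and k: "k \<ge> 1"
  shows "real (card {v \<in> cyc_reduced_words k n. take a v \<in> \<Lambda>}) \<le> real (card \<Lambda>) * (2 * (2 * real k - 1) ^ (n - a))"
proof -
  have "card {v \<in> cyc_reduced_words k n. take a v \<in> \<Lambda>} \<le> card (\<Lambda> \<times> reduced_words k (n - a))"
  proof (rule card_inj_on_le)
    show "inj_on (\<lambda>v. (take a v, drop a v)) {v \<in> cyc_reduced_words k n. take a v \<in> \<Lambda>}"
      by (rule inj_onI) (metis append_take_drop_id prod.inject)
    show "(\<lambda>v. (take a v, drop a v)) ` {v \<in> cyc_reduced_words k n. take a v \<in> \<Lambda>} \<subseteq> \<Lambda> \<times> reduced_words k (n - a)"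
      using reduced_drop[OF subsetD[OF crw_subset_reduced] a] by auto
  qed (use \<Lambda> in simp)
  also have "\<dots> = card \<Lambda> * card (reduced_words k (n - a))" by (rule card_cartesian_product)
  also have "\<dots> \<le> card \<Lambda> * (2 * (2 * k - 1) ^ (n - a))" by (rule mult_le_mono2[OF card_reduced_words_le[OF k]])
  finally have "real (card {v \<in> cyc_reduced_words k n. take a v \<in> \<Lambda>}) \<le> real (card \<Lambda> * (2 * (2 * k - 1) ^ (n - a)))"
    by (simp only: of_nat_le_iff)
  thus ?thesis using k by (simp add: of_nat_diff)
qed

abbreviation convex_event ::
  "nat \<Rightarrow> real \<Rightarrow> real \<Rightarrow> real \<Rightarrow> real \<Rightarrow> nat \<Rightarrow> nat \<Rightarrow> (segment \<Rightarrow> 'h fatgraph) \<Rightarrow> nat \<Rightarrow> (nat \<Rightarrow> word set) set" where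
  "convex_event k D C \<delta> \<alpha> L N \<Phi> n \<equiv>
     {R. \<forall>w\<in>R 0. \<forall>Y. beaded_surface C \<delta> L N \<Phi> w Y \<longrightarrow> alpha_convex \<alpha> (R ` {..<num_relators k D n}) Y}"

text \<open>What the argument asks of the parameters at one length n, before any limit.
  \<open>rest\<close> converts the bounds on the last segment: the lower one leaves room for the
  last lip, the upper one puts the last cut near the middle of the word.\<close>

locale scales =
  fixes k n m st sc l q a L N :: nat and C \<delta> \<alpha> \<rho> :: real
  assumes k: "k \<ge> 2" and n: "n \<ge> 2" and l: "l \<ge> 1" "2 * l \<le> n" and q: "q \<ge> 1"
    and m_def: "m = lip_length C n" and st_def: "st = stem_length \<delta> n" and sc_def: "sc = scan_length \<delta> n"
    and m: "m \<ge> 2" and st: "l + m + 2 \<le> st"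
    and \<rho>: "\<rho> \<ge> 1" "\<rho> ^ L = 2" "\<rho> ^ m \<ge> 4 * real N" and L: "L \<ge> 1"
    and rest: "4 * (real m + 1) \<le> real n powr (1 - \<delta>)" "3 / 2 * real n powr (1 - \<delta>) \<le> 3 * real (st + sc) + 6"
    and a: "a = nat \<lceil>\<alpha> * real n\<rceil>" "a \<le> n" "(q + 6) * (st + sc) + 2 * l + m + 10 \<le> a div 4" and \<alpha>: "\<alpha> > 0"
begin

abbreviation joined :: "(segment \<Rightarrow> 'h fatgraph) \<Rightarrow> word \<Rightarrow> nat list \<Rightarrow> (nat \<times> 'h \<Rightarrow> nat \<times> 'h) \<Rightarrow> bool" where
  "joined \<Phi> w cuts \<mu> \<equiv> joined_beads (pieces \<Phi> w cuts) (beads m w cuts) L N (length cuts) m \<mu> (lip_word m w cuts)"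

abbreviation spine :: "(segment \<Rightarrow> 'h fatgraph) \<Rightarrow> word \<Rightarrow> nat list \<Rightarrow> (nat \<times> 'h \<Rightarrow> nat \<times> 'h) \<Rightarrow> ((nat \<times> 'h) \<times> nat) fatgraph" where
  "spine \<Phi> w cuts \<mu> \<equiv> joined_beads.Y (pieces \<Phi> w cuts) (length cuts) \<mu> (lip_word m w cuts)"

lemma decomposition_valid:
  assumes "bead_decomposition C \<delta> w cuts" "length w = n"
  shows "valid_cuts m st sc w cuts" "n \<le> 2 * last cuts + 3 * (st + sc) + 6"
proof -
  have b: "cuts \<noteq> []" "cut_chain m st sc w cuts"
    "real n powr (1 - \<delta>) / 2 \<le> real n - 2 * real (last cuts)" "real n - 2 * real (last cuts) \<le> 3 / 2 * real n powr (1 - \<delta>)"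
    using assms by (auto simp: bead_decomposition_def successively_next_cut Let_def m_def st_def sc_def)
  have "real (2 * (last cuts + m + 1)) \<le> real n" using b(3) rest(1) by simp
  thus "valid_cuts m st sc w cuts" using b(1,2) assms(2) unfolding valid_cuts_def by (simp only: of_nat_le_iff simp_thms)
  have "real n \<le> real (2 * last cuts + 3 * (st + sc) + 6)" using b(4) rest(2) by simp
  thus "n \<le> 2 * last cuts + 3 * (st + sc) + 6" by (simp only: of_nat_le_iff)
qed

definition atypical :: "(segment \<Rightarrow> 'h fatgraph) \<Rightarrow> word set" where
  "atypical \<Phi> = (\<Union>bw. strays k n m st sc L N \<Phi> l bw) \<union> (\<Union>i0\<in>{..n}. echoes k n m st sc l i0 (i0 + q)) \<union>
     repeats k n l \<union> inv_word ` repeats k n l \<union> inverse_repeats k n l"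

lemma atypical_subset: "atypical \<Phi> \<subseteq> cyc_reduced_words k n"
  using crw_inv_word
  by (auto simp: atypical_def strays_def echoes_def repeats_def inverse_repeats_def)

text \<open>The surface may be built from any linear representative, the midpoint of the first
  segment being arbitrary; hence all of them contribute.\<close>

definition readable :: "(segment \<Rightarrow> 'h fatgraph) \<Rightarrow> word set \<Rightarrow> word set" where
  "readable \<Phi> c = {u. \<exists>w\<in>c. \<exists>cuts. valid_cuts m st sc w cuts \<and> pieces_good L N \<Phi> m w cuts \<and> u \<in> bead_words \<Phi> m w cuts {..length cuts} a}"

definition hits :: "(segment \<Rightarrow> 'h fatgraph) \<Rightarrow> word set \<Rightarrow> word set" where
  "hits \<Phi> c = {v \<in> cyc_reduced_words k n. take a v \<in> readable \<Phi> c \<or> take a (inv_word v) \<in> readable \<Phi> c}"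

lemma mst: "m < st" using st by simp
lemma a1: "a \<ge> 1"
proof -
  have "10 \<le> a div 4" using a(3) by linarith
  thus ?thesis by linarith
qed

lemma spine_locale:
  assumes w: "w \<in> cyc_reduced_words k n" and S: "beaded_surface C \<delta> L N \<Phi> w Y"
  obtains cuts \<mu> where "bead_decomposition C \<delta> w cuts"
    "joined \<Phi> w cuts \<mu>"
    "Y = spine \<Phi> w cuts \<mu>"
    "pieces_good L N \<Phi> m w cuts"
proof -
  have len: "length w = n" and wl: "set w \<subseteq> letters k" using w crw_length crw_letters by blast+
  have "\<exists>cuts \<mu>. bead_decomposition C \<delta> w cuts \<and>
    (\<forall>i\<le>length cuts. fatgraph (pieces \<Phi> w cuts i) \<and> trivalent (pieces \<Phi> w cuts i) \<and>
       long_edges L (pieces \<Phi> w cuts i) \<and> boundary (pieces \<Phi> w cuts i) = copies N (beads m w cuts i)) \<and>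
    tag_pairing (beads m w cuts) (disjoint_union {..length cuts} (pieces \<Phi> w cuts)) \<mu> \<and>
    Y = join_tags (disjoint_union {..length cuts} (pieces \<Phi> w cuts)) \<mu>
       (\<lambda>x. lip_word m w cuts (fst x) (lab (disjoint_union {..length cuts} (pieces \<Phi> w cuts)) x))"
    using S[unfolded beaded_surface_def Let_def, THEN conjunct1] unfolding len m_def[symmetric] by assumption
  then obtain cuts \<mu> where c: "bead_decomposition C \<delta> w cuts"
    "\<forall>i\<le>length cuts. fatgraph (pieces \<Phi> w cuts i) \<and> trivalent (pieces \<Phi> w cuts i) \<and>
       long_edges L (pieces \<Phi> w cuts i) \<and> boundary (pieces \<Phi> w cuts i) = copies N (beads m w cuts i)"
    "tag_pairing (beads m w cuts) (disjoint_union {..length cuts} (pieces \<Phi> w cuts)) \<mu>"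
    "Y = join_tags (disjoint_union {..length cuts} (pieces \<Phi> w cuts)) \<mu>
       (\<lambda>x. lip_word m w cuts (fst x) (lab (disjoint_union {..length cuts} (pieces \<Phi> w cuts)) x))"
    by (elim exE conjE) (rule that)
  have v: "valid_cuts m st sc w cuts" by (rule decomposition_valid(1)[OF c(1) len])
  let ?Ys = "pieces \<Phi> w cuts"
  let ?U = "disjoint_union {..length cuts} ?Ys"
  have tagU: "(i, h) \<in> tags ?U \<longleftrightarrow> i \<le> length cuts \<and> h \<in> tags (?Ys i)" for i h
    by (auto simp: tags_def disjoint_union_def)
  have jb: "joined_beads ?Ys (beads m w cuts) L N (length cuts) m \<mu> (lip_word m w cuts)"
  proof
    show "good_piece L N (beads m w cuts i) (?Ys i)" if "i \<le> length cuts" for i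
      using c(2) that by (simp add: good_piece_def)
    show "no_adjacent_tags (beads m w cuts i) \<and> beads m w cuts i \<noteq> []" if "i \<le> length cuts" for i
      by (rule bead_no_adjacent_tags[OF v mst wl that])
    show "length (lip_word m w cuts i (Tag b)) = m" if i: "i \<le> length cuts" "h \<in> tags (?Ys i)" "lab (?Ys i) h = Tag b" for i h b
    proof -
      have t: "(i, h) \<in> tags ?U" using i tagU by simp
      have lb: "lab ?U (i, h) = Tag b" using i by (simp add: disjoint_union_def)
      \<comment> \<open>A tag leading on is paired with a tag of the next bead, so the bead i is not
        the last one and its lip exists.\<close>
      have mu: "\<mu> (i, h) \<in> tags ?U" "lab ?U (i, h) = Tag True \<longrightarrow> fst (\<mu> (i, h)) = Suc i"
        using c(3) t unfolding tag_pairing_def by fastforce+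
      have le: "fst (\<mu> (i, h)) \<le> length cuts" using mu(1) tagU by (metis prod.collapse)
      have sl: "length (slice w (cuts ! j) (cuts ! j + m)) = m" if "j < length cuts" for j
        using valid_cuts_bound[OF v that] by (simp add: length_slice)
      show ?thesis
      proof (cases b)
        case True
        hence "i < length cuts" using mu(2) lb le by simp
        thus ?thesis using True sl by (simp add: lip_word_def)
      next
        case False
        have "i - 1 < length cuts" using i(1) v by (cases cuts) (auto simp: valid_cuts_def)
        thus ?thesis using False sl by (simp add: lip_word_def)
      qed
    qed
    show "tag_pairing (beads m w cuts) ?U \<mu>" by (rule c(3))
    show "1 \<le> m" using m by simp
  qed
  have "Y = joined_beads.Y ?Ys (length cuts) \<mu> (lip_word m w cuts)"
    unfolding joined_beads.Y_def[OF jb] joined_beads.U_def[OF jb] by (rule c(4))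
  moreover have "pieces_good L N \<Phi> m w cuts" using c(2) by (simp add: pieces_good_def good_piece_def)
  ultimately show thesis using that[OF c(1) jb] by blast
qed

lemma own_relator_in_boundary:
  assumes w: "w \<in> cyc_reduced_words k n" and S: "beaded_surface C \<delta> L N \<Phi> w Y"
    and tyw: "w \<notin> atypical \<Phi>"
    and \<gamma>: "immersed_path Y \<gamma>" "a \<le> length \<gamma>" "length \<gamma> \<le> n" "reads Y (orient bw w) \<gamma> p"
  shows "in_boundary Y \<gamma>"
proof -
  have len: "length w = n" using w by (rule crw_length)
  obtain cuts \<mu> where c: "bead_decomposition C \<delta> w cuts"
    "joined \<Phi> w cuts \<mu>"
    "Y = spine \<Phi> w cuts \<mu>"
    by (rule spine_locale[OF w S])
  have fY: "fatgraph Y" "folded Y" "boundary Y = copies N w" using S by (auto simp: beaded_surface_def)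
  note v = decomposition_valid[OF c(1) len]
  \<comment> \<open>The starting index of a run of echoes is at most n, as the last cut is at least
    the number of cuts.\<close>
  have ech: "w \<notin> echoes k (length w) m st sc l i0 (i0 + q)" for i0
  proof
    assume e: "w \<in> echoes k (length w) m st sc l i0 (i0 + q)"
    then obtain cuts where cu: "length cuts = i0 + q" "cut_chain m st sc w cuts" "\<forall>a\<in>set cuts. 2 * (a + l + m + 2) \<le> n"
      unfolding echoes_def len by blast
    have "cuts \<noteq> []" using cu(1) q by auto
    hence "i0 + q \<le> last cuts" "last cuts \<in> set cuts" using cut_chain_length_le[OF cu(2)] cu(1) mst by auto
    moreover from this have "2 * (last cuts + l + m + 2) \<le> n" using cu(3) by blast
    ultimately have "i0 \<le> n" by simp
    thus False using e tyw len by (auto simp: atypical_def)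
  qed
  interpret joined_beads "pieces \<Phi> w cuts" "beads m w cuts" L N "length cuts" m \<mu> "lip_word m w cuts"
    by (rule c(2))
  interpret ts: typical_spine \<Phi> w cuts L N m \<mu> k st sc l
  proof
    show "w \<in> cyc_reduced_words k (length w)" using w len by simp
    show "valid_cuts m st sc w cuts" by (rule v(1))
    show "l + m + 2 \<le> st" "1 \<le> l" using st l by auto
    show "fatgraph (spine \<Phi> w cuts \<mu>)"
      "folded (spine \<Phi> w cuts \<mu>)"
      "boundary (spine \<Phi> w cuts \<mu>) = copies N w"
      using fY c(3) by simp_all
    show "w \<notin> strays k (length w) m st sc L N \<Phi> l bw" for bw using tyw len by (auto simp: atypical_def)
    show "w \<notin> repeats k (length w) l" "w \<notin> inverse_repeats k (length w) l" using tyw len by (auto simp: atypical_def)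
    show "inv_word w \<notin> repeats k (length w) l"
    proof
      assume "inv_word w \<in> repeats k (length w) l"
      hence "inv_word (inv_word w) \<in> inv_word ` repeats k n l" using len by blast
      thus False using tyw by (simp add: atypical_def)
    qed
  qed
  have "in_boundary (spine \<Phi> w cuts \<mu>) \<gamma>"
  proof (rule ts.long_path_in_boundary)
    show "(q + 6) * (st + sc) + 2 * l + m + 10 \<le> length \<gamma> div 4"
      using a(3) div_le_mono[OF \<gamma>(2), of 4] by linarith
  qed (use \<gamma> c(3) v(2) len q ech in auto)
  thus ?thesis using c(3) by simp
qed

lemma path_label_readable:
  assumes c: "c \<in> cyclic_words k n" "w \<in> c" and S: "beaded_surface C \<delta> L N \<Phi> w Y"
    and \<gamma>: "immersed_path Y \<gamma>" "length \<gamma> = a"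
  shows "map (lab Y) \<gamma> \<in> readable \<Phi> c"
proof -
  have w: "w \<in> cyc_reduced_words k n" using cyclic_words_cyc c by blast
  have len: "length w = n" using w by (rule crw_length)
  obtain cuts \<mu> where cu: "bead_decomposition C \<delta> w cuts"
    "joined \<Phi> w cuts \<mu>"
    "Y = spine \<Phi> w cuts \<mu>"
    "pieces_good L N \<Phi> m w cuts"
    by (rule spine_locale[OF w S])
  interpret jb: joined_beads "pieces \<Phi> w cuts" "beads m w cuts" L N "length cuts" m \<mu> "lip_word m w cuts"
    by (rule cu(2))
  have "map (lab jb.Y) \<gamma> \<in> walk_words (pieces \<Phi> w cuts) {..length cuts} (length cuts) m (lip_fun m w cuts) (length \<gamma>)"
  proof (rule jb.path_walk)
    show "immersed_path jb.Y \<gamma>" using \<gamma>(1) cu(3) by simp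
    fix e i h assume e: "e \<in> set \<gamma>" "jb.state_of e = Edge i h"
    have "e \<in> hedges jb.Y" using \<gamma>(1) e(1) cu(3) by (auto simp: immersed_path_def)
    thus "i \<in> {..length cuts}" using e(2) by (cases e) (auto simp: jb.hedges_Y split: symbol.splits)
  qed (auto simp: lip_fun_def)
  thus ?thesis unfolding readable_def bead_words_def
    using c(2) decomposition_valid(1)[OF cu(1) len] cu(3,4) \<gamma>(2) by blast
qed

lemma alpha_convex_typical:
  fixes R :: "nat \<Rightarrow> word set"
  assumes R: "\<And>j. j < J \<Longrightarrow> R j \<in> cyclic_words k n" "0 < J"
    and tyw: "R 0 \<inter> atypical \<Phi> = {}" and nohit: "\<And>j. 1 \<le> j \<Longrightarrow> j < J \<Longrightarrow> R j \<inter> hits \<Phi> (R 0) = {}"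
    and w: "w \<in> R 0" and S: "beaded_surface C \<delta> L N \<Phi> w Y"
  shows "alpha_convex \<alpha> (R ` {..<J}) Y"
  unfolding alpha_convex_def
proof (intro allI impI, elim conjE)
  fix \<gamma> r v
  assume \<gamma>: "immersed_path Y \<gamma>" and r: "r \<in> R ` {..<J}" and v: "v \<in> r"
    and pre: "prefix (map (lab Y) \<gamma>) v \<or> prefix (map (lab Y) \<gamma>) (inv_word v)"
    and len: "\<alpha> \<le> real (length \<gamma>) / real (length v)"
  obtain j where j: "j < J" "r = R j" using r by auto
  have vc: "v \<in> cyc_reduced_words k n" using cyclic_words_cyc R(1)[OF j(1)] v j(2) by blast
  have lv: "length v = n" using vc by (rule crw_length)
  have ln: "length \<gamma> \<le> n" using pre lv prefix_length_le by fastforce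
  have "\<alpha> * real n \<le> real (length \<gamma>)" using len lv n by (simp add: field_simps)
  hence la: "a \<le> length \<gamma>" unfolding a(1) by linarith
  obtain z where z: "if z then prefix (map (lab Y) \<gamma>) (inv_word v) else prefix (map (lab Y) \<gamma>) v"
    using pre by (metis (full_types))
  hence pz: "prefix (map (lab Y) \<gamma>) (orient z v)" by (auto simp: orient_def split: if_splits)
  show "in_boundary Y \<gamma>"
  proof (cases "j = 0")
    case True
    have wc: "w \<in> cyc_reduced_words k n" "R 0 = cyc w" using cyclic_words_cyc R w by blast+
    have "orient z v \<in> cyc (orient z w)"
      using v j True wc(2) inv_word_in_cyc[of v w] by (auto simp: orient_def)
    then obtain x where x: "orient z v = rotate x (orient z w)" by (auto simp: cyc_iff)
    have lw: "length w = n" using wc(1) by (rule crw_length)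
    have ne: "orient z w \<noteq> []" using lw n by (auto simp: orient_def)
    have "reads Y (orient z w) \<gamma> x"
      unfolding reads_def
    proof (intro allI impI)
      fix t assume t: "t < length \<gamma>"
      obtain ys where ys: "orient z v = map (lab Y) \<gamma> @ ys" using pz by (auto simp: prefix_def)
      have "lab Y (\<gamma> ! t) = orient z v ! t" using t unfolding ys by (simp add: nth_append)
      also have "\<dots> = cnth (orient z v) t" using t ln lv by (simp add: cnth_nth)
      also have "\<dots> = cnth (orient z w) (x + t)" unfolding x by (rule cnth_rotate[OF ne])
      finally show "lab Y (\<gamma> ! t) = cnth (orient z w) (x + t)" .
    qed
    thus ?thesis using own_relator_in_boundary[OF wc(1) S _ \<gamma> la ln] tyw w by blast
  next
    case False
    \<comment> \<open>For another relator the first a letters, read along the path, would put v into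
      \<open>hits\<close>; so there is no such path at all.\<close>
    have im: "immersed_path Y (take a \<gamma>)" using immersed_path_take_drop[OF \<gamma>, of a 0] by simp
    have "length (take a \<gamma>) = a" using la by simp
    from path_label_readable[OF R(1)[OF R(2)] w S im this]
    have rd: "map (lab Y) (take a \<gamma>) \<in> readable \<Phi> (R 0)" .
    have "map (lab Y) (take a \<gamma>) = take a (orient z v)"
      using pz la by (auto simp: prefix_def take_map)
    hence "v \<in> hits \<Phi> (R 0)" using rd vc unfolding hits_def by (cases z) (auto simp: orient_def)
    moreover have "1 \<le> j" using False by (cases j) auto
    ultimately show ?thesis using nohit[OF _ j(1)] j(2) v by blast
  qed
qed

text \<open>There are at most n representatives and n + 1 numbers of cuts, and both together
  determine the cuts.\<close>

lemma readable_card: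
  assumes c: "c \<in> cyclic_words k n"
  shows "finite (readable \<Phi> c)" "real (card (readable \<Phi> c)) \<le> real (n * Suc n) * bead_word_bound n N m \<rho> a"
proof -
  define S where "S = (\<lambda>(w, M). {u. \<exists>cuts. length cuts = M \<and> valid_cuts m st sc w cuts \<and> pieces_good L N \<Phi> m w cuts \<and> u \<in> bead_words \<Phi> m w cuts {..length cuts} a})"
  have cw: "w \<in> cyc_reduced_words k n" "length w = n" if "w \<in> c" for w using cyclic_words_cyc[OF c that] crw_length by blast+
  have pos: "bead_word_bound n N m \<rho> a \<ge> 0" using \<rho>(1) by (simp add: bead_word_bound_def)
  have each: "finite (S d) \<and> real (card (S d)) \<le> bead_word_bound n N m \<rho> a" if d: "d \<in> c \<times> {..n}" for d
  proof (cases "S d = {}")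
    case False
    obtain w M where wM: "d = (w, M)" "w \<in> c" using d by auto
    obtain cuts where cu: "length cuts = M" "valid_cuts m st sc w cuts" "pieces_good L N \<Phi> m w cuts"
      using False by (auto simp: S_def wM)
    have "cuts' = cuts" if "length cuts' = M" "valid_cuts m st sc w cuts'" for cuts'
      using valid_cuts_unique[OF that(2) cu(2)] that(1) cu(1) mst by simp
    hence "S d \<subseteq> bead_words \<Phi> m w cuts {..length cuts} a" by (auto simp: S_def wM)
    moreover have "m \<ge> 1" using m by simp
    note card_bead_words_le[OF cu(2,3) order.refl cw(2)[OF wM(2)] crw_letters[OF cw(1)[OF wM(2)]] mst \<rho> L this a1]
    ultimately show ?thesis using finite_subset card_mono by (metis (no_types, lifting) of_nat_le_iff order.trans)
  qed (use pos in simp)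
  have "readable \<Phi> c \<subseteq> (\<Union>d\<in>c \<times> {..n}. S d)"
  proof
    fix u assume "u \<in> readable \<Phi> c"
    then obtain w cuts where u: "w \<in> c" "valid_cuts m st sc w cuts" "pieces_good L N \<Phi> m w cuts" "u \<in> bead_words \<Phi> m w cuts {..length cuts} a"
      by (auto simp: readable_def)
    have "length cuts \<le> n"
      using cut_chain_length_le[of m st sc w cuts] u(2) mst cw(2)[OF u(1)] by (auto simp: valid_cuts_def)
    moreover have "u \<in> S (w, length cuts)" using u by (auto simp: S_def)
    ultimately show "u \<in> (\<Union>d\<in>c \<times> {..n}. S d)" using u(1) by blast
  qed
  moreover have c': "finite c" "card c \<le> n"
  proof -
    obtain w where w: "w \<in> cyc_reduced_words k n" "c = cyc w" using c by (auto simp: cyclic_words_def)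
    show "finite c" using w(2) finite_cyc by simp
    have "length w = n" using w(1) by (rule crw_length)
    moreover from this have "w \<noteq> []" using n by auto
    ultimately show "card c \<le> n" using card_cyc_le[of w] w(2) by simp
  qed
  ultimately have *: "finite (c \<times> {..n})" "readable \<Phi> c \<subseteq> (\<Union>d\<in>c \<times> {..n}. S d)" by auto
  have "finite (\<Union>d\<in>c \<times> {..n}. S d)" using *(1) each by blast
  thus "finite (readable \<Phi> c)" using *(2) finite_subset by blast
  have "real (card (readable \<Phi> c)) \<le> real (card (c \<times> {..n})) * bead_word_bound n N m \<rho> a"
    by (rule card_UN_real_le[OF * each])
  also have "\<dots> \<le> real (n * Suc n) * bead_word_bound n N m \<rho> a"
    using c'(2) pos by (intro mult_right_mono) (simp_all only: card_cartesian_product card_atMost of_nat_le_iff mult_le_mono1)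
  finally show "real (card (readable \<Phi> c)) \<le> real (n * Suc n) * bead_word_bound n N m \<rho> a" .
qed

lemma K: "2 * real k - 1 \<ge> 3" using k by simp

text \<open>The lower bound (2 * k - 1) ^ (n - 2) for the number of cyclically reduced words loses
  only the factor (2 * k - 1) ^ 2.\<close>

lemma ratio_le:
  assumes "i \<le> n" "c \<ge> 0" "x \<le> c * (2 * (2 * real k - 1) ^ (n - i))"
  shows "x / real (card (cyc_reduced_words k n)) \<le> c * (2 * (2 * real k - 1)\<^sup>2 / (2 * real k - 1) ^ i)"
proof -
  let ?K = "2 * real k - 1"
  have Kp: "?K > 0" using K by simp
  have "real ((2 * k - 1) ^ (n - 2)) \<le> real (card (cyc_reduced_words k n))"
    using card_crw_ge[OF k n] by (simp only: of_nat_le_iff)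
  hence cg: "?K ^ (n - 2) \<le> real (card (cyc_reduced_words k n))" using k by (simp add: of_nat_diff)
  have p0: "?K ^ (n - 2) > 0" using Kp by simp
  have "x / real (card (cyc_reduced_words k n)) \<le> c * (2 * ?K ^ (n - i)) / real (card (cyc_reduced_words k n))"
    using assms(3) by (intro divide_right_mono) auto
  also have "\<dots> \<le> c * (2 * ?K ^ (n - i)) / ?K ^ (n - 2)"
    using cg p0 assms(2) Kp card_crw_pos[OF k n] by (intro divide_left_mono mult_pos_pos) auto
  also have "\<dots> = c * (2 * (?K ^ (n - i) / ?K ^ (n - 2)))" by simp
  also have "?K ^ (n - i) / ?K ^ (n - 2) = ?K\<^sup>2 / ?K ^ i"
  proof -
    have "?K ^ (n - i) * ?K ^ i = ?K ^ n" using assms(1) by (simp flip: power_add)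
    moreover have "?K\<^sup>2 * ?K ^ (n - 2) = ?K ^ n" using n power_add[of ?K 2 "n - 2"] by (simp only: le_add_diff_inverse)
    ultimately have "?K ^ (n - i) * ?K ^ i = ?K\<^sup>2 * ?K ^ (n - 2)" by simp
    thus ?thesis using Kp by (simp add: frac_eq_eq)
  qed
  finally show ?thesis by simp
qed

text \<open>In this order: stray paths in both directions, runs of echoes, repetitions in
  \<open>w\<close> and in its inverse, inverse repetitions. The exponent \<open>l div 2\<close> is
  due to the halving for reflections.\<close>

definition own_bound :: real where
  "own_bound = 2 * (real (Suc n ^ 5) * bead_word_bound n N m \<rho> l * (2 * (2 * real k - 1)\<^sup>2 / (2 * real k - 1) ^ l))
     + real (Suc n) * (real (2 * (2 * l + 1)) / (2 * real k - 1) ^ (m - 2)) ^ q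
     + 2 * (real (n ^ 2) * (2 * (2 * real k - 1)\<^sup>2 / (2 * real k - 1) ^ l))
     + real (n ^ 2) * (2 * (2 * real k - 1)\<^sup>2 / (2 * real k - 1) ^ (l div 2))"

definition hit_bound :: real where
  "hit_bound = 2 * (real (n * Suc n) * bead_word_bound n N m \<rho> a * (2 * (2 * real k - 1)\<^sup>2 / (2 * real k - 1) ^ a))"

lemma atypical_ratio: "real (card (atypical \<Phi>)) / real (card (cyc_reduced_words k n)) \<le> own_bound"
proof -
  let ?c = "real (card (cyc_reduced_words k n))"
  have cpos: "?c > 0" using card_crw_pos[OF k n] by simp
  have k1: "k \<ge> 1" using k by simp
  have m1: "m \<ge> 1" using m by simp
  have pos: "bead_word_bound n N m \<rho> l \<ge> 0" using \<rho>(1) by (simp add: bead_word_bound_def)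
  have fin: "finite (strays k n m st sc L N \<Phi> l bw)" "finite (echoes k n m st sc l i0 i)" "finite (repeats k n l)" "finite (inverse_repeats k n l)"
    for bw i0 i by (auto simp: strays_def echoes_def repeats_def inverse_repeats_def)
  let ?E = "\<Union>i0\<in>{..n}. echoes k n m st sc l i0 (i0 + q)"
  have un: "(\<Union>bw. strays k n m st sc L N \<Phi> l bw) = strays k n m st sc L N \<Phi> l True \<union> strays k n m st sc L N \<Phi> l False"
    by (auto simp: UNIV_bool)
  have "card (atypical \<Phi>) \<le> card (strays k n m st sc L N \<Phi> l True) + card (strays k n m st sc L N \<Phi> l False) + card ?E
      + card (repeats k n l) + card (inv_word ` repeats k n l) + card (inverse_repeats k n l)"
    unfolding atypical_def un by (meson card_Un_le order.trans add_mono order.refl)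
  also have "card (inv_word ` repeats k n l) \<le> card (repeats k n l)" by (rule card_image_le[OF fin(3)])
  finally have "real (card (atypical \<Phi>)) \<le> real (card (strays k n m st sc L N \<Phi> l True)) + real (card (strays k n m st sc L N \<Phi> l False))
      + real (card ?E) + 2 * real (card (repeats k n l)) + real (card (inverse_repeats k n l))" by simp
  hence "real (card (atypical \<Phi>)) / ?c \<le> (real (card (strays k n m st sc L N \<Phi> l True)) + real (card (strays k n m st sc L N \<Phi> l False))
      + real (card ?E) + 2 * real (card (repeats k n l)) + real (card (inverse_repeats k n l))) / ?c"
    using cpos by (intro divide_right_mono) auto
  also have "\<dots> = real (card (strays k n m st sc L N \<Phi> l True)) / ?c + real (card (strays k n m st sc L N \<Phi> l False)) / ?c
      + real (card ?E) / ?c + 2 * (real (card (repeats k n l)) / ?c) + real (card (inverse_repeats k n l)) / ?c"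
    by (simp add: add_divide_distrib)
  also have "\<dots> \<le> own_bound"
  proof -
    have s: "real (card (strays k n m st sc L N \<Phi> l bw)) / ?c \<le> real (Suc n ^ 5) * bead_word_bound n N m \<rho> l * (2 * (2 * real k - 1)\<^sup>2 / (2 * real k - 1) ^ l)" for bw
      using card_strays_le[OF mst k1 \<rho> L m1 l(1), of n sc \<Phi> bw] l pos by (intro ratio_le) (auto simp only: mult.assoc mult_nonneg_nonneg of_nat_0_le_iff)
    have r: "real (card (repeats k n l)) / ?c \<le> real (n ^ 2) * (2 * (2 * real k - 1)\<^sup>2 / (2 * real k - 1) ^ l)"
      using card_repeats_le[OF k1 l(2)] l by (intro ratio_le) auto
    have i: "real (card (inverse_repeats k n l)) / ?c \<le> real (n ^ 2) * (2 * (2 * real k - 1)\<^sup>2 / (2 * real k - 1) ^ (l div 2))"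
    proof (rule ratio_le)
      show "real (card (inverse_repeats k n l)) \<le> real (n\<^sup>2) * (2 * (2 * real k - 1) ^ (n - l div 2))"
        using l by (intro card_inverse_repeats_le[OF k1]) auto
    qed (use l in auto)
    let ?t = "(real (2 * (2 * l + 1)) / (2 * real k - 1) ^ (m - 2)) ^ q"
    have "real (card ?E) \<le> real (card {..n}) * (?t * ?c)"
    proof (rule card_UN_real_le)
      have lst: "l + m + 1 \<le> st" using st by simp
      show "finite (echoes k n m st sc l i0 (i0 + q)) \<and> real (card (echoes k n m st sc l i0 (i0 + q))) \<le> ?t * ?c" for i0
        using fin(2) card_echoes_le[OF k m lst, of n sc i0 q] by blast
    qed auto
    hence e: "real (card ?E) / ?c \<le> real (Suc n) * ?t" using cpos by (simp add: field_simps)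
    have sum: "x1 + x2 + e + 2 * r + i \<le> 2 * S + E + 2 * R + I"
      if "x1 \<le> S" "x2 \<le> S" "e \<le> E" "r \<le> R" "i \<le> I" for x1 x2 e r i S E R I :: real
      using that by linarith
    show ?thesis unfolding own_bound_def by (rule sum[OF s s e r i])
  qed
  finally show ?thesis .
qed

lemma hits_ratio:
  assumes c: "c \<in> cyclic_words k n"
  shows "real (card (hits \<Phi> c)) / real (card (cyc_reduced_words k n)) \<le> hit_bound"
proof -
  let ?c = "real (card (cyc_reduced_words k n))" and ?b = "real (n * Suc n) * bead_word_bound n N m \<rho> a"
  have k1: "k \<ge> 1" using k by simp
  have pos: "bead_word_bound n N m \<rho> a \<ge> 0" using \<rho>(1) by (simp add: bead_word_bound_def)
  let ?H = "{v \<in> cyc_reduced_words k n. take a v \<in> readable \<Phi> c}"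
  note rc = readable_card[OF c, of \<Phi>]
  have H: "real (card ?H) \<le> ?b * (2 * (2 * real k - 1) ^ (n - a))"
  proof -
    have "real (card ?H) \<le> real (card (readable \<Phi> c)) * (2 * (2 * real k - 1) ^ (n - a))"
      by (rule card_prefix_in_le[OF rc(1) a(2) k1])
    also have "\<dots> \<le> ?b * (2 * (2 * real k - 1) ^ (n - a))" using rc(2) K by (intro mult_right_mono) auto
    finally show ?thesis .
  qed
  have fH: "finite ?H" by simp
  have sub: "hits \<Phi> c \<subseteq> ?H \<union> inv_word ` ?H"
  proof
    fix v assume "v \<in> hits \<Phi> c"
    hence v: "v \<in> cyc_reduced_words k n" "take a v \<in> readable \<Phi> c \<or> take a (inv_word v) \<in> readable \<Phi> c"
      by (auto simp: hits_def)
    from v(2) show "v \<in> ?H \<union> inv_word ` ?H"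
    proof
      assume "take a (inv_word v) \<in> readable \<Phi> c"
      hence "inv_word v \<in> ?H" using crw_inv_word[OF v(1)] by simp
      hence "inv_word (inv_word v) \<in> inv_word ` ?H" by (rule imageI)
      thus ?thesis by simp
    qed (use v(1) in simp)
  qed
  have "card (hits \<Phi> c) \<le> card (?H \<union> inv_word ` ?H)" using fH by (intro card_mono[OF _ sub]) simp
  also have "\<dots> \<le> card ?H + card (inv_word ` ?H)" by (rule card_Un_le)
  also have "\<dots> \<le> card ?H + card ?H" using card_image_le[OF fH, of inv_word] by simp
  finally have "real (card (hits \<Phi> c)) \<le> (2 * ?b) * (2 * (2 * real k - 1) ^ (n - a))" using H by simp
  from ratio_le[OF a(2) _ this] pos show ?thesis unfolding hit_bound_def by (simp add: mult.assoc)
qed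

lemma bounds_nonneg: "own_bound \<ge> 0" "hit_bound \<ge> 0"
  using K \<rho>(1) unfolding own_bound_def hit_bound_def bead_word_bound_def
  by (intro add_nonneg_nonneg mult_nonneg_nonneg divide_nonneg_nonneg zero_le_power; simp)+

text \<open>The first relator is independent of the others, so \<open>hits\<close> can be regarded
  as fixed when each of the others is drawn; the union bound over them gives the factor (2 * k - 1)
  powr (D * n).\<close>

lemma failure_probability:
  fixes \<Phi> :: "segment \<Rightarrow> 'h fatgraph" and D :: real
  assumes D: "D \<ge> 0"
  shows "1 - measure_pmf.prob (random_relators k D n)
      {R. \<forall>w\<in>R 0. \<forall>Y. beaded_surface C \<delta> L N \<Phi> w Y \<longrightarrow> alpha_convex \<alpha> (R ` {..<num_relators k D n}) Y}
    \<le> real n * own_bound + (2 * real k - 1) powr (D * real n) * (real n * hit_bound)"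
proof -
  define J where "J = num_relators k D n"
  let ?p = "pmf_of_set (cyclic_words k n)" and ?P = "random_relators k D n"
  let ?G = "{R. \<forall>w\<in>R 0. \<forall>Y. beaded_surface C \<delta> L N \<Phi> w Y \<longrightarrow> alpha_convex \<alpha> (R ` {..<J}) Y}"
  \<comment> \<open>This guarantees at least one relator, so that R 0 is indeed drawn at
    random.\<close>
  have Kp: "(2 * real k - 1) powr (D * real n) \<ge> 1" using K D by (intro ge_one_powr_ge_zero) auto
  have J: "J \<ge> 1" "real J \<le> (2 * real k - 1) powr (D * real n)"
    using Kp unfolding J_def num_relators_def by linarith+
  have ne: "cyclic_words k n \<noteq> {}" using card_crw_pos[OF k n] by (auto simp: cyclic_words_def)
  have setp: "set_pmf ?p = cyclic_words k n" by (rule set_pmf_of_set[OF ne finite_cyclic_words])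
  have P: "?P = Pi_pmf {..<J} {} (\<lambda>_. ?p)" by (simp add: random_relators_def J_def)
  have supp: "R j \<in> cyclic_words k n" if "R \<in> set_pmf ?P" "j < J" for R j
    using that set_Pi_pmf_subset'[of "{..<J}" "{}" "\<lambda>_. ?p"] setp unfolding P by (auto simp: PiE_dflt_def)
  define A1 where "A1 = {R :: nat \<Rightarrow> word set. R 0 \<inter> atypical \<Phi> \<noteq> {}}"
  define A2 where "A2 = {R :: nat \<Rightarrow> word set. \<exists>j\<in>{1..<J}. R j \<inter> hits \<Phi> (R 0) \<noteq> {}}"
  have comp: "measure_pmf.prob (Pi_pmf I {} (\<lambda>_. ?p)) {R. R j \<inter> V \<noteq> {}} \<le> real n * (real (card V) / real (card (cyc_reduced_words k n)))"
    if "finite I" "j \<in> I" "V \<subseteq> cyc_reduced_words k n" for I and j :: nat and V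
  proof -
    have "measure_pmf.prob (Pi_pmf I {} (\<lambda>_. ?p)) {R. R j \<inter> V \<noteq> {}}
        = measure_pmf.prob (map_pmf (\<lambda>f. f j) (Pi_pmf I {} (\<lambda>_. ?p))) {c. c \<inter> V \<noteq> {}}"
      by (simp add: vimage_def)
    also have "\<dots> = measure_pmf.prob ?p {c. c \<inter> V \<noteq> {}}" using that by (simp add: Pi_pmf_component)
    also have "\<dots> \<le> real n * (real (card V) / real (card (cyc_reduced_words k n)))"
      by (rule prob_cyclic_word_meets[OF k n that(3)])
    finally show ?thesis .
  qed
  have p1: "measure_pmf.prob ?P A1 \<le> real n * own_bound"
  proof -
    have "measure_pmf.prob ?P A1 \<le> real n * (real (card (atypical \<Phi>)) / real (card (cyc_reduced_words k n)))"
      unfolding P A1_def using J(1) by (intro comp atypical_subset) auto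
    also have "\<dots> \<le> real n * own_bound" by (intro mult_left_mono atypical_ratio) simp
    finally show ?thesis .
  qed
  have p2: "measure_pmf.prob ?P A2 \<le> real J * (real n * hit_bound)"
  proof -
    let ?Q = "Pi_pmf {1..<J} {} (\<lambda>_. ?p)"
    have ins: "{..<J} = insert 0 {1..<J}" using J(1) by auto
    have "measure_pmf.prob ?P A2 = measure_pmf.prob (pair_pmf ?p ?Q) {(y, f). \<exists>j\<in>{1..<J}. f j \<inter> hits \<Phi> y \<noteq> {}}"
    proof -
      have "f(0 := y) \<in> A2 \<longleftrightarrow> (\<exists>j\<in>{1..<J}. f j \<inter> hits \<Phi> y \<noteq> {})" for f y
        unfolding A2_def mem_Collect_eq fun_upd_same by (rule bex_cong) auto
      hence "(\<lambda>(y, f). f(0 := y)) -` A2 = {(y, f). \<exists>j\<in>{1..<J}. f j \<inter> hits \<Phi> y \<noteq> {}}"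
        unfolding vimage_def by (simp add: case_prod_beta')
      thus ?thesis unfolding P ins by (subst Pi_pmf_insert) simp_all
    qed
    also have "\<dots> \<le> real J * (real n * hit_bound)"
    proof (rule prob_pair_pmf_le)
      fix y assume "y \<in> set_pmf ?p"
      hence y: "y \<in> cyclic_words k n" using setp by simp
      have "{f. \<exists>j\<in>{1..<J}. f j \<inter> hits \<Phi> y \<noteq> {}} = (\<Union>j\<in>{1..<J}. {f. f j \<inter> hits \<Phi> y \<noteq> {}})" by auto
      hence "measure_pmf.prob ?Q {f. \<exists>j\<in>{1..<J}. f j \<inter> hits \<Phi> y \<noteq> {}} \<le> (\<Sum>j\<in>{1..<J}. measure_pmf.prob ?Q {f. f j \<inter> hits \<Phi> y \<noteq> {}})"
        by (simp only:) (rule measure_pmf.finite_measure_subadditive_finite; simp)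
      also have "\<dots> \<le> (\<Sum>j\<in>{1..<J}. real n * hit_bound)"
      proof (rule sum_mono)
        fix j assume "j \<in> {1..<J}"
        hence "measure_pmf.prob ?Q {f. f j \<inter> hits \<Phi> y \<noteq> {}} \<le> real n * (real (card (hits \<Phi> y)) / real (card (cyc_reduced_words k n)))"
          by (intro comp) (auto simp: hits_def)
        also have "\<dots> \<le> real n * hit_bound" by (intro mult_left_mono hits_ratio[OF y]) simp
        finally show "measure_pmf.prob ?Q {f. f j \<inter> hits \<Phi> y \<noteq> {}} \<le> real n * hit_bound" .
      qed
      also have "\<dots> = real (card {1..<J}) * (real n * hit_bound)" by simp
      also have "\<dots> \<le> real J * (real n * hit_bound)" using bounds_nonneg by (intro mult_right_mono) auto
      finally show "measure_pmf.prob ?Q {f. \<exists>j\<in>{1..<J}. f j \<inter> hits \<Phi> y \<noteq> {}} \<le> real J * (real n * hit_bound)" .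
    qed (use bounds_nonneg in simp)
    finally show ?thesis .
  qed
  have "1 - measure_pmf.prob ?P ?G = measure_pmf.prob ?P (- ?G)"
    using measure_pmf.prob_compl[of ?G ?P] by (simp add: Compl_eq_Diff_UNIV)
  also have "\<dots> = measure_pmf.prob ?P (- ?G \<inter> set_pmf ?P)" by (rule measure_Int_set_pmf[symmetric])
  also have "\<dots> \<le> measure_pmf.prob ?P (A1 \<union> A2)"
  proof (rule measure_pmf.finite_measure_mono)
    show "- ?G \<inter> set_pmf ?P \<subseteq> A1 \<union> A2"
    proof
      fix R assume R: "R \<in> - ?G \<inter> set_pmf ?P"
      show "R \<in> A1 \<union> A2"
      proof (rule ccontr)
        assume "R \<notin> A1 \<union> A2"
        hence "R 0 \<inter> atypical \<Phi> = {}" "\<And>j. 1 \<le> j \<Longrightarrow> j < J \<Longrightarrow> R j \<inter> hits \<Phi> (R 0) = {}"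
          by (auto simp: A1_def A2_def)
        hence "R \<in> ?G" using alpha_convex_typical[of J R \<Phi>] supp R J(1) by auto
        thus False using R by blast
      qed
    qed
  qed simp
  also have "\<dots> \<le> measure_pmf.prob ?P A1 + measure_pmf.prob ?P A2" by (rule measure_Un_le) simp_all
  also have "\<dots> \<le> real n * own_bound + (2 * real k - 1) powr (D * real n) * (real n * hit_bound)"
  proof -
    have "real J * (real n * hit_bound) \<le> (2 * real k - 1) powr (D * real n) * (real n * hit_bound)"
      using J(2) bounds_nonneg by (intro mult_right_mono) auto
    thus ?thesis using p1 p2 by linarith
  qed
  finally show ?thesis unfolding J_def .
qed

end

section \<open>Asymptotics\<close>

text \<open>A power of n and the constant \<kappa> are absorbed by lowering the exponent d to
  e.\<close>

lemma eventually_powr_exp_le: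
  assumes "0 < e" "e < d" "0 < \<kappa>"
  shows "eventually (\<lambda>n::nat. real n powr p * exp (- \<kappa> * real n powr d) \<le> exp (- (real n powr e))) sequentially"
proof -
  have "eventually (\<lambda>n::nat. p * ln (real n) + real n powr e \<le> \<kappa> * real n powr d) sequentially"
    using assms by real_asymp
  thus ?thesis using eventually_ge_at_top[of "1::nat"]
  proof eventually_elim
    case (elim n)
    have "real n powr p * exp (- \<kappa> * real n powr d) = exp (p * ln (real n) - \<kappa> * real n powr d)"
      using elim(2) by (simp add: powr_def exp_diff exp_minus field_simps)
    also have "\<dots> \<le> exp (- (real n powr e))" using elim(1) by simp
    finally show ?case .
  qed
qed

text \<open>Rounding the exponent down costs at most a factor 1 / x.\<close>

lemma power_le_exp_neg:
  fixes x y :: real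
  assumes "0 < x" "x < 1" "y - 1 \<le> real l"
  shows "x ^ l \<le> exp (- (- ln x) * y) / x"
proof -
  have "x ^ l = x powr real l" using assms(1) by (simp add: powr_realpow)
  also have "\<dots> \<le> x powr (y - 1)" using assms by (intro powr_mono') auto
  also have "\<dots> = exp (- (- ln x) * y) / x" using assms(1) by (simp add: powr_def algebra_simps exp_diff)
  finally show ?thesis .
qed

text \<open>\<open>half_window\<close> leaves a quarter of the path, about \<alpha> * n / 4 letters,
  while q gaps of n powr (1 - \<delta>) / 2 letters with q about \<alpha> / 16 * n powr \<delta>
  take only \<alpha> * n / 32; the rest is of lower order.\<close>

lemma eventually_scales:
  fixes k N L :: nat and \<alpha> C \<delta> \<rho> :: real
  assumes k: "k \<ge> 2" and \<alpha>: "0 < \<alpha>" "\<alpha> \<le> 1" and C: "C > 0" and \<delta>: "0 < \<delta>" "\<delta> < 1 / 2"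
    and e: "0 < e" "e < 1 - \<delta>" and \<rho>: "\<rho> \<ge> 1" "\<rho> ^ L = 2" and L: "L \<ge> 1"
  shows "eventually (\<lambda>n. scales k n (lip_length C n) (stem_length \<delta> n) (scan_length \<delta> n) (nat \<lfloor>real n powr e\<rfloor>)
    (nat \<lfloor>\<alpha> / 16 * real n powr \<delta>\<rfloor>) (nat \<lceil>\<alpha> * real n\<rceil>) L N C \<delta> \<alpha> \<rho>) sequentially"
proof -
  have e1: "e < 1" using e \<delta> by simp
  have "eventually (\<lambda>n::nat. real n powr e + C * ln (real n) + 2 \<le> real n powr (1 - \<delta>) * (1 / 2 - real n powr (- \<delta>)) - 1) sequentially"
    using assms by real_asymp
  moreover have "eventually (\<lambda>n::nat. (\<alpha> / 16 * real n powr \<delta> + 6) * (real n powr (1 - \<delta>) / 2) + 2 * real n powr e + C * ln (real n) + 12 \<le> \<alpha> * real n / 4) sequentially"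
    using assms by real_asymp
  moreover have "eventually (\<lambda>n::nat. C * ln (real n) - 1 \<ge> max 2 (real (L * (4 * N)))) sequentially"
    using C by real_asymp
  moreover have "eventually (\<lambda>n::nat. 2 * real n powr e \<le> real n) sequentially" using e e1 by real_asymp
  moreover have "eventually (\<lambda>n::nat. \<alpha> / 16 * real n powr \<delta> \<ge> 2) sequentially" using \<alpha> \<delta> by real_asymp
  moreover have "eventually (\<lambda>n::nat. 4 * (C * ln (real n) + 1) \<le> real n powr (1 - \<delta>)) sequentially" using C \<delta> by real_asymp
  ultimately show ?thesis using eventually_ge_at_top[of "2::nat"]
  proof eventually_elim
    case (elim n)
    define m st sc l q a where "m = lip_length C n" and "st = stem_length \<delta> n" and "sc = scan_length \<delta> n"
      and "l = nat \<lfloor>real n powr e\<rfloor>" and "q = nat \<lfloor>\<alpha> / 16 * real n powr \<delta>\<rfloor>" and "a = nat \<lceil>\<alpha> * real n\<rceil>"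
    have ln: "ln (real n) \<ge> 0" using elim(7) by simp
    have m: "real m \<le> C * ln (real n)" "C * ln (real n) - 1 \<le> real m"
      using C ln unfolding m_def lip_length_def by (simp, linarith)
    have l: "real l \<le> real n powr e" unfolding l_def by simp
    have pw: "real n powr e \<ge> 1" using elim(7) e(1) by (intro ge_one_powr_ge_zero) auto
    hence l1: "l \<ge> 1" unfolding l_def by linarith
    have q: "real q \<le> \<alpha> / 16 * real n powr \<delta>" "q \<ge> 1" using elim(5) unfolding q_def by linarith+
    define x y where "x = real n powr (1 - \<delta>) * (1 / 2 - real n powr (- \<delta>))" and "y = real n powr (1 - 2 * \<delta>)"
    \<comment> \<open>Stem and scan together make up half the length of a bead: the stem is
      shortened by just what the scan may add.\<close>
    have xy: "x + y = real n powr (1 - \<delta>) / 2"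
    proof -
      have "real n powr (1 - \<delta>) * real n powr (- \<delta>) = y" unfolding y_def by (simp flip: powr_add)
      thus ?thesis by (simp add: x_def right_diff_distrib)
    qed
    have x: "real n powr e + C * ln (real n) + 2 \<le> x - 1" using elim(1) by (simp add: x_def)
    have x0: "x \<ge> 0" using x pw C ln by (smt (verit) mult_nonneg_nonneg)
    have st: "real st \<le> x" "x - 1 \<le> real st" using x0 unfolding st_def stem_length_def x_def[symmetric] by linarith+
    have y0: "y \<ge> 0" by (simp add: y_def)
    have sc: "real sc \<le> y" "y - 1 \<le> real sc" using y0 unfolding sc_def scan_length_def y_def[symmetric] by linarith+
    have a: "\<alpha> * real n \<le> real a" "a \<le> n"
    proof -
      show "\<alpha> * real n \<le> real a" unfolding a_def by linarith
      have "\<alpha> * real n \<le> real n" using \<alpha> by (simp add: mult_left_le_one_le)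
      thus "a \<le> n" unfolding a_def by linarith
    qed
    have "scales k n m st sc l q a L N C \<delta> \<alpha> \<rho>"
    proof
      show "2 \<le> m" using m(2) elim(3) by simp
      show "2 * l \<le> n" using l elim(4) by linarith
      have "real (l + m + 2) \<le> real st" using l m(1) x st(2) by simp
      thus "l + m + 2 \<le> st" by (simp only: of_nat_le_iff)
      show "\<rho> ^ m \<ge> 4 * real N"
      proof -
        \<comment> \<open>As \<rho> ^ L = 2, a length m >= 4 * N * L gives \<rho> ^ m >= 2 ^ (4 * N)
          >= 4 * N.\<close>
        have "real (L * (4 * N)) \<le> real m" using m(2) elim(3) by simp
        hence "L * (4 * N) \<le> m" by (simp only: of_nat_le_iff)
        hence "\<rho> ^ (L * (4 * N)) \<le> \<rho> ^ m" by (rule power_increasing[OF _ \<rho>(1)])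
        moreover have "\<rho> ^ (L * (4 * N)) = 2 ^ (4 * N)" by (simp only: power_mult \<rho>(2))
        moreover have "real (4 * N) \<le> 2 ^ (4 * N)" using of_nat_less_two_power[of "4 * N", where ?'a = real] by simp
        ultimately show ?thesis by simp
      qed
      show "4 * (real m + 1) \<le> real n powr (1 - \<delta>)" using m(1) elim(6) by simp
      show "3 / 2 * real n powr (1 - \<delta>) \<le> 3 * real (st + sc) + 6" using st(2) sc(2) xy by simp
      show "(q + 6) * (st + sc) + 2 * l + m + 10 \<le> a div 4"
      proof -
        have "(real q + 6) * (real st + real sc) \<le> (\<alpha> / 16 * real n powr \<delta> + 6) * (real n powr (1 - \<delta>) / 2)"
          using q(1) st(1) sc(1) xy \<alpha> by (intro mult_mono) auto
        hence "(real q + 6) * (real st + real sc) + 2 * real l + real m + 12 \<le> \<alpha> * real n / 4"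
          using l m(1) elim(2) by linarith
        hence "(real q + 6) * (real st + real sc) + 2 * real l + real m + 12 \<le> real a / 4" using a(1) by linarith
        \<comment> \<open>The surplus of 12 over 10 absorbs the rounding in
          \<open>a div 4\<close>.\<close>
        hence "real ((q + 6) * (st + sc) + 2 * l + m + 12) \<le> real a / 4" by simp
        thus ?thesis by linarith
      qed
    qed (use k elim(7) l1 q(2) \<rho> L a(2) \<alpha>(1) in \<open>simp_all add: m_def st_def sc_def a_def\<close>)
    thus ?case unfolding m_def st_def sc_def l_def q_def a_def .
  qed
qed

section \<open>The four error terms\<close>

context
  fixes k N L :: nat and D \<alpha> C \<delta> \<rho> e :: real
  assumes k: "k \<ge> 2" and D: "0 < D" "D < \<alpha>" and \<alpha>: "\<alpha> \<le> 1" and C: "C > 0" and \<delta>: "0 < \<delta>"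
    and C\<delta>: "C * ln (2 * real k - 1) < 1 - 2 * \<delta>"
    and e: "e = C * ln (2 * real k - 1) / 2"
    and \<rho>: "\<rho> \<ge> 1" "\<rho> \<le> 2" "\<rho> ^ L = 2" and L: "L \<ge> 1"
    and \<rho>K: "\<alpha> * ln \<rho> \<le> (\<alpha> - D) * ln (2 * real k - 1) / 2"
begin

abbreviation "K \<equiv> 2 * real k - 1"

lemma K3: "K \<ge> 3" using k by simp
lemma lnK: "ln K > 0" using K3 by simp
lemma e_pos: "e > 0" "2 * e < 1 - 2 * \<delta>" using lnK C C\<delta> by (auto simp: e)

text \<open>Since \<rho> \<le> 2 and m is at most C * ln n, the factor \<rho> ^ m is bounded by a
  power of n, and only \<rho> ^ l is left.\<close>

lemma eventually_bead_word_bound: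
  "eventually (\<lambda>n. \<forall>l. bead_word_bound n N (lip_length C n) \<rho> l \<le> real n powr (3 + C) * \<rho> ^ l) sequentially"
proof -
  have "eventually (\<lambda>n::nat. (real n + 1) * (2 * real N * (real n + 2) + 2 * real n) * 2 \<le> real n powr 3) sequentially"
    by real_asymp
  moreover have "eventually (\<lambda>n::nat. C * ln (real n) \<le> real n) sequentially" by real_asymp
  ultimately show ?thesis using eventually_ge_at_top[of "1::nat"]
  proof eventually_elim
    case (elim n)
    have ln: "ln (real n) \<ge> 0" using elim(3) by simp
    define m where "m = lip_length C n"
    have m: "real m \<le> C * ln (real n)" using C ln unfolding m_def lip_length_def by simp
    have "\<rho> ^ m \<le> 2 ^ m" using \<rho> by (intro power_mono) auto
    also have "(2::real) ^ m = exp (real m * ln 2)" by (simp add: exp_of_nat_mult)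
    also have "\<dots> \<le> exp (C * ln (real n) * 1)"
      using m ln C ln_2_less_1 by (intro iffD2[OF exp_le_cancel_iff] mult_mono) auto
    also have "\<dots> = real n powr C" using elim(3) by (simp add: powr_def)
    finally have rm: "\<rho> ^ m \<le> real n powr C" .
    have mn: "real m \<le> real n" using m elim(2) by linarith
    show ?case
    proof
      fix l
      have "bead_word_bound n N m \<rho> l = ((real n + 1) * (2 * real N * (real n + 2) + 2 * real m) * 2) * \<rho> ^ m * \<rho> ^ l"
        by (simp add: bead_word_bound_def algebra_simps)
      also have "\<dots> \<le> real n powr 3 * real n powr C * \<rho> ^ l"
      proof (intro mult_right_mono mult_mono)
        have "(real n + 1) * (2 * real N * (real n + 2) + 2 * real m) * 2 \<le> (real n + 1) * (2 * real N * (real n + 2) + 2 * real n) * 2"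
          using mn by (intro mult_right_mono mult_left_mono) auto
        thus "(real n + 1) * (2 * real N * (real n + 2) + 2 * real m) * 2 \<le> real n powr 3" using elim(1) by linarith
      qed (use rm \<rho> in auto)
      finally show "bead_word_bound n N (lip_length C n) \<rho> l \<le> real n powr (3 + C) * \<rho> ^ l"
        by (simp add: powr_add m_def)
    qed
  qed
qed

lemma rK: "0 < \<rho> / K" "\<rho> / K \<le> 2 / 3" "\<rho> / K < 1"
proof -
  show "0 < \<rho> / K" using \<rho> K3 by simp
  show "\<rho> / K \<le> 2 / 3" using \<rho> K3 by (intro frac_le) auto
  thus "\<rho> / K < 1" by (rule order.strict_trans1) simp
qed

text \<open>As \<rho> \<le> 2 and K >= 3, each letter of the window contributes at most a factor 2 /
  3.\<close>

lemma eventually_stray_bound: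
  assumes c: "0 < c" "c < e"
  shows "eventually (\<lambda>n. real n * (2 * (real (Suc n ^ 5) * bead_word_bound n N (lip_length C n) \<rho> (nat \<lfloor>real n powr e\<rfloor>) *
    (2 * K\<^sup>2 / K ^ nat \<lfloor>real n powr e\<rfloor>))) \<le> exp (- (real n powr c))) sequentially"
proof -
  define \<kappa> where "\<kappa> = - ln (2 / 3 :: real)"
  have \<kappa>: "\<kappa> > 0" by (simp add: \<kappa>_def)
  have "eventually (\<lambda>n::nat. real n * (2 * ((real n + 1) ^ 5 * (2 * K\<^sup>2))) * (3 / 2) \<le> real n powr 7) sequentially"
    by real_asymp
  moreover note eventually_bead_word_bound eventually_powr_exp_le[OF c \<kappa>, of "7 + (3 + C)"]
  ultimately show ?thesis using eventually_ge_at_top[of "1::nat"]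
  proof eventually_elim
    case (elim n)
    define l where "l = nat \<lfloor>real n powr e\<rfloor>"
    have l: "real n powr e - 1 \<le> real l" unfolding l_def by linarith
    have Kl: "K ^ l > 0" using K3 by simp
    have "real n * (2 * (real (Suc n ^ 5) * bead_word_bound n N (lip_length C n) \<rho> l * (2 * K\<^sup>2 / K ^ l)))
      \<le> real n * (2 * (real (Suc n ^ 5) * (real n powr (3 + C) * \<rho> ^ l) * (2 * K\<^sup>2 / K ^ l)))"
      using elim(2) K3 by (intro mult_left_mono mult_right_mono) auto
    also have "\<dots> = real n * (2 * ((real n + 1) ^ 5 * (2 * K\<^sup>2))) * real n powr (3 + C) * (\<rho> / K) ^ l"
      using Kl by (simp add: power_divide algebra_simps)
    also have "\<dots> \<le> real n * (2 * ((real n + 1) ^ 5 * (2 * K\<^sup>2))) * real n powr (3 + C) * (exp (- \<kappa> * real n powr e) / (2 / 3))"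
    proof (rule mult_left_mono)
      have "(\<rho> / K) ^ l \<le> (2 / 3) ^ l" using rK by (intro power_mono) auto
      also have "\<dots> \<le> exp (- \<kappa> * real n powr e) / (2 / 3)"
        using power_le_exp_neg[OF _ _ l, of "2 / 3"] by (simp add: \<kappa>_def)
      finally show "(\<rho> / K) ^ l \<le> exp (- \<kappa> * real n powr e) / (2 / 3)" .
    qed simp
    also have "\<dots> = (real n * (2 * ((real n + 1) ^ 5 * (2 * K\<^sup>2))) * (3 / 2)) * real n powr (3 + C) * exp (- \<kappa> * real n powr e)" by simp
    also have "\<dots> \<le> real n powr 7 * real n powr (3 + C) * exp (- \<kappa> * real n powr e)"
      using elim(1) by (intro mult_right_mono) auto
    also have "\<dots> = real n powr (7 + (3 + C)) * exp (- \<kappa> * real n powr e)" by (simp only: powr_add)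
    also have "\<dots> \<le> exp (- (real n powr c))" by (rule elim(3))
    finally show ?case unfolding l_def .
  qed
qed

text \<open>A lip has about n powr (2 * e) labels, against 2 * (2 * l + 1) places for an echo with l
  about n powr e. The quotient is eventually at most 1 / 2, which suffices because the number of
  lips is of order n powr \<delta>.\<close>

lemma eventually_echo_bound:
  assumes c: "0 < c" "c < \<delta>"
  shows "eventually (\<lambda>n. real n * (real (Suc n) * (real (2 * (2 * nat \<lfloor>real n powr e\<rfloor> + 1)) / K ^ (lip_length C n - 2)) ^ nat \<lfloor>\<alpha> / 16 * real n powr \<delta>\<rfloor>)
    \<le> exp (- (real n powr c))) sequentially"
proof -
  define \<kappa> where "\<kappa> = ln 2 * (\<alpha> / 16)"
  have \<kappa>: "\<kappa> > 0" using D by (simp add: \<kappa>_def)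
  \<comment> \<open>The factor K ^ 3 covers K ^ 2 lost in the exponent m - 2 and K lost in rounding
    down the length of the lips.\<close>
  have "eventually (\<lambda>n::nat. 8 * (real n powr (C * ln K / 2) + 2) * K ^ 3 \<le> real n powr (C * ln K)) sequentially"
    using C K3 by real_asymp
  moreover have "eventually (\<lambda>n::nat. real n * (real n + 1) * 2 \<le> real n powr 3) sequentially" by real_asymp
  moreover have "eventually (\<lambda>n::nat. C * ln (real n) \<ge> 3) sequentially" using C by real_asymp
  moreover note eventually_powr_exp_le[OF c \<kappa>, of 3]
  ultimately show ?thesis using eventually_ge_at_top[of "1::nat"]
  proof eventually_elim
    case (elim n)
    define l m q where "l = nat \<lfloor>real n powr e\<rfloor>" and "m = lip_length C n" and "q = nat \<lfloor>\<alpha> / 16 * real n powr \<delta>\<rfloor>"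
    have l: "real l \<le> real n powr e" by (simp add: l_def)
    have m: "C * ln (real n) - 1 \<le> real m" unfolding m_def lip_length_def by linarith
    have m2: "m \<ge> 2" using m elim(3) by linarith
    have q: "\<alpha> / 16 * real n powr \<delta> - 1 \<le> real q" unfolding q_def by linarith
    have Kp: "K > 0" using K3 by simp
    have "real n powr (C * ln K) = exp (ln K * (C * ln (real n)))" using elim(5) by (simp add: powr_def mult_ac)
    also have "\<dots> \<le> exp (ln K * (real m + 1))" using m lnK by simp
    also have "\<dots> = K ^ (m + 1)" using Kp by (simp add: exp_of_nat_mult algebra_simps exp_add flip: exp_of_nat2_mult)
    also have "m + 1 = (m - 2) + 3" using m2 by simp
    finally have KK: "real n powr (C * ln K) \<le> K ^ (m - 2) * K ^ 3" by (simp only: power_add)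
    have "8 * (real n powr e + 2) * K ^ 3 \<le> K ^ (m - 2) * K ^ 3"
      using elim(1) KK unfolding e by linarith
    hence "8 * (real n powr e + 2) \<le> K ^ (m - 2)" using Kp by simp
    moreover have "2 * real (2 * (2 * l + 1)) \<le> 8 * (real n powr e + 2)" using l by simp
    ultimately have "2 * real (2 * (2 * l + 1)) \<le> K ^ (m - 2)" by linarith
    hence \<theta>: "real (2 * (2 * l + 1)) / K ^ (m - 2) \<le> 1 / 2" using Kp by (simp add: field_simps)
    have "real n * (real (Suc n) * (real (2 * (2 * l + 1)) / K ^ (m - 2)) ^ q) \<le> real n * (real (Suc n) * (1 / 2) ^ q)"
      using \<theta> Kp by (intro mult_left_mono power_mono) auto
    also have "\<dots> \<le> real n * (real (Suc n) * (exp (- \<kappa> * real n powr \<delta>) / (1 / 2)))"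
    proof (intro mult_left_mono)
      show "(1 / 2) ^ q \<le> exp (- \<kappa> * real n powr \<delta>) / (1 / 2)"
        using power_le_exp_neg[OF _ _ q, of "1 / 2"] by (simp add: \<kappa>_def ln_div mult.assoc)
    qed auto
    also have "\<dots> = (real n * (real n + 1) * 2) * exp (- \<kappa> * real n powr \<delta>)" by (simp add: algebra_simps)
    also have "\<dots> \<le> real n powr 3 * exp (- \<kappa> * real n powr \<delta>)" using elim(2) by (intro mult_right_mono) auto
    also have "\<dots> \<le> exp (- (real n powr c))" by (rule elim(4))
    finally show ?case unfolding l_def m_def q_def .
  qed
qed

lemma eventually_repeat_bound:
  assumes c: "0 < c" "c < e"
  shows "eventually (\<lambda>n. real n * (2 * (real (n ^ 2) * (2 * K\<^sup>2 / K ^ nat \<lfloor>real n powr e\<rfloor>)) + real (n ^ 2) * (2 * K\<^sup>2 / K ^ (nat \<lfloor>real n powr e\<rfloor> div 2)))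
    \<le> exp (- (real n powr c))) sequentially"
proof -
  define \<kappa> :: real where "\<kappa> = ln 3 / 2"
  have \<kappa>: "\<kappa> > 0" by (simp add: \<kappa>_def)
  have "eventually (\<lambda>n::nat. real n * (3 * (real n ^ 2 * (2 * K\<^sup>2))) * 3 \<le> real n powr 4) sequentially" by real_asymp
  moreover note eventually_powr_exp_le[OF c \<kappa>, of 4]
  ultimately show ?thesis
  proof eventually_elim
    case (elim n)
    define l where "l = nat \<lfloor>real n powr e\<rfloor>"
    have l: "real n powr e - 1 \<le> real l" unfolding l_def by linarith
    have h: "real n powr e / 2 - 1 \<le> real (l div 2)" using l by linarith
    have K1: "K \<ge> 1" using K3 by simp
    have Kh: "1 / K ^ (l div 2) \<le> exp (- \<kappa> * real n powr e) * 3"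
    proof -
      have "1 / K ^ (l div 2) \<le> 1 / 3 ^ (l div 2)" using K3 by (intro divide_left_mono power_mono) auto
      also have "\<dots> = (1 / 3) ^ (l div 2)" by (simp add: power_one_over)
      also have "\<dots> \<le> exp (- \<kappa> * real n powr e) * 3"
        using power_le_exp_neg[OF _ _ h, of "1 / 3"] by (simp add: \<kappa>_def ln_div)
      finally show ?thesis .
    qed
    have Kl: "1 / K ^ l \<le> 1 / K ^ (l div 2)" using K1 K3 by (intro divide_left_mono power_increasing) auto
    have "real n * (2 * (real (n ^ 2) * (2 * K\<^sup>2 / K ^ l)) + real (n ^ 2) * (2 * K\<^sup>2 / K ^ (l div 2)))
      = real n * (real n ^ 2 * (2 * K\<^sup>2)) * (2 * (1 / K ^ l) + 1 / K ^ (l div 2))" by (simp add: algebra_simps)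
    also have "\<dots> \<le> real n * (real n ^ 2 * (2 * K\<^sup>2)) * (3 * (exp (- \<kappa> * real n powr e) * 3))"
      using Kl Kh by (intro mult_left_mono) auto
    also have "\<dots> = (real n * (3 * (real n ^ 2 * (2 * K\<^sup>2))) * 3) * exp (- \<kappa> * real n powr e)" by simp
    also have "\<dots> \<le> real n powr 4 * exp (- \<kappa> * real n powr e)" using elim(1) by (intro mult_right_mono) auto
    also have "\<dots> \<le> exp (- (real n powr c))" by (rule elim(2))
    finally show ?case unfolding l_def .
  qed
qed

text \<open>The relators and the prescribed letters contribute (D - \<alpha>) * n * ln K to the
  exponent, the number of paths adds \<alpha> * n * ln \<rho>, and by the choice of L this is at
  most half as large.\<close>

lemma eventually_hit_bound:
  assumes c: "0 < c" "c < 1"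
  shows "eventually (\<lambda>n. K powr (D * real n) * (real n * (2 * (real (n * Suc n) * bead_word_bound n N (lip_length C n) \<rho> (nat \<lceil>\<alpha> * real n\<rceil>) *
    (2 * K\<^sup>2 / K ^ nat \<lceil>\<alpha> * real n\<rceil>)))) \<le> exp (- (real n powr c))) sequentially"
proof -
  define \<kappa> where "\<kappa> = (\<alpha> - D) * ln K / 2"
  have \<kappa>: "\<kappa> > 0" using D lnK by (simp add: \<kappa>_def)
  have "eventually (\<lambda>n::nat. real n * (2 * (real n * (real n + 1) * (2 * K\<^sup>2))) \<le> real n powr 4) sequentially" by real_asymp
  moreover note eventually_bead_word_bound eventually_powr_exp_le[OF c \<kappa>, of "4 + (3 + C)"]
  ultimately show ?thesis using eventually_ge_at_top[of "1::nat"]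
  proof eventually_elim
    case (elim n)
    define a where "a = nat \<lceil>\<alpha> * real n\<rceil>"
    have a: "\<alpha> * real n \<le> real a" unfolding a_def by linarith
    have Kp: "K > 0" using K3 by simp
    have Ka: "K ^ a > 0" using Kp by simp
    have X: "K powr (D * real n) * (\<rho> / K) ^ a \<le> exp (- \<kappa> * real n powr 1)"
    proof -
      have "(\<rho> / K) ^ a = (\<rho> / K) powr real a" using rK(1) by (simp add: powr_realpow)
      also have "\<dots> \<le> (\<rho> / K) powr (\<alpha> * real n)" using rK(1) less_imp_le[OF rK(3)] a by (intro powr_mono') auto
      also have "\<dots> = exp (\<alpha> * real n * (ln \<rho> - ln K))" using rK(1) \<rho>(1) Kp by (simp add: powr_def ln_div)
      finally have "K powr (D * real n) * (\<rho> / K) ^ a \<le> K powr (D * real n) * exp (\<alpha> * real n * (ln \<rho> - ln K))"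
        by (intro mult_left_mono) auto
      also have "\<dots> = exp (real n * (D * ln K + \<alpha> * ln \<rho> - \<alpha> * ln K))"
        using Kp by (simp add: powr_def algebra_simps flip: exp_add)
      also have "\<dots> \<le> exp (real n * (- \<kappa>))"
      proof -
        have "D * ln K + \<alpha> * ln \<rho> - \<alpha> * ln K \<le> - \<kappa>" using \<rho>K by (simp add: \<kappa>_def field_simps)
        thus ?thesis by (intro iffD2[OF exp_le_cancel_iff] mult_left_mono) auto
      qed
      finally show ?thesis using elim(4) by (simp add: mult.commute)
    qed
    have "K powr (D * real n) * (real n * (2 * (real (n * Suc n) * bead_word_bound n N (lip_length C n) \<rho> a * (2 * K\<^sup>2 / K ^ a))))
      \<le> K powr (D * real n) * (real n * (2 * (real (n * Suc n) * (real n powr (3 + C) * \<rho> ^ a) * (2 * K\<^sup>2 / K ^ a))))"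
      using elim(2) K3 by (intro mult_left_mono mult_right_mono) auto
    also have "\<dots> = (real n * (2 * (real n * (real n + 1) * (2 * K\<^sup>2)))) * real n powr (3 + C) * (K powr (D * real n) * (\<rho> / K) ^ a)"
      using Ka by (simp add: power_divide algebra_simps)
    also have "\<dots> \<le> real n powr 4 * real n powr (3 + C) * exp (- \<kappa> * real n powr 1)"
      using elim(1) X Kp rK(1) by (intro mult_mono mult_right_mono) auto
    also have "\<dots> = real n powr (4 + (3 + C)) * exp (- \<kappa> * real n powr 1)" by (simp only: powr_add)
    also have "\<dots> \<le> exp (- (real n powr c))" by (rule elim(3))
    finally show ?case unfolding a_def .
  qed
qed

lemma failure_bigo:
  fixes \<Phi> :: "nat \<Rightarrow> segment \<Rightarrow> 'h fatgraph"
  assumes c: "0 < c" "c < e" "c < \<delta>"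
  shows "(\<lambda>n. 1 - measure_pmf.prob (random_relators k D n)
         (convex_event k D C \<delta> \<alpha> L N (\<Phi> n) n))
      \<in> O(\<lambda>n. exp (- (real n powr c)))"
proof (rule bigoI[where c = 4])
  have \<delta>2: "\<delta> < 1 / 2" using e_pos by simp
  have e2: "e < 1 - \<delta>" using e_pos \<delta> by simp
  have c1: "c < 1" using c \<delta>2 by simp
  have \<alpha>0: "0 < \<alpha>" using D by simp
  show "eventually (\<lambda>n. norm (1 - measure_pmf.prob (random_relators k D n)
         (convex_event k D C \<delta> \<alpha> L N (\<Phi> n) n))
      \<le> 4 * norm (exp (- (real n powr c)))) sequentially"
    using eventually_scales[OF k \<alpha>0 \<alpha> C \<delta> \<delta>2 e_pos(1) e2 \<rho>(1,3) L, of N] eventually_stray_bound[OF c(1,2)]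
      eventually_echo_bound[OF c(1,3)] eventually_repeat_bound[OF c(1,2)] eventually_hit_bound[OF c(1) c1]
  proof eventually_elim
    case (elim n)
    let ?p = "measure_pmf.prob (random_relators k D n)
         (convex_event k D C \<delta> \<alpha> L N (\<Phi> n) n)"
    have D0: "0 \<le> D" using D by simp
    note fp = scales.failure_probability[OF elim(1) D0, of "\<Phi> n"]
    have comb: "p \<le> 4 * x" if "p \<le> y * (r + s + t + u) + z" "y * r \<le> x" "y * s \<le> x" "y * (t + u) \<le> x" "z \<le> x"
      for p x y z r s t u :: real
      using that by (simp add: distrib_left)
    have "1 - ?p \<le> 4 * exp (- (real n powr c))"
      by (rule comb[OF fp[unfolded scales.own_bound_def[OF elim(1)] scales.hit_bound_def[OF elim(1)]] elim(2-5)])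
    moreover have "?p \<le> 1" by simp
    ultimately show ?case by simp
  qed
qed

end

section \<open>The choice of the constants\<close>

lemma alpha_convex_mono: "\<alpha> \<le> \<beta> \<Longrightarrow> alpha_convex \<alpha> Rels Y \<Longrightarrow> alpha_convex \<beta> Rels Y"
  unfolding alpha_convex_def by (meson order.trans)

theorem lemma6p2p1:
  fixes k :: nat and D \<alpha> C \<delta> :: real
  assumes "k \<ge> 2" and "0 < D" and "D < 1" and "\<alpha> > D"
    and "C > 0" and "\<delta> > 0" and "C < (1 - 2 * \<delta>) / ln (2 * real k - 1)"
  shows "\<exists>c>0. \<exists>L0::nat. \<forall>L\<ge>L0. \<forall>N::nat. N \<ge> 1 \<longrightarrow>
    (\<forall>\<Phi> :: nat \<Rightarrow> segment \<Rightarrow> nat fatgraph.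
      (\<lambda>n. 1 - measure_pmf.prob (random_relators k D n)
         {R. \<forall>w \<in> R 0. \<forall>Y. beaded_surface C \<delta> L N (\<Phi> n) w Y \<longrightarrow>
               alpha_convex \<alpha> (R ` {..<num_relators k D n}) Y})
      \<in> O(\<lambda>n. exp (- (real n powr c))))"
proof -
  define K where "K = 2 * real k - 1"
  \<comment> \<open>A constant \<alpha> > 1 is lowered to 1, so that subwords of \<beta> * n letters
    fit into words of length n.\<close>
  define \<beta> where "\<beta> = min \<alpha> 1"
  define e where "e = C * ln K / 2"
  \<comment> \<open>The exponent e comes from windows of length n powr e, the exponent \<delta> from
    the number of lips; halving makes c strictly smaller than both.\<close>
  define c where "c = min e \<delta> / 2"
  \<comment> \<open>The threshold for L, at which \<beta> * ln 2 / L equals (\<beta> - D) * ln K /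
    2.\<close>
  define x where "x = 2 * ln 2 * \<beta> / ((\<beta> - D) * ln K)"
  have K: "K \<ge> 3" using assms(1) by (simp add: K_def)
  hence lnK: "ln K > 0" by simp
  have \<beta>: "D < \<beta>" "\<beta> \<le> 1" "\<beta> \<le> \<alpha>" using assms(3,4) by (auto simp: \<beta>_def)
  have C: "C * ln K < 1 - 2 * \<delta>" using assms(7) lnK by (simp add: K_def pos_less_divide_eq)
  have e: "e > 0" using assms(5) lnK by (simp add: e_def)
  have c: "0 < c" "c < e" "c < \<delta>" using e assms(6) by (auto simp: c_def min_def)
  have "(\<lambda>n. 1 - measure_pmf.prob (random_relators k D n)
         (convex_event k D C \<delta> \<alpha> L N (\<Phi> n) n))
      \<in> O(\<lambda>n. exp (- (real n powr c)))"
    if L: "L \<ge> max 1 (nat \<lceil>x\<rceil>)" for L N :: nat and \<Phi> :: "nat \<Rightarrow> segment \<Rightarrow> nat fatgraph"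
  proof -
    define \<rho> :: real where "\<rho> = 2 powr (1 / real L)"
    have L1: "L \<ge> 1" "x \<le> real L" using L by (simp, linarith)
    have \<rho>1: "\<rho> \<ge> 1" unfolding \<rho>_def by (intro ge_one_powr_ge_zero) auto
    have \<rho>L: "\<rho> ^ L = 2"
      using L1(1) by (simp add: \<rho>_def powr_powr flip: powr_realpow)
    have \<rho>2: "\<rho> \<le> 2"
    proof -
      have "\<rho> \<le> 2 powr 1" unfolding \<rho>_def using L1(1) by (intro powr_mono) auto
      thus ?thesis by simp
    qed
    have ln\<rho>: "\<beta> * ln \<rho> \<le> (\<beta> - D) * ln K / 2"
    proof -
      have "2 * ln 2 * \<beta> \<le> real L * ((\<beta> - D) * ln K)"
        using L1(2) \<beta>(1) lnK by (simp add: x_def pos_divide_le_eq)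
      moreover have "ln \<rho> = ln 2 / real L" by (simp add: \<rho>_def ln_powr)
      moreover have "\<beta> * (ln 2 / real L) = 2 * ln 2 * \<beta> / (2 * real L)" by simp
      moreover have "(\<beta> - D) * ln K / 2 = real L * ((\<beta> - D) * ln K) / (2 * real L)" using L1(1) by simp
      ultimately show ?thesis by (simp only:) (rule divide_right_mono; simp)
    qed
    have "(\<lambda>n. 1 - measure_pmf.prob (random_relators k D n)
         (convex_event k D C \<delta> \<alpha> L N (\<Phi> n) n))
      \<in> O(\<lambda>n. 1 - measure_pmf.prob (random_relators k D n)
         (convex_event k D C \<delta> \<beta> L N (\<Phi> n) n))"
    proof (intro landau_o.big_mono always_eventually allI)
      fix n
      have "measure_pmf.prob (random_relators k D n)
         (convex_event k D C \<delta> \<beta> L N (\<Phi> n) n)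
        \<le> measure_pmf.prob (random_relators k D n)
         (convex_event k D C \<delta> \<alpha> L N (\<Phi> n) n)"
        using alpha_convex_mono[OF \<beta>(3)] by (intro measure_pmf.finite_measure_mono) auto
      thus "norm (1 - measure_pmf.prob (random_relators k D n)
         (convex_event k D C \<delta> \<alpha> L N (\<Phi> n) n))
        \<le> norm (1 - measure_pmf.prob (random_relators k D n)
         (convex_event k D C \<delta> \<beta> L N (\<Phi> n) n))"
        by simp
    qed
    also have "(\<lambda>n. 1 - measure_pmf.prob (random_relators k D n)
         (convex_event k D C \<delta> \<beta> L N (\<Phi> n) n))
      \<in> O(\<lambda>n. exp (- (real n powr c)))"
      by (rule failure_bigo[OF assms(1,2) \<beta>(1,2) assms(5,6) C[unfolded K_def] e_def[unfolded K_def] \<rho>1 \<rho>2 \<rho>L L1(1) ln\<rho>[unfolded K_def] c])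
    finally show ?thesis .
  qed
  thus ?thesis using c(1) by blast
qed

end
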